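(* If $\mathbf{NP}\not\subseteq\mathbf{P_{/poly}}$, then $\texttt{TSP}\notin\mathbf{CF}$.
   Context: Binary strings of length $m$ are identified with vectors in $\{0,1\}^m$. $\mathbf{CF}$ is the set of languages $L\subseteq\{0,1\}^*$ for which there exists a polynomial $p$ such that for every $m\in\mathbb{N}$ there exist $A\in\mathbb{R}^{p(m)\times m}$, $B\in\mathbb{R}^{p(m)\times p(m)}$, $b\in\mathbb{R}^{p(m)}$ with $\operatorname{conv}(\{x\in L: |x|=m\})=\{x\in\mathbb{R}^m\mid\exists y\in\mathbb{R}^{p(m)}: Ax+By\le b\}$. With $K_n=([n],E_n)$ the complete undirected graph on $n$ nodes, $\texttt{TSP}=\bigcup_{n\in\mathbb{N}}\{\chi(C)\in\{0,1\}^{\binom n2}\mid C\subseteq E_n \text{ is a Hamiltonian cycle in } K_n\}$, where $\chi(C)$ is the characteristic vector of $C$. $\mathbf{P_{/poly}}$ is the class of languages decidable by families of polynomial-size Boolean circuits. *)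

theory Defs
  imports Complex_Main
begin

type_synonym word = "bool list"
type_synonym language = "word set"

definition poly_bounded :: "(nat \<Rightarrow> nat) \<Rightarrow> bool" where
  "poly_bounded f \<longleftrightarrow> (\<exists>c k::nat. \<forall>n. f n \<le> c * n ^ k + c)"

text \<open>A deterministic single-tape Turing machine with states 0..<nq and tape
 symbols 0..<ns (ns \<ge> 4).  Symbol 0 is the blank, 1 encodes bit False, 2 encodes
 bit True, 3 is a separator.  State 0 is the start state, 1 accepting, 2 rejecting;
 states 1 and 2 are halting.  The transition function returns
 (new state, written symbol, head move), the move being in {-1,0,1}.\<close>

record tm =
  nq :: nat
  ns :: nat
  delta :: "nat \<Rightarrow> nat \<Rightarrow> nat \<times> nat \<times> int"

definition valid_tm :: "tm \<Rightarrow> bool" where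
  "valid_tm M \<longleftrightarrow> 3 \<le> nq M \<and> 4 \<le> ns M \<and>
     (\<forall>q a. q < nq M \<and> a < ns M \<longrightarrow>
        (case delta M q a of (q', a', d) \<Rightarrow> q' < nq M \<and> a' < ns M \<and> d \<in> {-1, 0, 1}))"

type_synonym config = "nat \<times> (int \<Rightarrow> nat) \<times> int"

definition tm_step :: "tm \<Rightarrow> config \<Rightarrow> config" where
  "tm_step M c = (case c of (q, tp, h) \<Rightarrow>
     if q = 1 \<or> q = 2 then c
     else (case delta M q (tp h) of (q', a', d) \<Rightarrow> (q', tp(h := a'), h + d)))"

definition init_config :: "nat list \<Rightarrow> config" where
  "init_config w = (0, (\<lambda>i. if 0 \<le> i \<and> i < int (length w) then w ! nat i else 0), 0)"

definition tm_accepts_within :: "tm \<Rightarrow> nat list \<Rightarrow> nat \<Rightarrow> bool" where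
  "tm_accepts_within M w t \<longleftrightarrow> (\<exists>s\<le>t. fst ((tm_step M ^^ s) (init_config w)) = 1)"

definition enc_bits :: "word \<Rightarrow> nat list" where
  "enc_bits x = map (\<lambda>b. if b then 2 else 1) x"

definition NP :: "language set" where
  "NP = {L. \<exists>M p q. valid_tm M \<and> poly_bounded p \<and> poly_bounded q \<and>
          (\<forall>x. x \<in> L \<longleftrightarrow>
             (\<exists>w. length w \<le> q (length x) \<and>
                  tm_accepts_within M (enc_bits x @ [3] @ enc_bits w) (p (length x))))}"

datatype gate = Input nat | Const bool | Not nat | And nat nat | Or nat nat

text \<open>A circuit is a list of gates; gate k may only read wires i < k (reads of
 other wires yield False).  The output is the value of the last gate.\<close>

fun gate_val :: "bool list \<Rightarrow> word \<Rightarrow> gate \<Rightarrow> bool" where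
  "gate_val vs x (Input i) = (i < length x \<and> x ! i)"
| "gate_val vs x (Const b) = b"
| "gate_val vs x (Not i) = (\<not> (i < length vs \<and> vs ! i))"
| "gate_val vs x (And i j) = ((i < length vs \<and> vs ! i) \<and> (j < length vs \<and> vs ! j))"
| "gate_val vs x (Or i j) = ((i < length vs \<and> vs ! i) \<or> (j < length vs \<and> vs ! j))"

definition circuit_wires :: "gate list \<Rightarrow> word \<Rightarrow> bool list" where
  "circuit_wires C x = foldl (\<lambda>vs g. vs @ [gate_val vs x g]) [] C"

definition circuit_eval :: "gate list \<Rightarrow> word \<Rightarrow> bool" where
  "circuit_eval C x = (C \<noteq> [] \<and> last (circuit_wires C x))"

definition Ppoly :: "language set" where
  "Ppoly = {L. \<exists>p. poly_bounded p \<and>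
     (\<forall>n. \<exists>C. length C \<le> p n \<and> (\<forall>x. length x = n \<longrightarrow> (circuit_eval C x \<longleftrightarrow> x \<in> L)))}"

text \<open>Vectors of R^m are functions nat \<Rightarrow> real vanishing from index m on.\<close>

definition vec_of_word :: "word \<Rightarrow> (nat \<Rightarrow> real)" where
  "vec_of_word x = (\<lambda>i. if i < length x \<and> x ! i then 1 else 0)"

definition conv :: "(nat \<Rightarrow> real) set \<Rightarrow> (nat \<Rightarrow> real) set" where
  "conv S = {x. \<exists>F u. finite F \<and> F \<noteq> {} \<and> F \<subseteq> S \<and> (\<forall>s\<in>F. 0 \<le> u s) \<and>
                 sum u F = 1 \<and> x = (\<lambda>i. \<Sum>s\<in>F. u s * s i)}"

definition proj_polyhedron ::
  "nat \<Rightarrow> nat \<Rightarrow> (nat \<Rightarrow> nat \<Rightarrow> real) \<Rightarrow> (nat \<Rightarrow> nat \<Rightarrow> real) \<Rightarrow> (nat \<Rightarrow> real) \<Rightarrow> (nat \<Rightarrow> real) set" where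
  "proj_polyhedron m k A B b = {x. (\<forall>i\<ge>m. x i = 0) \<and>
     (\<exists>y. \<forall>r<k. (\<Sum>j<m. A r j * x j) + (\<Sum>j<k. B r j * y j) \<le> b r)}"

definition CF :: "language set" where
  "CF = {L. \<exists>p. poly_bounded p \<and>
     (\<forall>m. \<exists>A B b. conv (vec_of_word ` {x \<in> L. length x = m}) = proj_polyhedron m (p m) A B b)}"

definition edges_list :: "nat \<Rightarrow> nat set list" where
  "edges_list n = concat (map (\<lambda>i. map (\<lambda>j. {i, j}) [i+1..<n+1]) [1..<n+1])"

definition ham_cycle :: "nat \<Rightarrow> nat set set \<Rightarrow> bool" where
  "ham_cycle n C \<longleftrightarrow> 3 \<le> n \<and>
     (\<exists>vs. distinct vs \<and> set vs = {1..n} \<and>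
          C = {{vs ! i, vs ! ((i + 1) mod n)} | i. i < n})"

definition char_vec :: "nat \<Rightarrow> nat set set \<Rightarrow> word" where
  "char_vec n C = map (\<lambda>e. e \<in> C) (edges_list n)"

definition TSP :: language where
  "TSP = (\<Union>n. {char_vec n C | C. C \<subseteq> set (edges_list n) \<and> ham_cycle n C})"

end

theory Submission
  imports Defs
begin

text \<open>Suppose that the travelling salesman polytopes have extended formulations of polynomial size. We show that
  polynomial-size circuits can decide whether some tour avoids a set of forbidden edges and contains a set of forced
  edges. The number of violated conditions is an affine function on the polytope that is either \<open>0\<close> somewhere or at
  least \<open>1\<close> everywhere, so it suffices to solve a linear program approximately. Replace the polytope by the span of
  the vectors that list, for each tour, its edges and the slacks of the formulation, normalised to have maximum
  \<open>1\<close>. A perceptron that repeatedly adds the orthogonal projection of a violated coordinate vector reaches an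
  approximately feasible point of this span after polynomially many steps, even if all numbers are rounded to
  integers of polynomial size, and such a point can be moved into the polytope at small cost. No general algorithm
  for linear programming and no bound on the coefficients of the formulation is needed.

  Hence every problem in NP has polynomial-size circuits: unroll the verifying machine into a circuit, express its
  satisfiability as a formula in conjunctive normal form, reduce this to a directed Hamiltonian cycle in which the
  input bits only decide which arcs are allowed, and split every node by a forced edge.\<close>

section \<open>Circuits and polynomial bounds\<close>

text \<open>The coefficients of an extended formulation are arbitrary reals, so neither they nor the
  auxiliary variables can be handed to a circuit. A circuit needs only the span of the normalised
  vectors, and an orthogonal projection has entries of absolute value at most \<open>1\<close>
  however wild the formulation is. Such a matrix can be rounded and hardwired, because circuits may
  depend on the input length; the input merely selects which coordinates are constrained. The gap
  between cost \<open>0\<close> and cost \<open>1\<close> tolerates an error of inverse polynomial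
  size, so the quadratic dependence of the number of steps on the accuracy is affordable and all
  integers stay polynomially bounded. They are therefore kept in unary, one wire for each possible
  value of each coordinate, and no binary arithmetic has to be built. On the side of the reduction,
  the numbers of variables, clauses and nodes are fixed by the input length, the certificate length
  and the circuit, so that one formulation serves all inputs of that length.\<close>

lemma circuit_wires_snoc:
  "circuit_wires (C @ [g]) x = circuit_wires C x @ [gate_val (circuit_wires C x) x g]"
  by (simp add: circuit_wires_def)

lemma length_circuit_wires [simp]: "length (circuit_wires C x) = length C"
  by (induction C rule: rev_induct) (simp_all add: circuit_wires_snoc, simp add: circuit_wires_def)

lemma circuit_wires_append_nth:
  "i < length C \<Longrightarrow> circuit_wires (C @ D) x ! i = circuit_wires C x ! i"
proof (induction D rule: rev_induct)
  case (snoc g D)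
  then show ?case
    by (simp flip: append_assoc add: circuit_wires_snoc nth_append)
qed simp

lemma circuit_wires_nth:
  assumes "k < length C"
  shows "circuit_wires C x ! k = gate_val (take k (circuit_wires C x)) x (C ! k)"
  using assms
proof (induction C rule: rev_induct)
  case (snoc g C)
  then show ?case
    by (cases "k = length C") (auto simp: circuit_wires_snoc nth_append)
qed simp

definition computes :: "nat \<Rightarrow> nat \<Rightarrow> (word \<Rightarrow> bool) set \<Rightarrow> bool" where
  "computes n s F \<longleftrightarrow> (\<exists>C. length C \<le> s \<and>
     (\<forall>f\<in>F. \<exists>i<length C. \<forall>x. length x = n \<longrightarrow> circuit_wires C x ! i = f x))"

text \<open>\<open>buildable n F k H\<close>: whatever the circuit, as soon as it computes the functions in \<open>F\<close>, at most \<open>k\<close>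
  further gates suffice to compute those in \<open>H\<close> as well. Quantifying over all circuits makes the closure
  rules composable while sharing common subcircuits.\<close>

definition buildable :: "nat \<Rightarrow> (word \<Rightarrow> bool) set \<Rightarrow> nat \<Rightarrow> (word \<Rightarrow> bool) set \<Rightarrow> bool" where
  "buildable n F k H \<longleftrightarrow> (\<forall>s G. F \<subseteq> G \<longrightarrow> computes n s G \<longrightarrow> computes n (s + k) (H \<union> G))"

lemma computes_empty: "computes n s {}"
  by (auto simp: computes_def intro: exI[of _ "[]"])

lemma computes_mono: "computes n s F \<Longrightarrow> s \<le> s' \<Longrightarrow> F' \<subseteq> F \<Longrightarrow> computes n s' F'"
  unfolding computes_def by (auto; blast intro: order_trans)

text \<open>The gate \<open>g\<close> is chosen after the circuit, because the wires that it reads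
  depend on where the functions in \<open>F\<close> are computed.\<close>

lemma computes_gate:
  assumes "computes n s F"
    and "\<And>C. \<forall>f\<in>F. \<exists>i<length C. \<forall>x. length x = n \<longrightarrow> circuit_wires C x ! i = f x \<Longrightarrow>
           \<exists>g. \<forall>x. length x = n \<longrightarrow> gate_val (circuit_wires C x) x g = h x"
  shows "computes n (Suc s) (insert h F)"
proof -
  obtain C where C: "length C \<le> s"
    "\<forall>f\<in>F. \<exists>i<length C. \<forall>x. length x = n \<longrightarrow> circuit_wires C x ! i = f x"
    using assms(1) unfolding computes_def by blast
  obtain g where g: "\<forall>x. length x = n \<longrightarrow> gate_val (circuit_wires C x) x g = h x"
    using assms(2)[OF C(2)] by blast
  have "\<exists>i<length (C @ [g]). \<forall>x. length x = n \<longrightarrow> circuit_wires (C @ [g]) x ! i = f x"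
    if "f \<in> insert h F" for f
  proof (cases "f = h")
    case True
    then show ?thesis
      using g by (intro exI[of _ "length C"]) (simp add: circuit_wires_snoc nth_append)
  next
    case False
    then obtain i where "i < length C" "\<forall>x. length x = n \<longrightarrow> circuit_wires C x ! i = f x"
      using C(2) \<open>f \<in> insert h F\<close> by blast
    then show ?thesis
      by (intro exI[of _ i]) (simp add: circuit_wires_append_nth)
  qed
  then show ?thesis
    unfolding computes_def using C(1) by (intro exI[of _ "C @ [g]"]) auto
qed

text \<open>Only the last gate is the output, so the circuit is cut off right after the gate for
  \<open>f\<close>; earlier wires do not depend on later gates.\<close>

lemma computes_circuit:
  assumes "computes n s F" "f \<in> F"
  shows "\<exists>C. C \<noteq> [] \<and> length C \<le> s \<and> (\<forall>x. length x = n \<longrightarrow> circuit_eval C x = f x)"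
proof -
  obtain C i where C: "length C \<le> s" "i < length C"
    "\<forall>x. length x = n \<longrightarrow> circuit_wires C x ! i = f x"
    using assms unfolding computes_def by blast
  have "circuit_wires (take (Suc i) C) x ! i = circuit_wires C x ! i" for x
    using circuit_wires_append_nth[of i "take (Suc i) C" "drop (Suc i) C" x] C(2) by simp
  moreover have "take (Suc i) C \<noteq> []"
    using C(2) by auto
  moreover have "last (circuit_wires (take (Suc i) C) x) = circuit_wires (take (Suc i) C) x ! i" for x
  proof -
    have l: "length (circuit_wires (take (Suc i) C) x) = Suc i"
      using C(2) by simp
    then have "circuit_wires (take (Suc i) C) x \<noteq> []"
      by (metis Zero_not_Suc list.size(3))
    then show ?thesis
      using l by (simp add: last_conv_nth)
  qed
  ultimately show ?thesis
    using C by (intro exI[of _ "take (Suc i) C"]) (auto simp: circuit_eval_def)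
qed

lemma buildable_imp_computes: "buildable n {} k H \<Longrightarrow> computes n k H"
  unfolding buildable_def using computes_empty[of n 0] by force

lemma buildable_mono: "buildable n F k H \<Longrightarrow> F \<subseteq> F' \<Longrightarrow> k \<le> k' \<Longrightarrow> H' \<subseteq> H \<Longrightarrow> buildable n F' k' H'"
  unfolding buildable_def
proof (intro allI impI)
  fix s G
  assume "\<forall>s G. F \<subseteq> G \<longrightarrow> computes n s G \<longrightarrow> computes n (s + k) (H \<union> G)"
    and *: "F \<subseteq> F'" "k \<le> k'" "H' \<subseteq> H" "F' \<subseteq> G" "computes n s G"
  then have "computes n (s + k) (H \<union> G)"
    by (meson order_trans)
  then show "computes n (s + k') (H' \<union> G)"
    by (rule computes_mono) (use * in auto)
qed

lemma buildable_le: "buildable n F k H \<Longrightarrow> k \<le> k' \<Longrightarrow> buildable n F k' H"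
  by (erule buildable_mono) auto

lemma buildable_subset: "H \<subseteq> F \<Longrightarrow> buildable n F k H"
  unfolding buildable_def by (auto elim!: computes_mono)

lemma buildable_trans:
  assumes "buildable n F k H" "buildable n (F \<union> H) l H'"
  shows "buildable n F (k + l) (H \<union> H')"
  unfolding buildable_def
proof (intro allI impI)
  fix s G assume "F \<subseteq> G" "computes n s G"
  then have "computes n (s + k) (H \<union> G)"
    using assms(1) by (auto simp: buildable_def)
  moreover have "F \<union> H \<subseteq> H \<union> G"
    using \<open>F \<subseteq> G\<close> by auto
  ultimately have "computes n (s + k + l) (H' \<union> (H \<union> G))"
    using assms(2) unfolding buildable_def by blast
  then show "computes n (s + (k + l)) (H \<union> H' \<union> G)"
    by (rule computes_mono) auto
qed

text \<open>Correctness is demanded on words of length \<open>n\<close> only, so functions that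
  differ elsewhere are interchangeable.\<close>

lemma buildable_cong:
  assumes "buildable n F k {f}" "\<And>x. length x = n \<Longrightarrow> f x = g x"
  shows "buildable n F k {g}"
  unfolding buildable_def
proof (intro allI impI)
  fix s G assume "F \<subseteq> G" "computes n s G"
  then have "computes n (s + k) ({f} \<union> G)"
    using assms(1) by (simp add: buildable_def)
  then obtain C where C: "length C \<le> s + k"
    "\<And>h. h \<in> {f} \<union> G \<Longrightarrow> \<exists>i<length C. \<forall>x. length x = n \<longrightarrow> circuit_wires C x ! i = h x"
    unfolding computes_def by blast
  obtain i where i: "i < length C" "\<forall>x. length x = n \<longrightarrow> circuit_wires C x ! i = f x"
    using C(2)[of f] by auto
  have "\<exists>i<length C. \<forall>x. length x = n \<longrightarrow> circuit_wires C x ! i = h x" if "h \<in> {g} \<union> G" for h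
  proof (cases "h = g")
    case True
    show ?thesis
      unfolding True by (rule exI[of _ i]) (use i assms(2) in simp)
  next
    case False
    then show ?thesis
      using C(2)[of h] that by simp
  qed
  then show "computes n (s + k) ({g} \<union> G)"
    unfolding computes_def using C(1) by blast
qed

lemma buildable_UN:
  assumes "finite I" "\<And>i. i \<in> I \<Longrightarrow> buildable n F k (H i)"
  shows "buildable n F (card I * k) (\<Union>i\<in>I. H i)"
  using assms
proof (induction I rule: finite_induct)
  case empty
  then show ?case by (simp add: buildable_subset)
next
  case (insert i I)
  have "buildable n F (k + card I * k) (H i \<union> (\<Union>i\<in>I. H i))"
  proof (rule buildable_trans)
    show "buildable n F k (H i)" using insert by simp
    show "buildable n (F \<union> H i) (card I * k) (\<Union>i\<in>I. H i)"
      by (rule buildable_mono[OF insert.IH]) (use insert in auto)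
  qed
  then show ?case
    using insert by simp
qed

lemma buildable_trans_drop:
  assumes "buildable n F k H" "buildable n (F \<union> H) l H'"
  shows "buildable n F (k + l) H'"
  using buildable_trans[OF assms] by (rule buildable_mono) auto

lemma buildable_singletons:
  assumes "finite I" "\<And>i. i \<in> I \<Longrightarrow> buildable n F k {f i}"
  shows "buildable n F (card I * k) (f ` I)"
  using buildable_UN[of I n F k "\<lambda>i. {f i}"] assms by (simp add: UNION_singleton_eq_range)

text \<open>Each stage reads only \<open>F\<close> and the shared wires of the previous stage, so
  the cost grows linearly with the number of steps.\<close>

lemma buildable_iter:
  assumes "\<And>t. t < T \<Longrightarrow> buildable n (F \<union> S t) k (S (Suc t))"
  shows "buildable n (F \<union> S 0) (T * k) (S T)"
  using assms
proof (induction T)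
  case 0
  then show ?case by (simp add: buildable_subset)
next
  case (Suc T)
  have "buildable n (F \<union> S 0) (T * k + k) (S T \<union> S (Suc T))"
  proof (rule buildable_trans)
    show "buildable n (F \<union> S 0) (T * k) (S T)"
      by (rule Suc.IH) (simp add: Suc.prems)
    show "buildable n (F \<union> S 0 \<union> S T) k (S (Suc T))"
      by (rule buildable_mono[OF Suc.prems[of T]]) auto
  qed
  then show ?case
    by (rule buildable_mono) auto
qed

lemma buildable_gate1:
  assumes "\<And>C. \<exists>g. \<forall>x. length x = n \<longrightarrow> gate_val (circuit_wires C x) x g = h x"
  shows "buildable n F 1 {h}"
  unfolding buildable_def using computes_gate assms by auto

lemma buildable_const: "buildable n F 1 {\<lambda>x. b}"
  by (rule buildable_gate1) (auto intro: exI[of _ "Const b"])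

lemma buildable_input: "i < n \<Longrightarrow> buildable n F 1 {\<lambda>x. x ! i}"
  by (rule buildable_gate1) (auto intro: exI[of _ "Input i"])

lemma buildable_not:
  assumes "buildable n F k {f}"
  shows "buildable n F (Suc k) {\<lambda>x. \<not> f x}"
proof -
  have "buildable n (F \<union> {f}) 1 {\<lambda>x. \<not> f x}"
    unfolding buildable_def
  proof (intro allI impI)
    fix s G assume *: "F \<union> {f} \<subseteq> G" "computes n s G"
    have "computes n (Suc s) (insert (\<lambda>x. \<not> f x) G)"
    proof (rule computes_gate[OF *(2)])
      fix C assume "\<forall>f\<in>G. \<exists>i<length C. \<forall>x. length x = n \<longrightarrow> circuit_wires C x ! i = f x"
      then obtain i where "i < length C" "\<forall>x. length x = n \<longrightarrow> circuit_wires C x ! i = f x"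
        using * by blast
      then show "\<exists>g. \<forall>x. length x = n \<longrightarrow> gate_val (circuit_wires C x) x g = (\<not> f x)"
        by (intro exI[of _ "Not i"]) simp
    qed
    then show "computes n (s + 1) ({\<lambda>x. \<not> f x} \<union> G)" by simp
  qed
  from buildable_trans[OF assms this] show ?thesis
    by (rule buildable_mono) auto
qed

lemma buildable_and:
  assumes "buildable n F k {f}" "buildable n F l {g}"
  shows "buildable n F (Suc (k + l)) {\<lambda>x. f x \<and> g x}"
proof -
  have "buildable n (F \<union> {f} \<union> {g}) 1 {\<lambda>x. f x \<and> g x}"
    unfolding buildable_def
  proof (intro allI impI)
    fix s G assume *: "F \<union> {f} \<union> {g} \<subseteq> G" "computes n s G"
    have "computes n (Suc s) (insert (\<lambda>x. f x \<and> g x) G)"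
    proof (rule computes_gate[OF *(2)])
      fix C assume **: "\<forall>f\<in>G. \<exists>i<length C. \<forall>x. length x = n \<longrightarrow> circuit_wires C x ! i = f x"
      obtain i where "i < length C" "\<forall>x. length x = n \<longrightarrow> circuit_wires C x ! i = f x"
        using * ** by blast
      moreover obtain j where "j < length C" "\<forall>x. length x = n \<longrightarrow> circuit_wires C x ! j = g x"
        using * ** by blast
      ultimately show "\<exists>h. \<forall>x. length x = n \<longrightarrow> gate_val (circuit_wires C x) x h = (f x \<and> g x)"
        by (intro exI[of _ "And i j"]) simp
    qed
    then show "computes n (s + 1) ({\<lambda>x. f x \<and> g x} \<union> G)" by simp
  qed
  moreover have "buildable n (F \<union> {f}) l {g}"
    using assms(2) by (rule buildable_mono) auto
  ultimately have "buildable n (F \<union> {f}) (l + 1) ({g} \<union> {\<lambda>x. f x \<and> g x})"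
    by (rule buildable_trans[rotated])
  from buildable_trans[OF assms(1) this] show ?thesis
    by (rule buildable_mono) auto
qed

text \<open>De Morgan; the \<open>4\<close> counts three negations and one conjunction.\<close>

lemma buildable_or:
  assumes "buildable n F k {f}" "buildable n F l {g}"
  shows "buildable n F (k + l + 4) {\<lambda>x. f x \<or> g x}"
  by (rule buildable_mono[OF buildable_not[OF buildable_and[OF buildable_not[OF assms(1)] buildable_not[OF assms(2)]]]]) auto

lemma buildable_ex:
  assumes "finite I" "\<And>i. i \<in> I \<Longrightarrow> buildable n F k {f i}"
  shows "buildable n F (card I * (k + 4) + 1) {\<lambda>x. \<exists>i\<in>I. f i x}"
  using assms
proof (induction I rule: finite_induct)
  case empty
  then show ?case using buildable_const[of n F False] by simp
next
  case (insert i I)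
  have "buildable n F (k + (card I * (k + 4) + 1) + 4) {\<lambda>x. f i x \<or> (\<exists>i\<in>I. f i x)}"
    by (rule buildable_or) (use insert in auto)
  then show ?case
    by (rule buildable_mono) (use insert in auto)
qed

section \<open>Closure properties of polynomial bounds\<close>

lemma poly_bounded_const: "poly_bounded (\<lambda>n. c)"
  unfolding poly_bounded_def by (intro exI[of _ c] exI[of _ 0]) auto

lemma poly_bounded_id: "poly_bounded (\<lambda>n. n)"
  unfolding poly_bounded_def by (intro exI[of _ 1] exI[of _ 1]) auto

text \<open>With a single term in \<open>Suc n\<close>, products of bounds have no mixed terms and a
  larger exponent never decreases the bound.\<close>

lemma poly_bounded_Suc_power: "poly_bounded f \<longleftrightarrow> (\<exists>c k. \<forall>n. f n \<le> c * Suc n ^ k)"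
proof
  assume "poly_bounded f"
  then obtain c k where f: "\<And>n. f n \<le> c * n ^ k + c"
    unfolding poly_bounded_def by blast
  have "f n \<le> (2 * c) * Suc n ^ k" for n
  proof -
    have "c * n ^ k \<le> c * Suc n ^ k"
      by (intro mult_le_mono2 power_mono) auto
    moreover have "c * 1 \<le> c * Suc n ^ k"
      by (intro mult_le_mono2) simp
    ultimately show ?thesis
      using f[of n] unfolding mult.assoc by linarith
  qed
  then show "\<exists>c k. \<forall>n. f n \<le> c * Suc n ^ k" by blast
next
  assume "\<exists>c k. \<forall>n. f n \<le> c * Suc n ^ k"
  then obtain c k where f: "\<And>n. f n \<le> c * Suc n ^ k" by blast
  have "f n \<le> (c * 2 ^ k) * n ^ k + (c * 2 ^ k)" for n
  proof (cases "n = 0")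
    case True
    have "c * 1 \<le> c * 2 ^ k" by (rule mult_le_mono2) simp
    then show ?thesis
      using f[of 0] True by (simp only: power_one mult_1_right One_nat_def[symmetric])
  next
    case False
    then have "Suc n ^ k \<le> (2 * n) ^ k" by (intro power_mono) auto
    then have "c * Suc n ^ k \<le> c * (2 * n) ^ k" by (rule mult_le_mono2)
    also have "\<dots> = (c * 2 ^ k) * n ^ k" by (simp only: power_mult_distrib mult.assoc)
    finally show ?thesis using f[of n] by linarith
  qed
  then show "poly_bounded f" unfolding poly_bounded_def by blast
qed

lemma poly_bounded_mult:
  assumes "poly_bounded f" "poly_bounded g"
  shows "poly_bounded (\<lambda>n. f n * g n)"
proof -
  obtain c k where f: "\<And>n. f n \<le> c * Suc n ^ k"
    using assms(1) unfolding poly_bounded_Suc_power by blast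
  obtain d l where g: "\<And>n. g n \<le> d * Suc n ^ l"
    using assms(2) unfolding poly_bounded_Suc_power by blast
  have "f n * g n \<le> (c * d) * Suc n ^ (k + l)" for n
    using mult_le_mono[OF f[of n] g[of n]] by (simp only: power_add ac_simps)
  then show ?thesis unfolding poly_bounded_Suc_power by blast
qed

lemma poly_bounded_add:
  assumes "poly_bounded f" "poly_bounded g"
  shows "poly_bounded (\<lambda>n. f n + g n)"
proof -
  obtain c k where f: "\<And>n. f n \<le> c * Suc n ^ k"
    using assms(1) unfolding poly_bounded_Suc_power by blast
  obtain d l where g: "\<And>n. g n \<le> d * Suc n ^ l"
    using assms(2) unfolding poly_bounded_Suc_power by blast
  have "f n + g n \<le> (c + d) * Suc n ^ (k + l)" for n
  proof -
    have "c * Suc n ^ k \<le> c * Suc n ^ (k + l)" "d * Suc n ^ l \<le> d * Suc n ^ (k + l)"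
      by (intro mult_le_mono2 power_increasing; simp)+
    then show ?thesis
      using f[of n] g[of n] unfolding add_mult_distrib by linarith
  qed
  then show ?thesis unfolding poly_bounded_Suc_power by blast
qed

lemma poly_bounded_power: "poly_bounded f \<Longrightarrow> poly_bounded (\<lambda>n. f n ^ k)"
  by (induction k) (auto intro: poly_bounded_const poly_bounded_mult)

section \<open>A perceptron for approximate linear feasibility\<close>

text \<open>\<open>P\<close> is the matrix of the orthogonal projection onto the span of the vectors \<open>\<zeta> v\<close>, built by
  Gram-Schmidt: its columns lie in the span, and pairing with column \<open>j\<close> evaluates coordinate \<open>j\<close> there.\<close>

lemma reproducing_kernel:
  fixes \<zeta> :: "'v \<Rightarrow> nat \<Rightarrow> real"
  assumes "finite Z"
  shows "\<exists>P :: nat \<Rightarrow> nat \<Rightarrow> real.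
     (\<forall>j<D. \<exists>c. \<forall>i<D. P i j = (\<Sum>v\<in>Z. c v * \<zeta> v i)) \<and>
     (\<forall>v\<in>Z. \<forall>j<D. (\<Sum>i<D. \<zeta> v i * P i j) = \<zeta> v j)"
  using assms
proof (induction Z rule: finite_induct)
  case empty
  show ?case by (rule exI[of _ "\<lambda>_ _. 0"]) simp
next
  case (insert z Z)
  then obtain P where P: "\<And>j. j < D \<Longrightarrow> \<exists>c. \<forall>i<D. P i j = (\<Sum>v\<in>Z. c v * \<zeta> v i)"
    "\<And>v j. v \<in> Z \<Longrightarrow> j < D \<Longrightarrow> (\<Sum>i<D. \<zeta> v i * P i j) = \<zeta> v j"
    by blast
  obtain C where C: "\<And>i j. i < D \<Longrightarrow> j < D \<Longrightarrow> P i j = (\<Sum>v\<in>Z. C j v * \<zeta> v i)"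
    using P(1) by metis
  define p where "p j = (\<Sum>i<D. \<zeta> z i * P i j)" for j
  define w where "w j = \<zeta> z j - p j" for j
  define N where "N = (\<Sum>i<D. w i * w i)"
  \<comment> \<open>Column \<open>l\<close> lies in the span, so pairing it with column
    \<open>j\<close> evaluates it at \<open>j\<close>. The left side is symmetric in
    \<open>j\<close> and \<open>l\<close>, which yields the symmetry of \<open>P\<close>
    below.\<close>
  have PP: "(\<Sum>i<D. P i l * P i j) = P j l" if "j < D" "l < D" for j l
  proof -
    have "(\<Sum>i<D. P i l * P i j) = (\<Sum>i<D. \<Sum>v\<in>Z. C l v * \<zeta> v i * P i j)"
      by (intro sum.cong refl) (simp add: C that sum_distrib_right)
    also have "\<dots> = (\<Sum>v\<in>Z. C l v * (\<Sum>i<D. \<zeta> v i * P i j))"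
      by (subst sum.swap) (simp add: sum_distrib_left mult.assoc)
    also have "\<dots> = P j l"
      using that by (simp add: P(2)) (simp add: C)
    finally show ?thesis .
  qed
  have sym: "P i j = P j i" if "i < D" "j < D" for i j
    using PP[of i j] PP[of j i] that by (simp add: mult.commute)
  have wP: "(\<Sum>i<D. w i * P i j) = 0" if "j < D" for j
  proof -
    have "(\<Sum>i<D. p i * P i j) = (\<Sum>i<D. \<Sum>l<D. \<zeta> z l * (P l i * P i j))"
      by (simp add: p_def sum_distrib_right mult.assoc)
    also have "\<dots> = (\<Sum>l<D. \<zeta> z l * (\<Sum>i<D. P i l * P i j))"
      by (subst sum.swap) (auto simp: sum_distrib_left intro!: sum.cong sym)
    also have "\<dots> = (\<Sum>l<D. \<zeta> z l * P j l)"
      using that by (intro sum.cong) (auto simp: PP)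
    also have "\<dots> = p j"
      unfolding p_def using that by (intro sum.cong) (auto simp: sym)
    finally show ?thesis
      by (simp add: w_def left_diff_distrib sum_subtractf flip: p_def)
  qed
  have wZ: "(\<Sum>i<D. \<zeta> v i * w i) = 0" if "v \<in> Z" for v
  proof -
    have "(\<Sum>i<D. \<zeta> v i * w i) = (\<Sum>i<D. (\<Sum>l<D. \<zeta> v l * P l i) * w i)"
      using that by (intro sum.cong) (auto simp: P(2))
    also have "\<dots> = (\<Sum>l<D. \<zeta> v l * (\<Sum>i<D. w i * P l i))"
      by (simp only: sum_distrib_right sum_distrib_left, subst sum.swap) (simp add: ac_simps)
    also have "\<dots> = (\<Sum>l<D. \<zeta> v l * (\<Sum>i<D. w i * P i l))"
      by (intro sum.cong refl arg_cong2[of _ _ _ _ "(*)"]) (auto intro: sym)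
    also have "\<dots> = 0"
      by (simp add: wP)
    finally show ?thesis .
  qed
  have zw: "(\<Sum>i<D. \<zeta> z i * w i) = N"
  proof -
    have "(\<Sum>i<D. p i * w i) = (\<Sum>l<D. \<zeta> z l * (\<Sum>i<D. w i * P l i))"
      by (simp only: p_def sum_distrib_right sum_distrib_left, subst sum.swap) (simp add: ac_simps)
    also have "\<dots> = (\<Sum>l<D. \<zeta> z l * (\<Sum>i<D. w i * P i l))"
      by (intro sum.cong refl arg_cong2[of _ _ _ _ "(*)"]) (auto intro: sym)
    also have "\<dots> = 0"
      by (simp add: wP)
    finally have "(\<Sum>i<D. p i * w i) = 0" .
    moreover have "N = (\<Sum>i<D. \<zeta> z i * w i) - (\<Sum>i<D. p i * w i)"
      unfolding N_def w_def by (simp add: left_diff_distrib sum_subtractf)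
    ultimately show ?thesis by simp
  qed
  \<comment> \<open>\<open>p\<close> is the projection of the new vector onto the old span and
    \<open>w\<close> the residual; the projection onto \<open>w\<close> is added. If the new vector
    already lies in the span, then \<open>N = 0\<close> and division by zero makes the update
    vanish.\<close>
  define Q where "Q i j = P i j + w i * w j / N" for i j
  have pC: "p i = (\<Sum>v\<in>Z. (\<Sum>l<D. \<zeta> z l * C l v) * \<zeta> v i)" if "i < D" for i
  proof -
    have "p i = (\<Sum>l<D. \<zeta> z l * P i l)"
      unfolding p_def using that by (intro sum.cong) (auto simp: sym)
    also have "\<dots> = (\<Sum>l<D. \<zeta> z l * (\<Sum>v\<in>Z. C l v * \<zeta> v i))"
      using that by (intro sum.cong) (auto simp: C)
    also have "\<dots> = (\<Sum>v\<in>Z. (\<Sum>l<D. \<zeta> z l * C l v) * \<zeta> v i)"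
      by (simp only: sum_distrib_right sum_distrib_left, subst sum.swap) (simp add: ac_simps)
    finally show ?thesis .
  qed
  have "\<exists>c. \<forall>i<D. Q i j = (\<Sum>v\<in>insert z Z. c v * \<zeta> v i)" if "j < D" for j
  proof (intro exI allI impI)
    fix i assume "i < D"
    let ?c = "\<lambda>v. if v = z then w j / N else C j v - w j / N * (\<Sum>l<D. \<zeta> z l * C l v)"
    have "(\<Sum>v\<in>Z. ?c v * \<zeta> v i) = (\<Sum>v\<in>Z. C j v * \<zeta> v i - w j / N * ((\<Sum>l<D. \<zeta> z l * C l v) * \<zeta> v i))"
      using insert.hyps by (intro sum.cong) (auto simp: algebra_simps)
    also have "\<dots> = P i j - w j / N * p i"
      by (simp only: sum_subtractf pC[OF \<open>i < D\<close>] C[OF \<open>i < D\<close> \<open>j < D\<close>] sum_distrib_left)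
    finally have "(\<Sum>v\<in>insert z Z. ?c v * \<zeta> v i) = w j / N * \<zeta> z i + (P i j - w j / N * p i)"
      using insert.hyps by simp
    also have "\<dots> = Q i j"
      by (simp add: Q_def w_def algebra_simps diff_divide_distrib add_divide_distrib)
    finally show "Q i j = (\<Sum>v\<in>insert z Z. ?c v * \<zeta> v i)" by simp
  qed
  moreover have "(\<Sum>i<D. \<zeta> v i * Q i j) = \<zeta> v j" if "v \<in> insert z Z" "j < D" for v j
  proof -
    have *: "(\<Sum>i<D. \<zeta> v i * Q i j) = (\<Sum>i<D. \<zeta> v i * P i j) + w j / N * (\<Sum>i<D. \<zeta> v i * w i)"
      by (simp add: Q_def algebra_simps sum.distrib sum_distrib_left)
    show ?thesis
    proof (cases "v = z")
      case True
      have "w j = 0" if "N = 0"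
      proof -
        have "w j * w j = 0"
          using that \<open>j < D\<close> unfolding N_def by (subst (asm) sum_nonneg_eq_0_iff) auto
        then show ?thesis by simp
      qed
      then show ?thesis
        using *[unfolded True zw] True
        by (cases "N = 0") (auto simp: w_def simp flip: p_def)
    next
      case False
      then show ?thesis
        unfolding * using that by (simp add: P(2) wZ)
    qed
  qed
  ultimately show ?case by blast
qed

text \<open>Pairing a column, which lies in the span, with itself evaluates it at its own index, so
  \<open>P j j\<close> is a squared norm. One summand is \<open>(P j j)\<^sup>2\<close>, hence
  \<open>P j j \<le> 1\<close>, and this bounds every entry independently of the size of the
  vectors.\<close>

lemma kernel_properties:
  fixes P :: "nat \<Rightarrow> nat \<Rightarrow> real"
  assumes P1: "\<And>i j. i < D \<Longrightarrow> j < D \<Longrightarrow> P i j = (\<Sum>v\<in>Z. C j v * \<zeta> v i)"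
    and P2: "\<And>v j. v \<in> Z \<Longrightarrow> j < D \<Longrightarrow> (\<Sum>i<D. \<zeta> v i * P i j) = \<zeta> v j"
    and "i < D" "j < D"
  shows "(\<Sum>i<D. (P i j)\<^sup>2) = P j j" "P j j \<le> 1" "\<bar>P i j\<bar> \<le> 1"
proof -
  have span: "(\<Sum>i<D. (\<Sum>v\<in>Z. c v * \<zeta> v i) * P i j) = (\<Sum>v\<in>Z. c v * \<zeta> v j)" for c
  proof -
    have "(\<Sum>i<D. (\<Sum>v\<in>Z. c v * \<zeta> v i) * P i j) = (\<Sum>v\<in>Z. c v * (\<Sum>i<D. \<zeta> v i * P i j))"
      by (simp only: sum_distrib_right sum_distrib_left, subst sum.swap) (simp add: ac_simps)
    then show ?thesis using \<open>j < D\<close> by (simp add: P2)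
  qed
  show *: "(\<Sum>i<D. (P i j)\<^sup>2) = P j j"
    using span[of "C j"] \<open>j < D\<close> by (simp add: P1 power2_eq_square)
  have le: "(P i j)\<^sup>2 \<le> P j j" if "i < D" for i
    unfolding *[symmetric] using that by (intro member_le_sum) auto
  have "P j j * P j j \<le> P j j * 1"
    using le[OF \<open>j < D\<close>] by (simp add: power2_eq_square)
  moreover have "P j j \<ge> 0"
    unfolding *[symmetric] by (simp add: sum_nonneg)
  ultimately show 1: "P j j \<le> 1"
    by (metis less_eq_real_def mult_le_cancel_left_pos zero_le_one)
  have "(P i j)\<^sup>2 \<le> 1\<^sup>2"
    using le[OF \<open>i < D\<close>] 1 by simp
  then show "\<bar>P i j\<bar> \<le> 1"
    using abs_le_square_iff[of "P i j" 1] by simp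
qed

section \<open>The rounded perceptron and its exact counterpart\<close>

definition violated :: "nat \<Rightarrow> (nat \<Rightarrow> int) \<Rightarrow> (nat \<Rightarrow> bool) \<Rightarrow> (nat \<Rightarrow> int) \<Rightarrow> nat \<Rightarrow> bool" where
  "violated D thr act V j \<longleftrightarrow> j < D \<and> act j \<and> V j < thr j"

text \<open>The analysis would tolerate any violated coordinate; the least one is a deterministic
  choice that a circuit can make.\<close>

primrec perceptron ::
    "nat \<Rightarrow> (nat \<Rightarrow> int) \<Rightarrow> (nat \<Rightarrow> nat \<Rightarrow> int) \<Rightarrow> (nat \<Rightarrow> bool) \<Rightarrow> nat \<Rightarrow> nat \<Rightarrow> int" where
  "perceptron D thr R act 0 = (\<lambda>i. 0)"
| "perceptron D thr R act (Suc t) =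
     (let V = perceptron D thr R act t in
      if \<exists>j. violated D thr act V j
      then (\<lambda>i. V i + R i (LEAST j. violated D thr act V j)) else V)"

text \<open>A polynomial bound on the entries allows a circuit to keep one wire for every possible
  value.\<close>

lemma perceptron_bound:
  assumes "\<And>i j. i < D \<Longrightarrow> j < D \<Longrightarrow> \<bar>R i j\<bar> \<le> K" "i < D" "0 \<le> K"
  shows "\<bar>perceptron D thr R act t i\<bar> \<le> int t * K"
proof (induction t)
  case (Suc t)
  let ?V = "perceptron D thr R act t"
  show ?case
  proof (cases "\<exists>j. violated D thr act ?V j")
    case True
    then have "violated D thr act ?V (LEAST j. violated D thr act ?V j)"
      by (rule LeastI_ex)
    then have "\<bar>R i (LEAST j. violated D thr act ?V j)\<bar> \<le> K"
      using assms by (auto simp: violated_def)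
    then show ?thesis
      using Suc True by (simp add: Let_def algebra_simps)
  next
    case False
    then have "perceptron D thr R act (Suc t) = ?V"
      by (simp only: perceptron.simps Let_def if_False)
    then show ?thesis
      using Suc assms(3) by (simp only: of_nat_Suc) (simp add: algebra_simps)
  qed
qed simp

text \<open>Without a violation the iterate is a fixed point. Hence a violation at time
  \<open>T\<close> means that all earlier steps were genuine updates.\<close>

lemma perceptron_stops:
  assumes "\<not> (\<exists>j. violated D thr act (perceptron D thr R act s) j)" "s \<le> t"
  shows "perceptron D thr R act t = perceptron D thr R act s"
  using assms(2) by (induction t rule: dec_induct) (use assms(1) in \<open>auto simp: Let_def\<close>)

text \<open>The exact iterate \<open>u\<close> below lives in the span and is scaled so that a feasible point \<open>\<zeta> v\<close> becomes
  \<open>L * \<zeta> v\<close>; the integers \<open>V\<close> track \<open>T * u\<close> with an error of at most \<open>1\<close> per step. Every step on a coordinate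
  below its threshold brings \<open>u\<close> closer to \<open>L * \<zeta> v\<close>, by at least \<open>1\<close> in squared distance, and
  that distance is at most \<open>L\<^sup>2 * D\<close> initially.\<close>

locale feasibility =
  fixes Z :: "'v set" and \<zeta> :: "'v \<Rightarrow> nat \<Rightarrow> real" and D L T :: nat
    and P :: "nat \<Rightarrow> nat \<Rightarrow> real" and C :: "nat \<Rightarrow> 'v \<Rightarrow> real" and \<theta> :: "nat \<Rightarrow> int"
    and R :: "nat \<Rightarrow> nat \<Rightarrow> int" and thr :: "nat \<Rightarrow> int"
  assumes L: "0 < L"
    and P1: "\<And>i j. i < D \<Longrightarrow> j < D \<Longrightarrow> P i j = (\<Sum>v\<in>Z. C j v * \<zeta> v i)"
    and P2: "\<And>v j. v \<in> Z \<Longrightarrow> j < D \<Longrightarrow> (\<Sum>i<D. \<zeta> v i * P i j) = \<zeta> v j"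
    and \<zeta>: "\<And>v i. v \<in> Z \<Longrightarrow> i < D \<Longrightarrow> \<bar>\<zeta> v i\<bar> \<le> 1"
    and T: "T = L\<^sup>2 * D + 1"
    and R: "\<And>i j. R i j = \<lfloor>real T * P i j\<rfloor>"
    and thr: "\<And>j. thr j = int T * (int L * \<theta> j - 2)"
begin

lemma T_pos: "0 < T"
  by (simp add: T)

lemma R_bound: "i < D \<Longrightarrow> j < D \<Longrightarrow> \<bar>R i j\<bar> \<le> int T"
proof -
  assume "i < D" "j < D"
  then have "\<bar>P i j\<bar> \<le> 1"
    by (intro kernel_properties(3)[where Z = Z and C = C and \<zeta> = \<zeta> and D = D] P1 P2)
  then have "real T * P i j \<le> real T" "- real T \<le> real T * P i j"
    using mult_left_mono[of "P i j" 1 "real T"] mult_left_mono[of "-1" "P i j" "real T"] by auto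
  then show ?thesis
    unfolding R abs_le_iff by (auto simp: floor_le_iff le_floor_iff) linarith
qed

context
  fixes act :: "nat \<Rightarrow> bool"
begin

abbreviation "V \<equiv> perceptron D thr R act"

text \<open>The exact iterate copies the selections made by the rounded one, so the two differ only
  by the rounding of the added columns.\<close>

primrec u :: "nat \<Rightarrow> nat \<Rightarrow> real" where
  "u 0 = (\<lambda>i. 0)"
| "u (Suc t) = (if \<exists>j. violated D thr act (V t) j
      then (\<lambda>i. u t i + P i (LEAST j. violated D thr act (V t) j)) else u t)"

lemma V_approx: "i < D \<Longrightarrow> \<bar>real_of_int (V t i) - real T * u t i\<bar> \<le> real t"
proof (induction t)
  case (Suc t)
  define l where "l = (LEAST j. violated D thr act (V t) j)"
  have "\<bar>real_of_int (R i l) - real T * P i l\<bar> \<le> 1"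
    unfolding R by linarith
  then show ?case
    using Suc by (auto simp: Let_def l_def[symmetric] algebra_simps)
qed simp

lemma u_span: "\<exists>c. \<forall>i<D. u t i = (\<Sum>v\<in>Z. c v * \<zeta> v i)"
proof (induction t)
  case 0
  show ?case by (rule exI[of _ "\<lambda>_. 0"]) simp
next
  case (Suc t)
  show ?case
  proof (cases "\<exists>j. violated D thr act (V t) j")
    case True
    define l where "l = (LEAST j. violated D thr act (V t) j)"
    have "violated D thr act (V t) l"
      unfolding l_def using True by (rule LeastI_ex)
    then have l: "l < D" by (simp add: violated_def)
    obtain c where "\<And>i. i < D \<Longrightarrow> u t i = (\<Sum>v\<in>Z. c v * \<zeta> v i)"
      using Suc by blast
    then have "\<forall>i<D. u (Suc t) i = (\<Sum>v\<in>Z. (c v + C l v) * \<zeta> v i)"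
      using True l by (simp add: l_def[symmetric] P1 distrib_right sum.distrib)
    then show ?thesis by (intro exI[of _ "\<lambda>v. c v + C l v"])
  next
    case False
    then have "u (Suc t) = u t" by (simp only: u.simps if_False)
    then show ?thesis using Suc by (simp only:)
  qed
qed

text \<open>By the reproducing property the inner product with column \<open>l\<close> is coordinate
  \<open>l\<close>, so the squared distance changes by minus twice the difference in coordinate
  \<open>l\<close>, plus the squared norm of the column. That difference exceeds \<open>1\<close>
  and the norm is at most \<open>1\<close>.\<close>

lemma progress:
  assumes "\<zeta>' \<in> Z" "\<And>i. i < D \<Longrightarrow> act i \<Longrightarrow> real_of_int (\<theta> i) \<le> \<zeta> \<zeta>' i"
    and "\<exists>j. violated D thr act (V t) j" "t \<le> T"
  shows "(\<Sum>i<D. (real L * \<zeta> \<zeta>' i - u (Suc t) i)\<^sup>2) \<le> (\<Sum>i<D. (real L * \<zeta> \<zeta>' i - u t i)\<^sup>2) - 1"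
proof -
  define l where "l = (LEAST j. violated D thr act (V t) j)"
  have "violated D thr act (V t) l"
    unfolding l_def using assms(3) by (rule LeastI_ex)
  then have l: "l < D" "act l" "V t l < thr l" by (auto simp: violated_def)
  have Tpos: "real T > 0" using T_pos by simp
  \<comment> \<open>The threshold lies \<open>2 * T\<close> below the scaled target; an accumulated
    rounding error of at most \<open>T\<close> leaves a deficit of more than
    \<open>1\<close>.\<close>
  have ul: "u t l < real L * \<theta> l - 1"
  proof -
    have "real_of_int (V t l) < real_of_int (thr l)"
      using l by simp
    then have "real T * u t l - real t < real T * (real L * \<theta> l - 2)"
      using V_approx[OF l(1), of t] by (simp add: thr)
    then have "real T * u t l < real T * (real L * \<theta> l - 1)"
      using assms(4) by (simp add: algebra_simps)
    then show ?thesis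
      using Tpos by simp
  qed
  obtain c where c: "\<And>i. i < D \<Longrightarrow> u t i = (\<Sum>v\<in>Z. c v * \<zeta> v i)"
    using u_span by blast
  have uP: "(\<Sum>i<D. u t i * P i l) = u t l"
  proof -
    have "(\<Sum>i<D. u t i * P i l) = (\<Sum>i<D. \<Sum>v\<in>Z. c v * (\<zeta> v i * P i l))"
      by (simp add: c sum_distrib_right mult.assoc)
    also have "\<dots> = (\<Sum>v\<in>Z. c v * (\<Sum>i<D. \<zeta> v i * P i l))"
      by (subst sum.swap) (simp add: sum_distrib_left)
    finally show ?thesis
      using l(1) by (simp add: P2 c)
  qed
  have PP: "(\<Sum>i<D. (P i l)\<^sup>2) \<le> 1"
    using kernel_properties(1,2)[where Z = Z and C = C and \<zeta> = \<zeta> and D = D and P = P, OF P1 P2 l(1) l(1)] by simp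
  have "(\<Sum>i<D. (real L * \<zeta> \<zeta>' i - u (Suc t) i)\<^sup>2) =
    (\<Sum>i<D. (real L * \<zeta> \<zeta>' i - u t i)\<^sup>2 - 2 * real L * (\<zeta> \<zeta>' i * P i l) + 2 * (u t i * P i l) + (P i l)\<^sup>2)"
    using assms(3) by (intro sum.cong) (auto simp: l_def[symmetric] power2_eq_square algebra_simps)
  also have "\<dots> = (\<Sum>i<D. (real L * \<zeta> \<zeta>' i - u t i)\<^sup>2) - 2 * real L * \<zeta> \<zeta>' l + 2 * u t l + (\<Sum>i<D. (P i l)\<^sup>2)"
    using P2[OF assms(1) l(1)] uP
    by (simp add: sum.distrib sum_subtractf flip: sum_distrib_left)
  also have "\<dots> \<le> (\<Sum>i<D. (real L * \<zeta> \<zeta>' i - u t i)\<^sup>2) - 1"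
  proof -
    have "real L * \<theta> l \<le> real L * \<zeta> \<zeta>' l"
      using assms(2) l by (intro mult_left_mono) auto
    then show ?thesis
      using PP ul by linarith
  qed
  finally show ?thesis .
qed

text \<open>The squared distance is initially at most \<open>L\<^sup>2 * D = T - 1\<close>, so
  \<open>T\<close> updates would make it negative.\<close>

lemma feasible_halts:
  assumes "\<zeta>' \<in> Z" "\<And>i. i < D \<Longrightarrow> act i \<Longrightarrow> real_of_int (\<theta> i) \<le> \<zeta> \<zeta>' i"
  shows "\<not> (\<exists>j. violated D thr act (V T) j)"
proof
  assume viol: "\<exists>j. violated D thr act (V T) j"
  have v: "\<exists>j. violated D thr act (V t) j" if "t \<le> T" for t
    using perceptron_stops[of D thr act R t T] viol that by metis
  have "(\<Sum>i<D. (real L * \<zeta> \<zeta>' i - u t i)\<^sup>2) \<le> (real L)\<^sup>2 * D - t" if "t \<le> T" for t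
    using that
  proof (induction t)
    case 0
    have "(real L * \<zeta> \<zeta>' i)\<^sup>2 \<le> (real L)\<^sup>2" if "i < D" for i
    proof -
      have "(\<zeta> \<zeta>' i)\<^sup>2 \<le> 1"
        using \<zeta>[OF assms(1) that] by (simp add: abs_square_le_1)
      then show ?thesis
        using L by (simp add: power_mult_distrib mult_left_le)
    qed
    then have "(\<Sum>i<D. (real L * \<zeta> \<zeta>' i)\<^sup>2) \<le> (\<Sum>i<D. (real L)\<^sup>2)"
      by (intro sum_mono) auto
    then show ?case
      by (simp add: mult.commute)
  next
    case (Suc t)
    then show ?case
      using progress[OF assms v[of t]] by simp
  qed
  from this[of T] have "(\<Sum>i<D. (real L * \<zeta> \<zeta>' i - u T i)\<^sup>2) < 0"
    by (simp add: T)
  moreover have "(\<Sum>i<D. (real L * \<zeta> \<zeta>' i - u T i)\<^sup>2) \<ge> 0"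
    by (simp add: sum_nonneg)
  ultimately show False by simp
qed

text \<open>The margin \<open>3\<close> is the \<open>2\<close> of the threshold plus
  \<open>1\<close> for rounding; dividing the exact iterate by \<open>L\<close> undoes the
  scaling.\<close>

lemma halts_approx:
  assumes "\<not> (\<exists>j. violated D thr act (V T) j)"
  shows "\<exists>c. \<forall>i<D. act i \<longrightarrow> \<theta> i - 3 / real L \<le> (\<Sum>v\<in>Z. c v * \<zeta> v i)"
proof -
  obtain c where c: "\<And>i. i < D \<Longrightarrow> u T i = (\<Sum>v\<in>Z. c v * \<zeta> v i)"
    using u_span by blast
  have "\<theta> i - 3 / real L \<le> (\<Sum>v\<in>Z. c v / real L * \<zeta> v i)" if "i < D" "act i" for i
  proof -
    have Tpos: "real T > 0" using T_pos by simp
    have "thr i \<le> V T i"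
      using assms that by (auto simp: violated_def not_less)
    then have "real_of_int (thr i) \<le> real_of_int (V T i)"
      by (rule of_int_le_iff[THEN iffD2])
    then have "real T * (real L * \<theta> i - 2) \<le> real T * u T i + real T"
      using V_approx[OF that(1), of T] by (simp add: thr)
    then have "real T * (real L * \<theta> i - 3) \<le> real T * u T i"
      by (simp add: algebra_simps)
    then have "real L * \<theta> i - 3 \<le> u T i"
      using Tpos by simp
    then have "(real L * \<theta> i - 3) / real L \<le> u T i / real L"
      using L by (intro divide_right_mono) auto
    moreover have "u T i / real L = (\<Sum>v\<in>Z. c v / real L * \<zeta> v i)"
      by (simp add: c that sum_divide_distrib)
    ultimately show ?thesis
      using L by (simp add: diff_divide_distrib)
  qed
  then show ?thesis by (intro exI[of _ "\<lambda>v. c v / real L"]) simp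
qed

end

end

text \<open>The update in the shape of a Boolean formula over tests of single values and violations:
  the selected index is a violated one with none below it, and the old value must have been
  \<open>c - R i j\<close>.\<close>

lemma perceptron_Suc_iff:
  "perceptron D thr R act (Suc t) i = c \<longleftrightarrow>
     (\<not> (\<exists>j\<in>{..<D}. violated D thr act (perceptron D thr R act t) j) \<and> perceptron D thr R act t i = c) \<or>
     (\<exists>j\<in>{..<D}. (violated D thr act (perceptron D thr R act t) j \<and>
         \<not> (\<exists>l\<in>{..<j}. violated D thr act (perceptron D thr R act t) l)) \<and>
         perceptron D thr R act t i = c - R i j)"
proof -
  let ?v = "violated D thr act (perceptron D thr R act t)"
  have D: "j < D" if "?v j" for j
    using that by (simp add: violated_def)
  show ?thesis
  proof (cases "\<exists>j. ?v j")
    case True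
    define l where "l = (LEAST j. ?v j)"
    have l: "?v l"
      unfolding l_def by (rule LeastI_ex[OF True])
    have min: "l \<le> j" if "?v j" for j
      unfolding l_def using that by (rule Least_le)
    have eq: "perceptron D thr R act (Suc t) i = perceptron D thr R act t i + R i l"
      by (simp only: perceptron.simps Let_def True if_True l_def)
    have least: "(?v j \<and> \<not> (\<exists>l\<in>{..<j}. ?v l)) \<longleftrightarrow> j = l" for j
    proof
      assume j: "?v j \<and> \<not> (\<exists>l\<in>{..<j}. ?v l)"
      then have "\<not> l < j" using l by (meson lessThan_iff)
      moreover have "l \<le> j" using j min by simp
      ultimately show "j = l" by simp
    next
      assume "j = l"
      moreover have "\<not> (\<exists>k\<in>{..<l}. ?v k)"
        using min by (meson leD lessThan_iff)
      ultimately show "?v j \<and> \<not> (\<exists>l\<in>{..<j}. ?v l)" using l by simp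
    qed
    have "l \<in> {..<D}" using D[OF l] by simp
    then have "\<exists>j\<in>{..<D}. ?v j"
      using l by (rule rev_bexI)
    then show ?thesis
      unfolding least eq using \<open>l \<in> {..<D}\<close> by (simp add: eq_diff_eq)
  next
    case False
    then have "perceptron D thr R act (Suc t) = perceptron D thr R act t"
      by (simp only: perceptron.simps Let_def if_False)
    moreover have "\<not> ?v j" for j
      using False by blast
    ultimately show ?thesis
      by simp
  qed
qed

text \<open>The wire \<open>W t (i, c)\<close> says that coordinate \<open>i\<close> has the value
  \<open>c\<close> after \<open>t\<close> steps. \<open>R\<close> and \<open>thr\<close> are
  constants of the circuit; the input enters through \<open>act\<close> only. The size adds up the
  activity wires, the initial values, \<open>T\<close> updates and the final test.\<close>

lemma buildable_perceptron:
  fixes act :: "nat \<Rightarrow> word \<Rightarrow> bool"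
  assumes R: "\<And>i j. i < D \<Longrightarrow> j < D \<Longrightarrow> \<bar>R i j\<bar> \<le> int T"
    and act: "\<And>j. j < D \<Longrightarrow> buildable n {} a {act j}"
  shows "buildable n {} (D * a + (D * (2 * T\<^sup>2 + 1) + (T * (D * (8 * T\<^sup>2 + 6) + (D * (4 * D + 3) + (4 * D + 2)
            + D * (2 * T\<^sup>2 + 1) * (5 * D + 6))) + (D * (8 * T\<^sup>2 + 6) + (4 * D + 1)))))
     {\<lambda>x. \<exists>j\<in>{..<D}. violated D thr (\<lambda>j. act j x) (perceptron D thr R (\<lambda>j. act j x) T) j}"
proof -
  define V where "V t x = perceptron D thr R (\<lambda>j. act j x) t" for t x
  define W where "W t = (\<lambda>(i, c) x. V t x i = c)" for t
  \<comment> \<open>At most \<open>T\<close> steps, each changing a coordinate by at most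
    \<open>T\<close>.\<close>
  define B where "B = int (T\<^sup>2)"
  define I where "I = {..<D} \<times> {- B..B}"
  define S where "S t = W t ` I" for t
  define A where "A = act ` {..<D}"
  define viol where "viol t j x = violated D thr (\<lambda>j. act j x) (V t x) j" for t j x
  define sel where "sel t j x \<longleftrightarrow> viol t j x \<and> \<not> (\<exists>l\<in>{..<j}. viol t l x)" for t j x
  define none where "none t x \<longleftrightarrow> \<not> (\<exists>j\<in>{..<D}. viol t j x)" for t x
  have cardI: "card {- B..B} = 2 * T\<^sup>2 + 1" "card I = D * (2 * T\<^sup>2 + 1)"
    by (simp_all add: I_def B_def card_cartesian_product nat_add_distrib nat_mult_distrib nat_power_eq)
  have finI: "finite I" by (simp add: I_def)
  have bound: "- B \<le> V t x i \<and> V t x i \<le> B" if "i < D" "t \<le> T" for t x i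
  proof -
    have "\<bar>V t x i\<bar> \<le> int t * int T"
      unfolding V_def by (rule perceptron_bound[of D]) (use R that in auto)
    also have "\<dots> \<le> B"
      using that by (auto simp: B_def power2_eq_square intro!: mult_right_mono)
    finally show ?thesis by auto
  qed
  have viol: "buildable n (A \<union> S t) (8 * T\<^sup>2 + 6) {viol t j}" if "j < D" "t \<le> T" for t j
  proof -
    let ?C = "{c \<in> {- B..B}. c < thr j}"
    have fin: "finite ?C"
      by (rule finite_subset[of _ "{- B..B}"]) auto
    have "buildable n (A \<union> S t) (Suc (0 + (card ?C * (0 + 4) + 1))) {\<lambda>x. act j x \<and> (\<exists>c\<in>?C. W t (j, c) x)}"
    proof (intro buildable_and buildable_ex)
      show "buildable n (A \<union> S t) 0 {act j}"
        by (rule buildable_subset) (use that in \<open>auto simp: A_def\<close>)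
      show "buildable n (A \<union> S t) 0 {W t (j, c)}" if "c \<in> ?C" for c
        by (rule buildable_subset) (use that \<open>j < D\<close> in \<open>auto simp: S_def I_def\<close>)
    qed (rule fin)
    moreover have "card ?C \<le> 2 * T\<^sup>2 + 1"
      unfolding cardI(1)[symmetric] by (intro card_mono) auto
    ultimately have "buildable n (A \<union> S t) (8 * T\<^sup>2 + 6) {\<lambda>x. act j x \<and> (\<exists>c\<in>?C. W t (j, c) x)}"
      by (elim buildable_le) simp
    then show ?thesis
    proof (rule buildable_cong)
      show "(act j x \<and> (\<exists>c\<in>?C. W t (j, c) x)) = viol t j x" for x
        using bound[OF that, of x] that(1) by (auto simp: viol_def violated_def W_def)
    qed
  qed
  have viols: "buildable n (A \<union> S t) (D * (8 * T\<^sup>2 + 6)) (viol t ` {..<D})" if "t \<le> T" for t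
    using buildable_singletons[of "{..<D}" n "A \<union> S t" "8 * T\<^sup>2 + 6" "viol t"] viol that by simp
  have step: "buildable n (A \<union> S t) (D * (8 * T\<^sup>2 + 6) + (D * (4 * D + 3) + (4 * D + 2)
            + D * (2 * T\<^sup>2 + 1) * (5 * D + 6))) (S (Suc t))" if "t < T" for t
  proof (rule buildable_trans_drop[OF viols])
    let ?F = "A \<union> S t \<union> viol t ` {..<D}"
    have sel: "buildable n ?F (D * (4 * D + 3)) (sel t ` {..<D})"
    proof -
      have "buildable n ?F (4 * D + 3) {sel t j}" if "j < D" for j
      proof -
        have "buildable n ?F (Suc (0 + Suc (card {..<j} * (0 + 4) + 1))) {sel t j}"
          unfolding sel_def
        proof (intro buildable_and buildable_ex buildable_not)
          show "buildable n ?F 0 {viol t j}"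
            by (rule buildable_subset) (use that in auto)
          show "buildable n ?F 0 {viol t l}" if "l \<in> {..<j}" for l
            by (rule buildable_subset) (use that \<open>j < D\<close> in auto)
        qed simp
        then show ?thesis
          by (rule buildable_le) (use that in simp)
      qed
      then show ?thesis
        using buildable_singletons[of "{..<D}" n ?F "4 * D + 3" "sel t"] by simp
    qed
    have none: "buildable n ?F (4 * D + 2) {none t}"
    proof -
      have "buildable n ?F (Suc (card {..<D} * (0 + 4) + 1)) {none t}"
        unfolding none_def
      proof (intro buildable_ex buildable_not)
        show "buildable n ?F 0 {viol t l}" if "l \<in> {..<D}" for l
          by (rule buildable_subset) (use that in auto)
      qed simp
      then show ?thesis
        by (rule buildable_le) simp
    qed
    have "buildable n (?F \<union> sel t ` {..<D}) (4 * D + 2) {none t}"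
      using none by (rule buildable_mono) auto
    from buildable_trans[OF sel this]
    have selnone: "buildable n ?F (D * (4 * D + 3) + (4 * D + 2)) (sel t ` {..<D} \<union> {none t})" .
    let ?G = "?F \<union> (sel t ` {..<D} \<union> {none t})"
    have "buildable n ?G (D * (2 * T\<^sup>2 + 1) * (5 * D + 6)) (S (Suc t))"
    proof -
      have "buildable n ?G (5 * D + 6) {W (Suc t) (i, c)}" if "i < D" "c \<in> {- B..B}" for i c
      proof -
        have "buildable n ?G (Suc (0 + 0) + (card {..<D} * (1 + 4) + 1) + 4)
          {\<lambda>x. (none t x \<and> W t (i, c) x) \<or> (\<exists>j\<in>{..<D}. sel t j x \<and> W t (i, c - R i j) x)}"
        proof (intro buildable_or buildable_and buildable_ex)
          show "buildable n ?G 0 {none t}"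
            by (rule buildable_subset) auto
          show "buildable n ?G 0 {W t (i, c)}"
            by (rule buildable_subset) (use that in \<open>auto simp: S_def I_def\<close>)
          show "buildable n ?G 1 {\<lambda>x. sel t j x \<and> W t (i, c - R i j) x}" if "j \<in> {..<D}" for j
          proof (cases "c - R i j \<in> {- B..B}")
            case True
            have "buildable n ?G (Suc (0 + 0)) {\<lambda>x. sel t j x \<and> W t (i, c - R i j) x}"
            proof (intro buildable_and)
              show "buildable n ?G 0 {sel t j}"
                by (rule buildable_subset) (use that in auto)
              have "W t (i, c - R i j) \<in> S t"
                unfolding S_def by (rule imageI) (use True \<open>i < D\<close> in \<open>auto simp: I_def\<close>)
              then show "buildable n ?G 0 {W t (i, c - R i j)}"
                by (intro buildable_subset) auto
            qed
            then show ?thesis by simp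
          next
            \<comment> \<open>A previous value outside the range never occurs, so there is no wire
              for it and the disjunct is false.\<close>
            case False
            have "W t (i, c - R i j) x = False" for x
              using bound[of i t x] False \<open>i < D\<close> \<open>t < T\<close> by (auto simp: W_def)
            then show ?thesis
              using buildable_const[of n ?G False] by simp
          qed
        qed simp
        then have "buildable n ?G (5 * D + 6)
          {\<lambda>x. (none t x \<and> W t (i, c) x) \<or> (\<exists>j\<in>{..<D}. sel t j x \<and> W t (i, c - R i j) x)}"
          by (rule buildable_le) simp
        then show ?thesis
        proof (rule buildable_cong)
          show "((none t x \<and> W t (i, c) x) \<or> (\<exists>j\<in>{..<D}. sel t j x \<and> W t (i, c - R i j) x))
              = W (Suc t) (i, c) x" for x
            using perceptron_Suc_iff[of D thr R "\<lambda>j. act j x" t i c]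
            by (simp only: W_def none_def sel_def viol_def V_def prod.case)
        qed
      qed
      then have "buildable n ?G (card I * (5 * D + 6)) (W (Suc t) ` I)"
        by (intro buildable_singletons finI) (auto simp: I_def)
      then show ?thesis
        by (simp only: cardI S_def)
    qed
    from buildable_trans_drop[OF selnone this]
    show "buildable n ?F (D * (4 * D + 3) + (4 * D + 2) + D * (2 * T\<^sup>2 + 1) * (5 * D + 6)) (S (Suc t))" .
  qed (use that in simp)
  have A: "buildable n {} (D * a) A"
    using buildable_singletons[of "{..<D}" n "{}" a act] act by (simp add: A_def)
  have S0: "buildable n ({} \<union> A) (D * (2 * T\<^sup>2 + 1)) (S 0)"
  proof -
    have "buildable n ({} \<union> A) 1 {W 0 ic}" if "ic \<in> I" for ic
      by (rule buildable_cong[OF buildable_const[of n _ "0 = snd ic"]]) (simp add: W_def V_def case_prod_beta)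
    from buildable_singletons[OF finI this] show ?thesis
      by (simp add: S_def cardI)
  qed
  let ?k = "D * (8 * T\<^sup>2 + 6) + (D * (4 * D + 3) + (4 * D + 2) + D * (2 * T\<^sup>2 + 1) * (5 * D + 6))"
  have iter: "buildable n (A \<union> S 0) (T * ?k) (S T)"
    by (rule buildable_iter) (rule step)
  have final: "buildable n (A \<union> S T) (D * (8 * T\<^sup>2 + 6) + (4 * D + 1)) {\<lambda>x. \<exists>j\<in>{..<D}. viol T j x}"
  proof (rule buildable_trans_drop[OF viols])
    have "buildable n (A \<union> S T \<union> viol T ` {..<D}) (card {..<D} * (0 + 4) + 1) {\<lambda>x. \<exists>j\<in>{..<D}. viol T j x}"
    proof (intro buildable_ex)
      show "buildable n (A \<union> S T \<union> viol T ` {..<D}) 0 {viol T l}" if "l \<in> {..<D}" for l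
        by (rule buildable_subset) (use that in auto)
    qed simp
    then show "buildable n (A \<union> S T \<union> viol T ` {..<D}) (4 * D + 1) {\<lambda>x. \<exists>j\<in>{..<D}. viol T j x}"
      by (rule buildable_le) simp
  qed simp
  have "buildable n (A \<union> S 0 \<union> S T) (D * (8 * T\<^sup>2 + 6) + (4 * D + 1)) {\<lambda>x. \<exists>j\<in>{..<D}. viol T j x}"
    using final by (rule buildable_mono) auto
  from buildable_trans_drop[OF iter this]
  have "buildable n ({} \<union> A \<union> S 0) (T * ?k + (D * (8 * T\<^sup>2 + 6) + (4 * D + 1))) {\<lambda>x. \<exists>j\<in>{..<D}. viol T j x}"
    by simp
  from buildable_trans_drop[OF A buildable_trans_drop[OF S0 this]] show ?thesis
    by (simp only: viol_def V_def)
qed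

section \<open>Extended formulations decide the existence of tours\<close>

text \<open>The gates of \<open>buildable_perceptron\<close>, and one more for negating its
  answer.\<close>

definition perceptron_size :: "nat \<Rightarrow> nat \<Rightarrow> nat \<Rightarrow> nat" where
  "perceptron_size D T a = Suc (D * a + (D * (2 * T\<^sup>2 + 1) + (T * (D * (8 * T\<^sup>2 + 6) +
     (D * (4 * D + 3) + (4 * D + 2) + D * (2 * T\<^sup>2 + 1) * (5 * D + 6))) +
     (D * (8 * T\<^sup>2 + 6) + (4 * D + 1)))))"

text \<open>The perceptron separates exact feasibility from the failure of approximate feasibility
  and may answer either way in between. The hypothesis \<open>gap\<close> says that nothing lies in
  between, so the answer is correct on every input.\<close>

lemma buildable_gap_feasibility:
  fixes \<zeta> :: "'v \<Rightarrow> nat \<Rightarrow> real" and \<theta> :: "nat \<Rightarrow> int" and act :: "nat \<Rightarrow> word \<Rightarrow> bool"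
  assumes "finite Z" and \<zeta>: "\<And>v i. v \<in> Z \<Longrightarrow> i < D \<Longrightarrow> \<bar>\<zeta> v i\<bar> \<le> 1" and L: "0 < L"
    and act: "\<And>j. j < D \<Longrightarrow> buildable n {} a {act j}"
    and gap: "\<And>x c. length x = n \<Longrightarrow>
      (\<And>i. i < D \<Longrightarrow> act i x \<Longrightarrow> \<theta> i - 3 / real L \<le> (\<Sum>v\<in>Z. c v * \<zeta> v i)) \<Longrightarrow>
      \<exists>v\<in>Z. \<forall>i<D. act i x \<longrightarrow> \<theta> i \<le> \<zeta> v i"
  shows "buildable n {} (perceptron_size D (L\<^sup>2 * D + 1) a) {\<lambda>x. \<exists>v\<in>Z. \<forall>i<D. act i x \<longrightarrow> \<theta> i \<le> \<zeta> v i}"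
proof -
  obtain P :: "nat \<Rightarrow> nat \<Rightarrow> real" where P:
    "\<And>j. j < D \<Longrightarrow> \<exists>c. \<forall>i<D. P i j = (\<Sum>v\<in>Z. c v * \<zeta> v i)"
    "\<And>v j. v \<in> Z \<Longrightarrow> j < D \<Longrightarrow> (\<Sum>i<D. \<zeta> v i * P i j) = \<zeta> v j"
    using reproducing_kernel[OF \<open>finite Z\<close>, of D \<zeta>] by blast
  obtain C where C: "\<And>i j. i < D \<Longrightarrow> j < D \<Longrightarrow> P i j = (\<Sum>v\<in>Z. C j v * \<zeta> v i)"
    using P(1) by metis
  define T where "T = L\<^sup>2 * D + 1"
  define R where "R i j = \<lfloor>real T * P i j\<rfloor>" for i j
  define thr where "thr j = int T * (int L * \<theta> j - 2)" for j
  interpret feasibility Z \<zeta> D L T P C \<theta> R thr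
    by unfold_locales (use L C P(2) \<zeta> in \<open>auto simp: T_def R_def thr_def\<close>)
  let ?v = "\<lambda>x. \<exists>j\<in>{..<D}. violated D thr (\<lambda>j. act j x) (perceptron D thr R (\<lambda>j. act j x) T) j"
  have "buildable n {} (perceptron_size D T a) {\<lambda>x. \<not> ?v x}"
    unfolding perceptron_size_def by (intro buildable_not buildable_perceptron R_bound act)
  then show ?thesis
    unfolding T_def[symmetric]
  proof (rule buildable_cong)
    fix x :: word assume "length x = n"
    have v: "?v x \<longleftrightarrow> (\<exists>j. violated D thr (\<lambda>j. act j x) (perceptron D thr R (\<lambda>j. act j x) T) j)"
      by (auto simp: violated_def)
    show "(\<not> ?v x) = (\<exists>v\<in>Z. \<forall>i<D. act i x \<longrightarrow> \<theta> i \<le> \<zeta> v i)"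
    proof
      assume "\<not> ?v x"
      then obtain c where "\<forall>i<D. act i x \<longrightarrow> \<theta> i - 3 / real L \<le> (\<Sum>v\<in>Z. c v * \<zeta> v i)"
        using halts_approx[of "\<lambda>j. act j x"] unfolding v by blast
      then show "\<exists>v\<in>Z. \<forall>i<D. act i x \<longrightarrow> \<theta> i \<le> \<zeta> v i"
        using gap[OF \<open>length x = n\<close>, of c] by blast
    next
      assume "\<exists>v\<in>Z. \<forall>i<D. act i x \<longrightarrow> \<theta> i \<le> \<zeta> v i"
      then show "\<not> ?v x"
        unfolding v using feasible_halts[of _ "\<lambda>j. act j x"] by blast
    qed
  qed
qed

text \<open>Adding \<open>\<epsilon>\<close> times each vertex \<open>hi r\<close>, where the slack of row \<open>r\<close> is largest, turns an approximately
  feasible combination into a point of the polytope, whose cost stays below \<open>1\<close>; a vertex has integral cost,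
  so some vertex has cost \<open>0\<close>. Rows that are tight at all vertices have normalised slack \<open>0 / 0 = 0\<close>.\<close>

lemma approximate_point_imp_vertex:
  fixes vec :: "'v \<Rightarrow> nat \<Rightarrow> real"
  assumes "finite Z"
    and vec: "\<And>v i. v \<in> Z \<Longrightarrow> vec v i = 0 \<or> vec v i = 1" "\<And>v i. v \<in> Z \<Longrightarrow> i \<ge> m \<Longrightarrow> vec v i = 0"
    and conv: "conv (vec ` Z) = proj_polyhedron m k A B b"
    and slack: "\<And>r v. slack r v = b r - (\<Sum>j<m. A r j * vec v j) - (\<Sum>j<k. B r j * y v j)"
    and hi: "\<And>r. r < k \<Longrightarrow> hi r \<in> Z"
      "\<And>r v. r < k \<Longrightarrow> v \<in> Z \<Longrightarrow> 0 \<le> slack r v \<and> slack r v \<le> slack r (hi r)"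
    and c: "1 - \<epsilon> \<le> sum c Z"
      "\<And>r. r < k \<Longrightarrow> - \<epsilon> \<le> (\<Sum>v\<in>Z. c v * (slack r v / slack r (hi r)))"
      "\<And>e. e \<in> Fb \<Longrightarrow> (\<Sum>v\<in>Z. c v * vec v e) \<le> \<epsilon>"
      "\<And>e. e \<in> Fc \<Longrightarrow> (\<Sum>v\<in>Z. c v * (1 - vec v e)) \<le> \<epsilon>"
    and \<epsilon>: "0 \<le> \<epsilon>" "\<epsilon> * (2 * real m * (real k + 1) + 1) < 1"
    and F: "Fb \<subseteq> {..<m}" "Fc \<subseteq> {..<m}"
  shows "\<exists>v\<in>Z. (\<forall>e\<in>Fb. vec v e = 0) \<and> (\<forall>e\<in>Fc. vec v e = 1)"
proof (rule ccontr)
  assume neg: "\<not> ?thesis"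
  define c' where "c' v = c v + (\<Sum>r<k. if hi r = v then \<epsilon> else 0)" for v
  have c'_sum: "(\<Sum>v\<in>Z. c' v * f v) = (\<Sum>v\<in>Z. c v * f v) + \<epsilon> * (\<Sum>r<k. f (hi r))" for f :: "'v \<Rightarrow> real"
  proof -
    have "(\<Sum>v\<in>Z. (\<Sum>r<k. if hi r = v then \<epsilon> else 0) * f v) = (\<Sum>r<k. \<Sum>v\<in>Z. if hi r = v then \<epsilon> * f v else 0)"
      by (subst sum.swap) (auto simp: sum_distrib_right intro!: sum.cong)
    also have "\<dots> = (\<Sum>r<k. \<epsilon> * f (hi r))"
      using hi(1) \<open>finite Z\<close> by (intro sum.cong refl) (subst sum.delta', auto)
    finally show ?thesis
      by (simp add: c'_def distrib_right sum.distrib sum_distrib_left)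
  qed
  define S where "S = sum c' Z"
  have S: "S = sum c Z + \<epsilon> * k"
    using c'_sum[of "\<lambda>_. 1"] by (simp add: S_def)
  have S1: "1 - \<epsilon> \<le> S"
    using c(1) \<epsilon>(1) unfolding S by (simp add: add_increasing2)
  have "\<epsilon> * 1 \<le> \<epsilon> * (2 * real m * (real k + 1) + 1)"
    using \<epsilon>(1) by (intro mult_left_mono) auto
  then have "0 < S"
    using S1 \<epsilon>(2) by linarith
  define d where "d v = c' v / S" for v
  have d_sum: "(\<Sum>v\<in>Z. d v * f v) = (\<Sum>v\<in>Z. c' v * f v) / S" for f
    by (simp add: d_def sum_divide_distrib)
  have d1: "sum d Z = 1"
    using d_sum[of "\<lambda>_. 1"] \<open>0 < S\<close> by (simp add: S_def)
  define x where "x i = (\<Sum>v\<in>Z. d v * vec v i)" for i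
  define y' where "y' j = (\<Sum>v\<in>Z. d v * y v j)" for j
  have "(\<Sum>j<m. A r j * x j) + (\<Sum>j<k. B r j * y' j) \<le> b r" if "r < k" for r
  proof -
    have "(\<Sum>j<m. A r j * x j) = (\<Sum>v\<in>Z. d v * (\<Sum>j<m. A r j * vec v j))"
      unfolding x_def by (simp only: sum_distrib_left, subst sum.swap) (simp add: ac_simps)
    moreover have "(\<Sum>j<k. B r j * y' j) = (\<Sum>v\<in>Z. d v * (\<Sum>j<k. B r j * y v j))"
      unfolding y'_def by (simp only: sum_distrib_left, subst sum.swap) (simp add: ac_simps)
    moreover have "b r = (\<Sum>v\<in>Z. d v * b r)"
      using d1 by (simp flip: sum_distrib_right)
    ultimately have "b r - ((\<Sum>j<m. A r j * x j) + (\<Sum>j<k. B r j * y' j)) = (\<Sum>v\<in>Z. d v * slack r v)"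
      by (simp add: slack right_diff_distrib sum_subtractf)
    \<comment> \<open>The combination \<open>c\<close> falls short by at most
      \<open>\<epsilon>\<close> times the largest slack of row \<open>r\<close>. The added vertex
      \<open>hi r\<close> alone makes up for this, and the other added vertices have nonnegative
      slack.\<close>
    moreover have "0 \<le> (\<Sum>v\<in>Z. c' v * slack r v)"
    proof (cases "slack r (hi r) = 0")
      case True
      then have "slack r v = 0" if "v \<in> Z" for v
        using hi(2)[OF \<open>r < k\<close> that] by simp
      then show ?thesis by simp
    next
      case False
      then have pos: "0 < slack r (hi r)"
        using hi(2)[OF \<open>r < k\<close> hi(1)[OF \<open>r < k\<close>]] by simp
      have "(\<Sum>v\<in>Z. c v * slack r v) = slack r (hi r) * (\<Sum>v\<in>Z. c v * (slack r v / slack r (hi r)))"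
        using False by (simp add: sum_distrib_left)
      also have "\<dots> \<ge> slack r (hi r) * (- \<epsilon>)"
        using c(2)[OF \<open>r < k\<close>] pos by (intro mult_left_mono) auto
      finally have "- (\<epsilon> * slack r (hi r)) \<le> (\<Sum>v\<in>Z. c v * slack r v)"
        by (simp add: mult.commute)
      moreover have "slack r (hi r) \<le> (\<Sum>r'<k. slack r (hi r'))"
        using \<open>r < k\<close> hi by (intro member_le_sum[of r "{..<k}" "\<lambda>r'. slack r (hi r')"]) auto
      then have "\<epsilon> * slack r (hi r) \<le> \<epsilon> * (\<Sum>r'<k. slack r (hi r'))"
        using \<epsilon>(1) by (rule mult_left_mono)
      ultimately show ?thesis
        unfolding c'_sum by linarith
    qed
    then have "0 \<le> (\<Sum>v\<in>Z. d v * slack r v)"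
      unfolding d_sum using \<open>0 < S\<close> by simp
    ultimately show ?thesis by linarith
  qed
  \<comment> \<open>The weights \<open>d\<close> may be negative. Membership in the polyhedron
    trades them for genuine convex weights \<open>u\<close>.\<close>
  then have "x \<in> conv (vec ` Z)"
    unfolding conv proj_polyhedron_def by (auto simp: x_def vec(2))
  then obtain G u where G: "finite G" "G \<subseteq> vec ` Z" "\<And>s. s \<in> G \<Longrightarrow> 0 \<le> u s" "sum u G = 1"
    "x = (\<lambda>i. \<Sum>s\<in>G. u s * s i)"
    unfolding conv_def by blast
  define cost where "cost z = (\<Sum>e\<in>Fb. z e) + (\<Sum>e\<in>Fc. 1 - z e)" for z :: "nat \<Rightarrow> real"
  have finF: "finite Fb" "finite Fc" "card Fb \<le> m" "card Fc \<le> m"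
    using F finite_subset card_mono[of "{..<m}"] by auto
  have cost1: "1 \<le> cost s" if sG: "s \<in> G" for s
  proof -
    obtain v where v: "v \<in> Z" "s = vec v"
      using G(2) sG by blast
    have nn: "0 \<le> s e" "0 \<le> 1 - s e" for e
      using vec(1)[OF v(1), of e] v(2) by auto
    have "(\<exists>e\<in>Fb. s e = 1) \<or> (\<exists>e\<in>Fc. s e = 0)"
      using neg v vec(1)[OF v(1)] by metis
    then show ?thesis
    proof
      assume "\<exists>e\<in>Fb. s e = 1"
      then obtain e where "e \<in> Fb" "s e = 1" by blast
      then have "1 \<le> (\<Sum>e\<in>Fb. s e)"
        using member_le_sum[of e Fb s] finF nn by simp
      moreover have "0 \<le> (\<Sum>e\<in>Fc. 1 - s e)"
        using nn(2) by (rule sum_nonneg)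
      ultimately show ?thesis by (simp add: cost_def)
    next
      assume "\<exists>e\<in>Fc. s e = 0"
      then obtain e where "e \<in> Fc" "s e = 0" by blast
      then have "1 \<le> (\<Sum>e\<in>Fc. 1 - s e)"
        using member_le_sum[of e Fc "\<lambda>e. 1 - s e"] finF nn by simp
      moreover have "0 \<le> (\<Sum>e\<in>Fb. s e)"
        using nn(1) by (rule sum_nonneg)
      ultimately show ?thesis by (simp add: cost_def)
    qed
  qed
  have "cost x = (\<Sum>s\<in>G. u s * cost s)"
  proof -
    have 1: "(\<Sum>e\<in>Fb. x e) = (\<Sum>s\<in>G. u s * (\<Sum>e\<in>Fb. s e))"
      unfolding G(5) by (simp only: sum_distrib_left, subst sum.swap) simp
    have "1 - x e = (\<Sum>s\<in>G. u s * (1 - s e))" for e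
      unfolding G(5) using G(4) by (simp add: right_diff_distrib sum_subtractf)
    then have 2: "(\<Sum>e\<in>Fc. 1 - x e) = (\<Sum>s\<in>G. u s * (\<Sum>e\<in>Fc. 1 - s e))"
      by (simp only: sum_distrib_left, subst sum.swap) simp
    show ?thesis
      unfolding cost_def 1 2 by (simp add: distrib_left sum.distrib)
  qed
  also have "\<dots> \<ge> (\<Sum>s\<in>G. u s * 1)"
    using G(3) cost1 by (intro sum_mono mult_left_mono) auto
  finally have "1 \<le> cost x"
    using G(4) by simp
  then have "S \<le> S * cost x"
    using \<open>0 < S\<close> by simp
  also have "S * cost x = (\<Sum>e\<in>Fb. S * x e) + (\<Sum>e\<in>Fc. S * (1 - x e))"
    by (simp add: cost_def distrib_left sum_distrib_left)
  \<comment> \<open>An edge contributes at most \<open>\<epsilon>\<close> through \<open>c\<close>,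
    and at most \<open>\<epsilon>\<close> more through each of the \<open>k\<close> added
    vertices.\<close>
  also have "\<dots> \<le> (\<Sum>e\<in>Fb. \<epsilon> + \<epsilon> * k) + (\<Sum>e\<in>Fc. \<epsilon> + \<epsilon> * k)"
  proof (intro add_mono sum_mono)
    fix e assume "e \<in> Fb"
    have "S * x e = (\<Sum>v\<in>Z. c v * vec v e) + \<epsilon> * (\<Sum>r<k. vec (hi r) e)"
      unfolding x_def d_sum c'_sum using \<open>0 < S\<close> by simp
    also have "\<dots> \<le> \<epsilon> + \<epsilon> * (\<Sum>r<k. 1)"
    proof (intro add_mono mult_left_mono sum_mono)
      show "vec (hi r) e \<le> 1" if "r \<in> {..<k}" for r
        using vec(1)[OF hi(1), of r e] that by auto
    qed (use c(3) \<open>e \<in> Fb\<close> \<epsilon>(1) in auto)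
    finally show "S * x e \<le> \<epsilon> + \<epsilon> * k" by simp
  next
    fix e assume "e \<in> Fc"
    have "1 - x e = (\<Sum>v\<in>Z. d v * (1 - vec v e))"
      unfolding x_def using d1 by (simp add: right_diff_distrib sum_subtractf)
    then have "S * (1 - x e) = (\<Sum>v\<in>Z. c v * (1 - vec v e)) + \<epsilon> * (\<Sum>r<k. 1 - vec (hi r) e)"
      unfolding d_sum c'_sum using \<open>0 < S\<close> by simp
    also have "\<dots> \<le> \<epsilon> + \<epsilon> * (\<Sum>r<k. 1)"
    proof (intro add_mono mult_left_mono sum_mono)
      show "1 - vec (hi r) e \<le> 1" if "r \<in> {..<k}" for r
        using vec(1)[OF hi(1), of r e] that by auto
    qed (use c(4) \<open>e \<in> Fc\<close> \<epsilon>(1) in auto)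
    finally show "S * (1 - x e) \<le> \<epsilon> + \<epsilon> * k" by simp
  qed
  also have "\<dots> = (real (card Fb) + real (card Fc)) * (\<epsilon> * (k + 1))"
    by (simp add: algebra_simps)
  also have "\<dots> \<le> (2 * real m) * (\<epsilon> * (k + 1))"
    using finF(3,4) \<epsilon>(1) by (intro mult_right_mono) auto
  finally have "1 - \<epsilon> \<le> (2 * real m) * (\<epsilon> * (k + 1))"
    using S1 by linarith
  then show False
    using \<epsilon>(2) by (simp add: algebra_simps)
qed

section \<open>Edge lists and the words of tours\<close>

lemma set_edges_list: "set (edges_list n) = {{i, j} | i j. 1 \<le> i \<and> i < j \<and> j \<le> n}"
proof -
  have *: "set (edges_list n) = (\<Union>i\<in>{1..<n+1}. (\<lambda>j. {i, j}) ` {i+1..<n+1})"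
    unfolding edges_list_def set_concat set_map set_upt image_image ..
  show ?thesis
  proof (intro equalityI subsetI)
    fix e assume "e \<in> set (edges_list n)"
    then obtain i j where "i \<in> {1..<n+1}" "j \<in> {i+1..<n+1}" "e = {i, j}"
      unfolding * by blast
    then show "e \<in> {{i, j} | i j. 1 \<le> i \<and> i < j \<and> j \<le> n}"
      by (intro CollectI exI[of _ i] exI[of _ j]) auto
  next
    fix e assume "e \<in> {{i, j} | i j. 1 \<le> i \<and> i < j \<and> j \<le> n}"
    then obtain i j where "e = {i, j}" "1 \<le> i" "i < j" "j \<le> n" by blast
    then show "e \<in> set (edges_list n)"
      unfolding * by (intro UN_I[of i] image_eqI[of _ _ j]) auto
  qed
qed

lemma length_edges_list_Suc: "length (edges_list (Suc n)) = length (edges_list n) + n"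
proof -
  have len: "length (edges_list n) = (\<Sum>i=1..<n+1. n - i)" for n
  proof -
    have "length (edges_list n) = (\<Sum>i\<leftarrow>[1..<n+1]. n + 1 - (i + 1))"
      unfolding edges_list_def length_concat map_map o_def length_map length_upt ..
    then show ?thesis
      by (simp only: interv_sum_list_conv_sum_set_nat set_upt diff_add_inverse2 diff_cancel2)
  qed
  have "(\<Sum>i=1..<Suc n + 1. Suc n - i) = (\<Sum>i=1..<n+1. Suc n - i)"
    by simp
  also have "\<dots> = (\<Sum>i=1..<n+1. (n - i) + 1)"
    by (intro sum.cong) auto
  also have "\<dots> = (\<Sum>i=1..<n+1. n - i) + n"
    by (simp only: sum.distrib) simp
  finally show ?thesis
    unfolding len .
qed

lemma length_edges_list_strict_mono:
  assumes "1 \<le> a" "a < b"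
  shows "length (edges_list a) < length (edges_list b)"
proof -
  have "length (edges_list a) + 1 \<le> length (edges_list b)"
    using Suc_leI[OF assms(2)] by (induction b rule: dec_induct) (use assms(1) in \<open>auto simp: length_edges_list_Suc\<close>)
  then show ?thesis by simp
qed

lemma length_edges_list_le: "length (edges_list n) \<le> n * n"
  by (induction n) (auto simp: length_edges_list_Suc, simp add: edges_list_def)

definition tours :: "nat \<Rightarrow> nat set set set" where
  "tours n = {C. C \<subseteq> set (edges_list n) \<and> ham_cycle n C}"

text \<open>From one node on, the number of edges determines the number of nodes, so words of this
  length come from one complete graph only.\<close>

lemma TSP_words:
  assumes "3 \<le> n"
  shows "{x \<in> TSP. length x = length (edges_list n)} = char_vec n ` tours n"
proof (intro equalityI subsetI)
  fix x assume "x \<in> {x \<in> TSP. length x = length (edges_list n)}"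
  then obtain l C where C: "x = char_vec l C" "C \<in> tours l" "length x = length (edges_list n)"
    unfolding TSP_def tours_def by blast
  then have "length (edges_list l) = length (edges_list n)"
    by (simp add: char_vec_def)
  moreover have "3 \<le> l"
    using C(2) by (simp add: tours_def ham_cycle_def)
  ultimately have "l = n"
    using length_edges_list_strict_mono[of l n] length_edges_list_strict_mono[of n l] assms
    by (cases l n rule: linorder_cases) auto
  then show "x \<in> char_vec n ` tours n"
    using C by simp
next
  fix x assume "x \<in> char_vec n ` tours n"
  then show "x \<in> {x \<in> TSP. length x = length (edges_list n)}"
    unfolding TSP_def tours_def by (auto simp: char_vec_def)
qed

text \<open>The coordinates are a constant, \<open>k\<close> slacks, \<open>m\<close> forbidden
  edges and \<open>m\<close> forced edges. The scale \<open>L = 4 * (2 * m * (k + 1) + 1)\<close>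
  turns the accuracy \<open>3 / L\<close> into a total error of \<open>3 / 4\<close>, which is below
  the integrality gap.\<close>

definition lp_size :: "nat \<Rightarrow> nat \<Rightarrow> nat \<Rightarrow> nat" where
  "lp_size m k a = perceptron_size (1 + k + 2 * m)
     ((4 * (2 * m * (k + 1) + 1))\<^sup>2 * (1 + k + 2 * m) + 1) (Suc a)"

lemma buildable_tour:
  fixes forb :: "nat set \<Rightarrow> word \<Rightarrow> bool"
  assumes "3 \<le> N" and m: "m = length (edges_list N)"
    and conv: "conv (vec_of_word ` {x \<in> TSP. length x = m}) = proj_polyhedron m k A B b"
    and forb: "\<And>e. e \<in> set (edges_list N) \<Longrightarrow> buildable n {} a {forb e}"
    and forced: "forced \<subseteq> set (edges_list N)"
  shows "buildable n {} (lp_size m k a) {\<lambda>x. \<exists>C\<in>tours N. (\<forall>e\<in>C. \<not> forb e x) \<and> forced \<subseteq> C}"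
proof -
  define Z where "Z = tours N"
  define vec where "vec C = vec_of_word (char_vec N C)" for C
  define E where "E e = edges_list N ! e" for e
  have vec: "vec C e = (if e < m \<and> E e \<in> C then 1 else 0)" for C e
    by (auto simp: vec_def vec_of_word_def char_vec_def m E_def)
  have setE: "set (edges_list N) = E ` {..<m}"
    unfolding E_def m by (auto simp: set_conv_nth)
  have "finite Z"
    unfolding Z_def tours_def by (rule finite_subset[of _ "Pow (set (edges_list N))"]) auto
  have conv': "conv (vec ` Z) = proj_polyhedron m k A B b"
    using conv unfolding m TSP_words[OF assms(1)] Z_def vec_def image_image .
  have "\<exists>y. \<forall>r<k. (\<Sum>j<m. A r j * vec v j) + (\<Sum>j<k. B r j * y j) \<le> b r" if "v \<in> Z" for v
  proof -
    have "vec v \<in> conv (vec ` Z)"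
      unfolding conv_def using that
      by (intro CollectI exI[of _ "{vec v}"] exI[of _ "\<lambda>_. 1"]) auto
    then show ?thesis
      unfolding conv' proj_polyhedron_def by blast
  qed
  then obtain y where y: "\<And>v r. v \<in> Z \<Longrightarrow> r < k \<Longrightarrow>
      (\<Sum>j<m. A r j * vec v j) + (\<Sum>j<k. B r j * y v j) \<le> b r"
    by metis
  define slack where "slack r v = b r - (\<Sum>j<m. A r j * vec v j) - (\<Sum>j<k. B r j * y v j)" for r v
  define hi where "hi r = (SOME v. v \<in> Z \<and> (\<forall>w\<in>Z. slack r w \<le> slack r v))" for r
  have hi: "hi r \<in> Z \<and> (\<forall>w\<in>Z. slack r w \<le> slack r (hi r))" if "Z \<noteq> {}" for r
  proof -
    have "\<exists>v. v \<in> Z \<and> (\<forall>w\<in>Z. slack r w \<le> slack r v)"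
    proof -
      have "Max (slack r ` Z) \<in> slack r ` Z"
        using \<open>finite Z\<close> that by (intro Max_in) auto
      then obtain v where "v \<in> Z" "slack r v = Max (slack r ` Z)" by auto
      then show ?thesis
        using \<open>finite Z\<close> by (intro exI[of _ v]) auto
    qed
    then show ?thesis
      unfolding hi_def by (rule someI_ex)
  qed
  have slack0: "0 \<le> slack r v" if "v \<in> Z" "r < k" for r v
    using y[OF that] by (simp add: slack_def)
  define D where "D = 1 + k + 2 * m"
  define \<zeta> where "\<zeta> v i = (if i = 0 then 1
      else if i \<le> k then slack (i - 1) v / slack (i - 1) (hi (i - 1))
      else if i \<le> k + m then - vec v (i - 1 - k)
      else vec v (i - 1 - k - m) - 1)" for v i
  define act where "act i x = (if i \<le> k then True else if i \<le> k + m then forb (E (i - 1 - k)) x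
      else E (i - 1 - k - m) \<in> forced)" for i x
  define \<theta> where "\<theta> i = (if i = 0 then 1 else 0 :: int)" for i :: nat
  define L where "L = 4 * (2 * m * (k + 1) + 1)"
  have feas: "(\<forall>i<D. act i x \<longrightarrow> \<theta> i \<le> \<zeta> C i) \<longleftrightarrow> (\<forall>e\<in>C. \<not> forb e x) \<and> forced \<subseteq> C"
    if "C \<in> Z" for C x
  proof
    assume *: "\<forall>i<D. act i x \<longrightarrow> \<theta> i \<le> \<zeta> C i"
    have "\<not> forb (E e) x" if "e < m" "E e \<in> C" for e
      using *[rule_format, of "1 + k + e"] that by (auto simp: D_def act_def \<theta>_def \<zeta>_def vec)
    moreover have "E e \<in> C" if "e < m" "E e \<in> forced" for e
      using *[rule_format, of "1 + k + m + e"] that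
      by (auto simp: D_def act_def \<theta>_def \<zeta>_def vec split: if_splits)
    moreover have "C \<subseteq> E ` {..<m}"
      using \<open>C \<in> Z\<close> unfolding Z_def tours_def setE by blast
    ultimately show "(\<forall>e\<in>C. \<not> forb e x) \<and> forced \<subseteq> C"
      using forced unfolding setE by blast
  next
    assume *: "(\<forall>e\<in>C. \<not> forb e x) \<and> forced \<subseteq> C"
    show "\<forall>i<D. act i x \<longrightarrow> \<theta> i \<le> \<zeta> C i"
    proof (intro allI impI)
      fix i assume "i < D" "act i x"
      consider "i = 0" | "0 < i" "i \<le> k" | "k < i" "i \<le> k + m" | "k + m < i" by linarith
      then show "\<theta> i \<le> \<zeta> C i"
      proof cases
        case 2
        have "hi (i - 1) \<in> Z"
          using hi[of "i - 1"] \<open>C \<in> Z\<close> by blast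
        then have "0 \<le> slack (i - 1) C / slack (i - 1) (hi (i - 1))"
          using \<open>C \<in> Z\<close> 2 by (intro divide_nonneg_nonneg slack0) auto
        then show ?thesis
          using 2 by (simp add: \<theta>_def \<zeta>_def)
      next
        case 3
        then show ?thesis
          using * \<open>act i x\<close> by (auto simp: \<theta>_def \<zeta>_def vec act_def)
      next
        case 4
        then show ?thesis
          using * \<open>act i x\<close> \<open>i < D\<close> by (auto simp: \<theta>_def \<zeta>_def vec act_def D_def)
      qed (simp add: \<theta>_def \<zeta>_def)
    qed
  qed
  have "buildable n {} (perceptron_size D (L\<^sup>2 * D + 1) (Suc a)) {\<lambda>x. \<exists>v\<in>Z. \<forall>i<D. act i x \<longrightarrow> \<theta> i \<le> \<zeta> v i}"
  proof (rule buildable_gap_feasibility[OF \<open>finite Z\<close>])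
    show "\<bar>\<zeta> v i\<bar> \<le> 1" if v: "v \<in> Z" and "i < D" for v i
    proof (cases "0 < i \<and> i \<le> k")
      case True
      then have "0 \<le> slack (i - 1) v" "slack (i - 1) v \<le> slack (i - 1) (hi (i - 1))"
        using slack0[OF v, of "i - 1"] hi[of "i - 1"] v by auto
      then have "\<bar>slack (i - 1) v / slack (i - 1) (hi (i - 1))\<bar> \<le> 1"
        by (auto simp: abs_divide divide_le_eq_1)
      moreover have "\<zeta> v i = slack (i - 1) v / slack (i - 1) (hi (i - 1))"
        using True by (simp add: \<zeta>_def)
      ultimately show ?thesis by (simp only:)
    qed (auto simp: \<zeta>_def vec)
    show "0 < L" by (simp add: L_def)
    show "buildable n {} (Suc a) {act j}" if "j < D" for j
    proof -
      consider "j \<le> k" | "k < j" "j \<le> k + m" | "k + m < j" by linarith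
      then show ?thesis
      proof cases
        case 1
        then have "act j = (\<lambda>x. True)" by (simp add: act_def fun_eq_iff)
        then show ?thesis using buildable_le[OF buildable_const, of "Suc a"] by simp
      next
        case 2
        then have "act j = forb (E (j - 1 - k))" by (simp add: act_def fun_eq_iff)
        moreover have "E (j - 1 - k) \<in> set (edges_list N)"
          unfolding setE using 2 by auto
        ultimately show ?thesis using buildable_le[OF forb, of _ "Suc a"] by simp
      next
        case 3
        then have "act j = (\<lambda>x. E (j - 1 - k - m) \<in> forced)" by (simp add: act_def fun_eq_iff)
        then show ?thesis using buildable_le[OF buildable_const, of "Suc a"] by simp
      qed
    qed
    show "\<exists>v\<in>Z. \<forall>i<D. act i x \<longrightarrow> \<theta> i \<le> \<zeta> v i"
      if "length x = n" and z: "\<And>i. i < D \<Longrightarrow> act i x \<Longrightarrow> \<theta> i - 3 / real L \<le> (\<Sum>v\<in>Z. c v * \<zeta> v i)" for x c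
    proof -
      define Fb where "Fb = {e. e < m \<and> forb (E e) x}"
      define Fc where "Fc = {e. e < m \<and> E e \<in> forced}"
      have c1: "1 - 3 / real L \<le> sum c Z"
        using z[of 0] by (simp add: D_def act_def \<theta>_def \<zeta>_def)
      have L4: "4 \<le> real L"
        by (simp add: L_def)
      then have "3 / real L < 1"
        by (simp add: divide_less_eq)
      then have "Z \<noteq> {}"
        using c1 by auto
      have "\<exists>v\<in>Z. (\<forall>e\<in>Fb. vec v e = 0) \<and> (\<forall>e\<in>Fc. vec v e = 1)"
      proof (rule approximate_point_imp_vertex[OF \<open>finite Z\<close> _ _ conv' slack_def])
        show "hi r \<in> Z" for r
          using hi[OF \<open>Z \<noteq> {}\<close>] by blast
        show "0 \<le> slack r v \<and> slack r v \<le> slack r (hi r)" if "r < k" "v \<in> Z" for r v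
          using hi[OF \<open>Z \<noteq> {}\<close>] slack0 that by blast
        show "1 - 3 / real L \<le> sum c Z" by (rule c1)
        show "- (3 / real L) \<le> (\<Sum>v\<in>Z. c v * (slack r v / slack r (hi r)))" if "r < k" for r
          using z[of "Suc r"] that by (simp add: D_def act_def \<theta>_def \<zeta>_def)
        show "(\<Sum>v\<in>Z. c v * vec v e) \<le> 3 / real L" if "e \<in> Fb" for e
          using z[of "1 + k + e"] that by (simp add: D_def act_def \<theta>_def \<zeta>_def Fb_def sum_negf)
        show "(\<Sum>v\<in>Z. c v * (1 - vec v e)) \<le> 3 / real L" if "e \<in> Fc" for e
          using z[of "1 + k + m + e"] that
          by (simp add: D_def act_def \<theta>_def \<zeta>_def Fc_def sum_negf right_diff_distrib sum_subtractf)
        have "real L = 4 * (2 * real m * (real k + 1) + 1)"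
          by (simp add: L_def algebra_simps)
        moreover have "0 \<le> 2 * real m * (real k + 1)" by simp
        ultimately show "3 / real L * (2 * real m * (real k + 1) + 1) < 1"
          by (simp add: divide_less_eq)
        show "Fb \<subseteq> {..<m}" "Fc \<subseteq> {..<m}" by (auto simp: Fb_def Fc_def)
      qed (auto simp: vec)
      then obtain C where C: "C \<in> Z" "\<And>e. e \<in> Fb \<Longrightarrow> vec C e = 0" "\<And>e. e \<in> Fc \<Longrightarrow> vec C e = 1"
        by blast
      have "C \<subseteq> E ` {..<m}"
        using C(1) unfolding Z_def tours_def setE by blast
      then have "(\<forall>e\<in>C. \<not> forb e x)"
        using C(2) unfolding Fb_def by (fastforce simp: vec split: if_splits)
      moreover have "forced \<subseteq> C"
        using C(3) forced unfolding setE Fc_def by (fastforce simp: vec split: if_splits)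
      ultimately show ?thesis
        using C(1) feas by blast
    qed
  qed
  then show ?thesis
    unfolding lp_size_def D_def[symmetric] L_def[symmetric]
    by (rule buildable_cong) (use feas in \<open>auto simp: Z_def\<close>)
qed

section \<open>From satisfiability to Hamiltonian cycles in digraphs\<close>

text \<open>Successor relations of cycle covers without 2-cycles: this consequence of Hamiltonicity is all
  that the soundness of the reduction uses.\<close>

definition cover :: "'a set \<Rightarrow> ('a \<Rightarrow> 'a \<Rightarrow> bool) \<Rightarrow> bool" where
  "cover U \<rho> \<longleftrightarrow> (\<forall>u\<in>U. \<exists>v. \<rho> u v) \<and> (\<forall>v\<in>U. \<exists>u. \<rho> u v) \<and>
     (\<forall>u v v'. \<rho> u v \<longrightarrow> \<rho> u v' \<longrightarrow> v = v') \<and> (\<forall>u u' v. \<rho> u v \<longrightarrow> \<rho> u' v \<longrightarrow> u = u') \<and>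
     (\<forall>u v. \<rho> u v \<longrightarrow> \<not> \<rho> v u)"

text \<open>The row is entered at position \<open>0\<close> from outside. Since every node is
  covered and there are no 2-cycles, the path can neither turn round nor leave through
  \<open>q j\<close> for another row. Row and clause nodes are abstract so that the same argument
  serves rows read from the right.\<close>

lemma traverse_row:
  fixes p q :: "nat \<Rightarrow> 'a"
  assumes fn: "\<And>u v v'. \<rho> u v \<Longrightarrow> \<rho> u v' \<Longrightarrow> v = v'"
    and inj: "\<And>u u' v. \<rho> u v \<Longrightarrow> \<rho> u' v \<Longrightarrow> u = u'"
    and no2: "\<And>u v. \<rho> u v \<Longrightarrow> \<not> \<rho> v u"
    and tot: "\<And>k. k \<le> 3 * B \<Longrightarrow> \<exists>v. \<rho> (p k) v" "\<And>k. k \<le> 3 * B \<Longrightarrow> \<exists>u. \<rho> u (p k)"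
    and nb: "\<And>k v. 0 < k \<Longrightarrow> k < 3 * B \<Longrightarrow> \<rho> (p k) v \<or> \<rho> v (p k) \<Longrightarrow>
      v = p (k - 1) \<or> v = p (k + 1) \<or> (\<exists>j. 0 < j \<and> v = q j \<and> (k = 3 * j + 1 \<or> k = 3 * j + 2))"
    and p: "\<And>k l. k \<le> 3 * B \<Longrightarrow> l \<le> 3 * B \<Longrightarrow> p k = p l \<Longrightarrow> k = l"
    and q: "\<And>j k. k \<le> 3 * B \<Longrightarrow> q j \<noteq> p k"
    and s: "\<rho> s (p 0)" "\<And>k. k \<le> 3 * B \<Longrightarrow> s \<noteq> p k"
  shows "j + 1 < B \<Longrightarrow> \<rho> (p (3 * j + 2)) (p (3 * j + 3))"
proof -
  have nb0: "v = p a \<or> v = p b"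
    if "0 < k" "k < 3 * B" "\<And>j'. 0 < j' \<Longrightarrow> k \<noteq> 3 * j' + 1 \<and> k \<noteq> 3 * j' + 2" "a = k - 1" "b = k + 1"
      "\<rho> (p k) v \<or> \<rho> v (p k)" for k a b v
    using nb[OF that(1,2,6)] that(3,4,5) by blast
  have nbq: "v = p a \<or> v = p b \<or> v = q j"
    if "0 < k" "k < 3 * B" "\<And>j'. k = 3 * j' + 1 \<or> k = 3 * j' + 2 \<Longrightarrow> j' = j" "a = k - 1" "b = k + 1"
      "\<rho> (p k) v \<or> \<rho> v (p k)" for k a b v j
    using nb[OF that(1,2,6)] that(3,4,5) by blast
  show "j + 1 < B \<Longrightarrow> \<rho> (p (3 * j + 2)) (p (3 * j + 3))"
  proof (induction j)
    case 0
    have nb1: "v = p 0 \<or> v = p 2" if "\<rho> (p 1) v \<or> \<rho> v (p 1)" for v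
      by (rule nb0[OF _ _ _ _ _ that]) (use 0 in presburger)+
    have nb2: "v = p 1 \<or> v = p 3" if "\<rho> (p 2) v \<or> \<rho> v (p 2)" for v
      by (rule nb0[OF _ _ _ _ _ that]) (use 0 in presburger)+
    obtain v where v: "\<rho> (p 1) v" using tot(1)[of 1] 0 by auto
    obtain u where u: "\<rho> u (p 1)" using tot(2)[of 1] 0 by auto
    \<comment> \<open>\<open>p 0\<close> already has the predecessor \<open>s\<close>, so
      \<open>p 1\<close> must continue to \<open>p 2\<close>, there being no clause in block
      \<open>0\<close>.\<close>
    have "v \<noteq> p 0" using inj[OF s(1)] v s(2)[of 1] 0 by auto
    then have v2: "\<rho> (p 1) (p 2)" using nb1 v by blast
    obtain w where w: "\<rho> (p 2) w" using tot(1)[of 2] 0 by auto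
    have "w \<noteq> p 1" using no2[OF v2] w by auto
    then show ?case using nb2 w by (auto simp: eval_nat_numeral)
  next
    case (Suc i)
    define j where "j = Suc i"
    have j: "0 < j" "j + 1 < B" using Suc.prems by (auto simp: j_def)
    have in_d: "\<rho> (p (3 * j - 1)) (p (3 * j))"
      using Suc by (simp add: j_def eval_nat_numeral)
    let ?d = "p (3 * j)" and ?a = "p (3 * j + 1)" and ?b = "p (3 * j + 2)" and ?d' = "p (3 * j + 3)"
      and ?a' = "p (3 * j + 4)"
    have W: "3 * j + 4 < 3 * B" using j by simp
    have nbd: "v = p (3 * j - 1) \<or> v = ?a" if "\<rho> ?d v \<or> \<rho> v ?d" for v
      by (rule nb0[OF _ _ _ _ _ that]) (use j in presburger)+
    have nba: "v = ?d \<or> v = ?b \<or> v = q j" if "\<rho> ?a v \<or> \<rho> v ?a" for v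
      by (rule nbq[OF _ _ _ _ _ that]) (use j in presburger)+
    have nbb: "v = ?a \<or> v = ?d' \<or> v = q j" if "\<rho> ?b v \<or> \<rho> v ?b" for v
      by (rule nbq[OF _ _ _ _ _ that]) (use j in presburger)+
    have nbd': "v = ?b \<or> v = ?a'" if "\<rho> ?d' v \<or> \<rho> v ?d'" for v
      by (rule nb0[OF _ _ _ _ _ that]) (use j in presburger)+
    have ne: "?d \<noteq> ?b" "?a \<noteq> ?d'" "?a \<noteq> ?b" "?d \<noteq> ?a"
      using p[of "3 * j" "3 * j + 2"] p[of "3 * j + 1" "3 * j + 3"] p[of "3 * j + 1" "3 * j + 2"]
        p[of "3 * j" "3 * j + 1"] W by auto
    have nq: "q j \<noteq> ?d" "q j \<noteq> ?a" "q j \<noteq> ?b" "q j \<noteq> ?d'"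
      using q[of _ j] W by auto
    obtain d1 where "\<rho> ?d d1" using tot(1)[of "3 * j"] W by auto
    then have da: "\<rho> ?d ?a" using nbd no2[OF in_d] by blast
    obtain a1 where a1: "\<rho> ?a a1" using tot(1)[of "3 * j + 1"] W by auto
    obtain b0 where b0: "\<rho> b0 ?b" using tot(2)[of "3 * j + 2"] W by auto
    obtain b1 where b1: "\<rho> ?b b1" using tot(1)[of "3 * j + 2"] W by auto
    obtain e0 where e0: "\<rho> e0 ?d'" using tot(2)[of "3 * j + 3"] W by auto
    obtain e1 where e1: "\<rho> ?d' e1" using tot(1)[of "3 * j + 3"] W by auto
    have b1_not_a: "b1 \<noteq> ?a" using inj[OF da] b1 ne by blast
    have "a1 = ?b \<or> a1 = q j" using nba a1 no2[OF da] by blast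
    \<comment> \<open>If \<open>?a\<close> leaves for the clause node, then \<open>?b\<close> still
      needs a predecessor, and the clause node is the only one possible.\<close>
    then have entered: "\<rho> ?a ?b \<or> (\<rho> ?a (q j) \<and> \<rho> (q j) ?b)"
    proof
      assume "a1 = q j"
      then have aq: "\<rho> ?a (q j)" using a1 by simp
      have "b0 \<noteq> ?a" using fn[OF aq] b0 nq by blast
      moreover have "b0 \<noteq> ?d'"
      proof
        assume "b0 = ?d'"
        then have "b1 \<noteq> ?d'" using no2 b0 b1 by blast
        then have "b1 = q j" using nbb b1 b1_not_a by blast
        then show False using inj[OF aq] b1 ne by blast
      qed
      ultimately show ?thesis using nbb b0 aq by blast
    qed (use a1 in auto)
    \<comment> \<open>Otherwise \<open>?d'\<close> could be entered only from the next block and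
      would have to continue to \<open>?b\<close>, which already has the predecessor
      \<open>?a\<close>.\<close>
    have "b1 \<noteq> q j"
    proof
      assume "b1 = q j"
      then have bq: "\<rho> ?b (q j)" using b1 by simp
      then have ab: "\<rho> ?a ?b" using entered no2 by blast
      have "e0 \<noteq> ?b" using fn[OF bq] e0 nq by blast
      then have "\<rho> ?a' ?d'" using nbd' e0 by blast
      then have "e1 = ?b" using nbd' e1 no2 by blast
      then show False using inj[OF ab] e1 ne by blast
    qed
    then have "\<rho> ?b ?d'" using nbb b1 b1_not_a by blast
    then show ?case by (simp add: j_def)
  qed
qed

text \<open>Each variable has a row of nodes that is traversed from left to right if the variable is true and
  from right to left if it is false. Positions \<open>3 * j + 1\<close> and \<open>3 * j + 2\<close> may be joined through clause \<open>j\<close>, in the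
  direction given by the literal; positions \<open>3 * j\<close> are separators. The blocks \<open>0\<close> and \<open>nc + 1\<close> belong to no
  clause, which prevents a row from being left at the end where it is entered.\<close>

datatype vert = St nat | Row nat nat | Cl nat

inductive arc :: "nat \<Rightarrow> nat \<Rightarrow> (nat \<Rightarrow> nat \<Rightarrow> bool \<Rightarrow> bool) \<Rightarrow> (nat \<Rightarrow> bool \<Rightarrow> bool) \<Rightarrow> vert \<Rightarrow> vert \<Rightarrow> bool"
  for nv nc lit ok where
  enterL: "i < nv \<Longrightarrow> ok i True \<Longrightarrow> arc nv nc lit ok (St i) (Row i 0)"
| enterR: "i < nv \<Longrightarrow> ok i False \<Longrightarrow> arc nv nc lit ok (St i) (Row i (3 * (nc + 2)))"
| exitL: "i < nv \<Longrightarrow> arc nv nc lit ok (Row i 0) (St (Suc i mod nv))"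
| exitR: "i < nv \<Longrightarrow> arc nv nc lit ok (Row i (3 * (nc + 2))) (St (Suc i mod nv))"
| right: "i < nv \<Longrightarrow> k < 3 * (nc + 2) \<Longrightarrow> arc nv nc lit ok (Row i k) (Row i (Suc k))"
| left: "i < nv \<Longrightarrow> k < 3 * (nc + 2) \<Longrightarrow> arc nv nc lit ok (Row i (Suc k)) (Row i k)"
| pos_out: "i < nv \<Longrightarrow> j \<in> {1..nc} \<Longrightarrow> lit i j True \<Longrightarrow> arc nv nc lit ok (Row i (3 * j + 1)) (Cl j)"
| pos_in: "i < nv \<Longrightarrow> j \<in> {1..nc} \<Longrightarrow> lit i j True \<Longrightarrow> arc nv nc lit ok (Cl j) (Row i (3 * j + 2))"
| neg_out: "i < nv \<Longrightarrow> j \<in> {1..nc} \<Longrightarrow> lit i j False \<Longrightarrow> arc nv nc lit ok (Row i (3 * j + 2)) (Cl j)"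
| neg_in: "i < nv \<Longrightarrow> j \<in> {1..nc} \<Longrightarrow> lit i j False \<Longrightarrow> arc nv nc lit ok (Cl j) (Row i (3 * j + 1))"

definition verts :: "nat \<Rightarrow> nat \<Rightarrow> vert set" where
  "verts nv nc = St ` {..<nv} \<union> (\<lambda>(i, k). Row i k) ` ({..<nv} \<times> {..3 * (nc + 2)}) \<union> Cl ` {1..nc}"

lemma arc_row_nb:
  assumes "arc nv nc lit ok (Row i k) v \<or> arc nv nc lit ok v (Row i k)" "0 < k" "k < 3 * (nc + 2)"
  shows "v = Row i (k - 1) \<or> v = Row i (k + 1) \<or>
    (\<exists>j\<in>{1..nc}. v = Cl j \<and> (k = 3 * j + 1 \<or> k = 3 * j + 2))"
  using assms(1)
proof
  assume "arc nv nc lit ok (Row i k) v"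
  then show ?thesis
    using assms(2,3) by cases auto
next
  assume "arc nv nc lit ok v (Row i k)"
  then show ?thesis
    using assms(2,3) by cases auto
qed

text \<open>A variable is true iff its row is entered at the left end. The direction of a row fixes
  the successor of the node on the far side of each block, so a clause node can be reached only from
  a row whose direction matches the literal.\<close>

lemma cover_imp_sat:
  assumes cov: "cover (verts nv nc) \<rho>" and sub: "\<And>u v. \<rho> u v \<Longrightarrow> arc nv nc lit ok u v"
  shows "\<exists>\<alpha>. (\<forall>i<nv. ok i (\<alpha> i)) \<and> (\<forall>j\<in>{1..nc}. \<exists>i<nv. lit i j (\<alpha> i))"
proof -
  have tot: "\<And>u. u \<in> verts nv nc \<Longrightarrow> \<exists>v. \<rho> u v" "\<And>v. v \<in> verts nv nc \<Longrightarrow> \<exists>u. \<rho> u v"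
    and fn: "\<And>u v v'. \<rho> u v \<Longrightarrow> \<rho> u v' \<Longrightarrow> v = v'"
    and inj: "\<And>u u' v. \<rho> u v \<Longrightarrow> \<rho> u' v \<Longrightarrow> u = u'"
    and no2: "\<And>u v. \<rho> u v \<Longrightarrow> \<not> \<rho> v u"
    using cov unfolding cover_def by blast+
  let ?W = "3 * (nc + 2)"
  define \<alpha> where "\<alpha> i \<longleftrightarrow> \<rho> (St i) (Row i 0)" for i
  have start: "ok i (\<alpha> i) \<and> (\<not> \<alpha> i \<longrightarrow> \<rho> (St i) (Row i ?W))" if i: "i < nv" for i
  proof -
    have "St i \<in> verts nv nc" using i by (auto simp: verts_def)
    then obtain v where v: "\<rho> (St i) v" using tot by blast
    from sub[OF v] consider "v = Row i 0" "ok i True" | "v = Row i ?W" "ok i False"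
      by cases auto
    then show ?thesis
    proof cases
      case 2
      have "\<not> \<alpha> i"
      proof
        assume "\<alpha> i"
        then have "v = Row i 0" using fn[OF v] by (simp add: \<alpha>_def)
        then show False using 2(1) by simp
      qed
      then show ?thesis using 2 v by simp
    qed (use v in \<open>simp add: \<alpha>_def\<close>)
  qed
  have row: "Row i k \<in> verts nv nc" if "i < nv" "k \<le> ?W" for i k
    unfolding verts_def using that by force
  have fwd: "\<rho> (Row i (3 * j + 2)) (Row i (3 * j + 3))" if "i < nv" "\<alpha> i" "j \<le> nc" for i j
  proof (rule traverse_row[where B = "nc + 2" and p = "Row i" and q = Cl and s = "St i"])
    show "v = Row i (k - 1) \<or> v = Row i (k + 1) \<or>
        (\<exists>j. 0 < j \<and> v = Cl j \<and> (k = 3 * j + 1 \<or> k = 3 * j + 2))"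
      if "0 < k" "k < ?W" "\<rho> (Row i k) v \<or> \<rho> v (Row i k)" for k v
      using arc_row_nb[of nv nc lit ok i k v] sub that by (metis atLeastAtMost_iff less_le_trans zero_less_one)
  qed (use fn inj no2 tot row that in \<open>auto simp: \<alpha>_def\<close>)
  \<comment> \<open>Reading the row from the right exchanges the two clause positions of a block and
    numbers the clauses backwards, whence \<open>Cl (nc + 1 - j)\<close>.\<close>
  have bwd: "\<rho> (Row i (?W - (3 * j + 2))) (Row i (?W - (3 * j + 3)))" if i: "i < nv" "\<not> \<alpha> i" "j \<le> nc" for i j
  proof (rule traverse_row[where B = "nc + 2" and p = "\<lambda>k. Row i (?W - k)" and q = "\<lambda>j. Cl (nc + 1 - j)" and s = "St i"])
    show "v = Row i (?W - (k - 1)) \<or> v = Row i (?W - (k + 1)) \<or>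
        (\<exists>j. 0 < j \<and> v = Cl (nc + 1 - j) \<and> (k = 3 * j + 1 \<or> k = 3 * j + 2))"
      if k: "0 < k" "k < ?W" and v: "\<rho> (Row i (?W - k)) v \<or> \<rho> v (Row i (?W - k))" for k v
    proof -
      have "v = Row i (?W - k - 1) \<or> v = Row i (?W - k + 1) \<or>
        (\<exists>j\<in>{1..nc}. v = Cl j \<and> (?W - k = 3 * j + 1 \<or> ?W - k = 3 * j + 2))"
      proof (rule arc_row_nb)
        show "arc nv nc lit ok (Row i (?W - k)) v \<or> arc nv nc lit ok v (Row i (?W - k))"
          using v sub by blast
      qed (use k in auto)
      then consider "v = Row i (?W - k - 1)" | "v = Row i (?W - k + 1)"
        | j where "j \<in> {1..nc}" "v = Cl j" "?W - k = 3 * j + 1 \<or> ?W - k = 3 * j + 2"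
        by blast
      then show ?thesis
      proof cases
        case 2
        moreover have "?W - k + 1 = ?W - (k - 1)" using k by simp
        ultimately show ?thesis by simp
      next
        case 3
        then have "k = 3 * (nc + 1 - j) + 2 \<or> k = 3 * (nc + 1 - j) + 1" using k by auto
        moreover have "nc + 1 - (nc + 1 - j) = j" "0 < nc + 1 - j" using 3(1) by auto
        ultimately show ?thesis using 3(2) by metis
      qed simp
    qed
    show "\<rho> (St i) (Row i (?W - 0))" using start i by simp
  qed (use fn inj no2 tot row that in auto)
  have "\<exists>i<nv. lit i j (\<alpha> i)" if j: "j \<in> {1..nc}" for j
  proof -
    have "Cl j \<in> verts nv nc" using j by (auto simp: verts_def)
    then obtain u where u: "\<rho> u (Cl j)" using tot by blast
    from sub[OF u] consider i where "u = Row i (3 * j + 1)" "i < nv" "lit i j True"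
      | i where "u = Row i (3 * j + 2)" "i < nv" "lit i j False"
      by cases auto
    then show ?thesis
    proof cases
      case 1
      have "\<alpha> i"
      proof (rule ccontr)
        assume "\<not> \<alpha> i"
        then have "\<rho> (Row i (?W - (3 * (nc + 1 - j) + 2))) (Row i (?W - (3 * (nc + 1 - j) + 3)))"
          using bwd[of i "nc + 1 - j"] 1 j by auto
        moreover have "?W - (3 * (nc + 1 - j) + 2) = 3 * j + 1" using j by auto
        ultimately show False using fn u 1 by (metis vert.distinct(6))
      qed
      then show ?thesis using 1 by auto
    next
      case 2
      have "\<not> \<alpha> i"
      proof
        assume "\<alpha> i"
        then have "\<rho> (Row i (3 * j + 2)) (Row i (3 * j + 3))"
          using fwd 2 j by auto
        then show False using fn u 2 by (metis vert.distinct(6))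
      qed
      then show ?thesis using 2 by auto
    qed
  qed
  then show ?thesis using start by blast
qed

section \<open>Hamiltonian cycles from satisfying assignments\<close>

primrec row_path :: "(nat \<Rightarrow> bool) \<Rightarrow> nat \<Rightarrow> nat \<Rightarrow> vert list" where
  "row_path c i 0 = [Row i 0]"
| "row_path c i (Suc b) = row_path c i b @ Row i (3 * b + 1) #
     (if c b then [Cl b] else []) @ [Row i (3 * b + 2), Row i (3 * b + 3)]"

lemma row_path_nonempty [simp]: "row_path c i b \<noteq> []"
  by (cases b) auto

lemma hd_row_path [simp]: "hd (row_path c i b) = Row i 0"
  by (induction b) auto

lemma last_row_path [simp]: "last (row_path c i b) = Row i (3 * b)"
  by (cases b) (auto simp: eval_nat_numeral)

lemma set_row_path: "set (row_path c i b) = Row i ` {..3 * b} \<union> Cl ` {j. j < b \<and> c j}"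
proof (induction b)
  case (Suc b)
  have "{..3 * Suc b} = {..3 * b} \<union> {3 * b + 1, 3 * b + 2, 3 * b + 3}"
    by auto
  moreover have "{j. j < Suc b \<and> c j} = {j. j < b \<and> c j} \<union> (if c b then {b} else {})"
    by (auto simp: less_Suc_eq)
  ultimately show ?case
    using Suc by auto
qed simp

lemma distinct_row_path: "distinct (row_path c i b)"
  by (induction b) (auto simp: set_row_path)

text \<open>\<open>R\<close> is arbitrary so that the converse of \<open>arc\<close> can be inserted
  for rows traversed from right to left.\<close>

lemma successively_row_path:
  assumes "\<And>k. k < 3 * b \<Longrightarrow> R (Row i k) (Row i (Suc k))"
    and "\<And>j. j < b \<Longrightarrow> c j \<Longrightarrow> R (Row i (3 * j + 1)) (Cl j) \<and> R (Cl j) (Row i (3 * j + 2))"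
  shows "successively R (row_path c i b)"
  using assms
proof (induction b)
  case (Suc b)
  have "R (Row i (3 * b)) (Row i (3 * b + 1))" "R (Row i (3 * b + 1)) (Row i (3 * b + 2))"
    "R (Row i (3 * b + 2)) (Row i (3 * b + 3))"
    using Suc.prems(1)[of "3 * b"] Suc.prems(1)[of "3 * b + 1"] Suc.prems(1)[of "3 * b + 2"]
    by (simp_all add: eval_nat_numeral)
  moreover have "successively R (row_path c i b)"
    by (rule Suc.IH) (use Suc.prems in auto)
  moreover have "c b \<Longrightarrow> R (Row i (3 * b + 1)) (Cl b) \<and> R (Cl b) (Row i (3 * b + 2))"
    using Suc.prems(2)[of b] by simp
  ultimately show ?case
    by (simp add: successively_append_iff)
qed simp

text \<open>\<open>sel j\<close> fixes the single row that picks up clause \<open>j\<close>, even if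
  several of its literals are true.\<close>

definition segment :: "nat \<Rightarrow> (nat \<Rightarrow> bool) \<Rightarrow> (nat \<Rightarrow> nat) \<Rightarrow> nat \<Rightarrow> vert list" where
  "segment nc \<alpha> sel i = St i #
     (let r = row_path (\<lambda>j. j \<in> {1..nc} \<and> sel j = i) i (nc + 2) in if \<alpha> i then r else rev r)"

lemma set_segment: "set (segment nc \<alpha> sel i) =
    {St i} \<union> Row i ` {..3 * (nc + 2)} \<union> Cl ` {j \<in> {1..nc}. sel j = i}"
proof -
  have "{j. j < nc + 2 \<and> j \<in> {1..nc} \<and> sel j = i} = {j \<in> {1..nc}. sel j = i}" by auto
  then show ?thesis
    unfolding segment_def by (simp only: Let_def list.set if_distrib set_rev set_row_path if_cancel) auto
qed

text \<open>The segments are concatenated cyclically. Both ends of a row have an arc to the next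
  start node, so neighbouring rows may run in different directions.\<close>

lemma sat_imp_ham_list:
  assumes "0 < nv" and ok: "\<And>i. i < nv \<Longrightarrow> ok i (\<alpha> i)"
    and sat: "\<And>j. j \<in> {1..nc} \<Longrightarrow> \<exists>i<nv. lit i j (\<alpha> i)"
  shows "\<exists>us. distinct us \<and> set us = verts nv nc \<and> us \<noteq> [] \<and>
     successively (arc nv nc lit ok) us \<and> arc nv nc lit ok (last us) (hd us)"
proof -
  let ?W = "3 * (nc + 2)"
  obtain sel where sel: "\<And>j. j \<in> {1..nc} \<Longrightarrow> sel j < nv \<and> lit (sel j) j (\<alpha> (sel j))"
    using sat by metis
  define A where "A = arc nv nc lit ok"
  have seg: "successively A (segment nc \<alpha> sel i)" "distinct (segment nc \<alpha> sel i)"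
    "A (last (segment nc \<alpha> sel i)) (St (Suc i mod nv))" if i: "i < nv" for i
  proof -
    let ?c = "\<lambda>j. j \<in> {1..nc} \<and> sel j = i"
    let ?r = "row_path ?c i (nc + 2)"
    show "distinct (segment nc \<alpha> sel i)"
      unfolding segment_def by (auto simp: Let_def distinct_row_path set_row_path)
    show "A (last (segment nc \<alpha> sel i)) (St (Suc i mod nv))"
      using exitL[OF i, of nc lit ok] exitR[OF i, of nc lit ok]
      by (simp add: segment_def Let_def last_rev A_def del: row_path.simps)
    show "successively A (segment nc \<alpha> sel i)"
    proof (cases "\<alpha> i")
      case True
      have lit: "lit i j True" if "j \<in> {1..nc}" "sel j = i" for j
        using sel[OF that(1)] that(2) True by simp
      have "successively A ?r"
        by (rule successively_row_path)
           (use i lit in \<open>auto simp: A_def intro!: arc.right arc.pos_out[simplified] arc.pos_in[simplified]\<close>)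
      moreover have "A (St i) (Row i 0)"
        using i ok[OF i] True by (simp add: A_def enterL)
      ultimately show ?thesis
        using True by (simp add: segment_def successively_Cons)
    next
      case False
      have lit: "lit i j False" if "j \<in> {1..nc}" "sel j = i" for j
        using sel[OF that(1)] that(2) False by simp
      have "successively (\<lambda>x y. A y x) ?r"
        by (rule successively_row_path)
           (use i lit in \<open>auto simp: A_def intro!: arc.left arc.neg_out[simplified] arc.neg_in[simplified]\<close>)
      moreover have "A (St i) (Row i ?W)"
        using enterR[where ok = ok and nc = nc and lit = lit, OF i] ok[OF i] False by (simp add: A_def)
      ultimately show ?thesis
        using False by (simp add: segment_def successively_Cons successively_rev hd_rev
            del: mult_Suc_right mult_Suc add_2_eq_Suc' row_path.simps)
    qed
  qed
  define us where "us b = concat (map (segment nc \<alpha> sel) [0..<b])" for b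
  have us_Suc: "us (Suc b) = us b @ segment nc \<alpha> sel b" for b
    by (simp add: us_def)
  have seg_ne: "segment nc \<alpha> sel b \<noteq> []" "hd (segment nc \<alpha> sel b) = St b" for b
    by (simp_all add: segment_def)
  have set_us: "set (us b) = St ` {..<b} \<union> (\<lambda>(i, k). Row i k) ` ({..<b} \<times> {..?W}) \<union>
      Cl ` {j \<in> {1..nc}. sel j < b}" for b
  proof (rule set_eqI)
    fix x
    show "x \<in> set (us b) \<longleftrightarrow> x \<in> St ` {..<b} \<union> (\<lambda>(i, k). Row i k) ` ({..<b} \<times> {..?W}) \<union>
      Cl ` {j \<in> {1..nc}. sel j < b}"
      unfolding us_def by (cases x) (auto simp: set_segment)
  qed
  have main: "distinct (us (Suc b)) \<and> successively A (us (Suc b)) \<and> hd (us (Suc b)) = St 0 \<and>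
      A (last (us (Suc b))) (St (Suc b mod nv))" if "b < nv" for b
    using that
  proof (induction b)
    case 0
    then show ?case
      using seg[of 0] seg_ne[of 0] by (simp add: us_def)
  next
    case (Suc b)
    have ne: "us (Suc b) \<noteq> []"
      by (simp add: us_Suc seg_ne)
    have "set (us (Suc b)) \<inter> set (segment nc \<alpha> sel (Suc b)) = {}"
      unfolding set_us set_segment by auto
    then show ?case
      using Suc seg[of "Suc b"] seg_ne[of "Suc b"] ne
      unfolding us_Suc[of "Suc b"] by (simp add: successively_append_iff)
  qed
  have "set (us nv) = verts nv nc"
    unfolding set_us verts_def using sel by auto
  moreover obtain b where "nv = Suc b"
    using \<open>0 < nv\<close> gr0_conv_Suc by auto
  ultimately show ?thesis
    using main[of b] unfolding A_def
    by (intro exI[of _ "us nv"]) (auto simp: us_Suc seg_ne)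
qed

section \<open>From digraphs to tours\<close>

text \<open>One of the two neighbours of a split node will be its partner on the forced edge; the
  other gives a unique successor or predecessor.\<close>

lemma ham_cycle_nbrs:
  assumes "ham_cycle n C" "x \<in> {1..n}"
  shows "card {y. {x, y} \<in> C} = 2"
proof -
  obtain vs where vs: "distinct vs" "set vs = {1..n}" "C = {{vs ! i, vs ! ((i + 1) mod n)} | i. i < n}"
    and n: "3 \<le> n"
    using assms(1) unfolding ham_cycle_def by blast
  have len: "length vs = n"
    using distinct_card[OF vs(1)] vs(2) by simp
  obtain i where i: "i < n" "x = vs ! i"
    using assms(2) vs(2) len by (metis in_set_conv_nth)
  have nth: "vs ! j = vs ! l \<longleftrightarrow> j = l" if "j < n" "l < n" for j l
    using nth_eq_iff_index_eq[OF vs(1)] that len by simp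
  define s where "s = (if i + 1 = n then 0 else i + 1)"
  define p where "p = (if i = 0 then n - 1 else i - 1)"
  have modS: "(j + 1) mod n = (if j + 1 = n then 0 else j + 1)" if "j < n" for j
    using that by auto
  have sp: "s < n" "p < n" "s \<noteq> p"
    using i n by (auto simp: s_def p_def)
  have "{y. {x, y} \<in> C} = {vs ! s, vs ! p}"
  proof (intro equalityI subsetI)
    fix y assume "y \<in> {y. {x, y} \<in> C}"
    then obtain j where j: "j < n" "{x, y} = {vs ! j, vs ! ((j + 1) mod n)}"
      using vs(3) by auto
    then consider "x = vs ! j" "y = vs ! ((j + 1) mod n)" | "x = vs ! ((j + 1) mod n)" "y = vs ! j"
      by (auto simp: doubleton_eq_iff)
    then show "y \<in> {vs ! s, vs ! p}"
    proof cases
      case 1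
      then have "j = i" using nth i j by auto
      then show ?thesis using 1 modS[OF j(1)] by (simp add: s_def)
    next
      case 2
      have "(j + 1) mod n < n" using n by simp
      moreover have "vs ! ((j + 1) mod n) = vs ! i" using 2(1) i(2) by simp
      ultimately have "(j + 1) mod n = i" using nth i(1) by blast
      then have "j = p" using modS[OF j(1)] j(1) n by (auto simp: p_def split: if_splits)
      then show ?thesis using 2 by simp
    qed
  next
    fix y assume "y \<in> {vs ! s, vs ! p}"
    then consider "y = vs ! s" | "y = vs ! p" by blast
    then have "\<exists>j<n. {x, y} = {vs ! j, vs ! ((j + 1) mod n)}"
    proof cases
      case 1
      then show ?thesis using i modS[OF i(1)] by (intro exI[of _ i]) (auto simp: s_def)
    next
      case 2
      have "(p + 1) mod n = i" using modS[OF sp(2)] i n by (auto simp: p_def split: if_splits)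
      then show ?thesis using 2 i sp by (intro exI[of _ p]) (auto simp: insert_commute)
    qed
    then show "y \<in> {y. {x, y} \<in> C}" using vs(3) by auto
  qed
  then show ?thesis
    using nth[OF sp(1,2)] sp(3) by simp
qed

text \<open>This excludes 2-cycles of the digraph, which would be closed sets of four nodes.\<close>

lemma ham_cycle_connected:
  assumes "ham_cycle n C" "X \<subseteq> {1..n}" "X \<noteq> {}" "\<And>x y. x \<in> X \<Longrightarrow> {x, y} \<in> C \<Longrightarrow> y \<in> X"
  shows "X = {1..n}"
proof -
  obtain vs where vs: "distinct vs" "set vs = {1..n}" "C = {{vs ! i, vs ! ((i + 1) mod n)} | i. i < n}"
    and n: "3 \<le> n"
    using assms(1) unfolding ham_cycle_def by blast
  have len: "length vs = n"
    using distinct_card[OF vs(1)] vs(2) by simp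
  obtain i where i: "i < n" "vs ! i \<in> X"
    using assms(2,3) vs(2) len by (metis ex_in_conv in_set_conv_nth subsetD)
  have *: "vs ! ((i + t) mod n) \<in> X" for t
  proof (induction t)
    case 0
    then show ?case using i by simp
  next
    case (Suc t)
    let ?j = "(i + t) mod n"
    have "{vs ! ?j, vs ! ((?j + 1) mod n)} \<in> C"
      unfolding vs(3) using n by (intro CollectI exI[of _ ?j]) auto
    then have "vs ! ((?j + 1) mod n) \<in> X"
      using assms(4) Suc by blast
    then show ?case by (simp add: mod_Suc_eq)
  qed
  have "vs ! j \<in> X" if "j < n" for j
    using *[of "j + n - i"] i that by simp
  then show ?thesis
    using assms(2) vs(2) len by (metis in_set_conv_nth subsetI subset_antisym)
qed

text \<open>The digraph vertex \<open>u\<close> is split into the nodes \<open>2 e u + 1\<close>, which receives its incoming arcs, and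
  \<open>2 e u + 2\<close>, which emits its outgoing arcs.\<close>

definition split_edges :: "('a \<Rightarrow> nat) \<Rightarrow> 'a set \<Rightarrow> nat set set" where
  "split_edges e U = (\<lambda>u. {2 * e u + 1, 2 * e u + 2}) ` U"

definition arc_edges :: "('a \<Rightarrow> nat) \<Rightarrow> 'a set \<Rightarrow> ('a \<Rightarrow> 'a \<Rightarrow> bool) \<Rightarrow> nat set set" where
  "arc_edges e U A = {{2 * e u + 2, 2 * e v + 1} | u v. u \<in> U \<and> v \<in> U \<and> u \<noteq> v \<and> A u v}"

text \<open>The even endpoint is the tail and the odd one the head, so an undirected edge still
  determines its arc.\<close>

lemma doubleton_parity:
  "{2 * a + 2, 2 * b + 1} = {2 * c + 2, 2 * d + 1} \<longleftrightarrow> a = c \<and> b = (d::nat)"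
proof -
  have "2 * a + 2 \<noteq> 2 * d + 1" "2 * b + 1 \<noteq> 2 * c + 2" by presburger+
  then show ?thesis by (auto simp: doubleton_eq_iff)
qed

lemma tour_imp_cover:
  assumes e: "bij_betw e U {..<V}" and V: "3 \<le> V"
    and C: "C \<in> tours (2 * V)" "split_edges e U \<subseteq> C" "C \<subseteq> split_edges e U \<union> arc_edges e U A"
  shows "\<exists>\<rho>. cover U \<rho> \<and> (\<forall>u v. \<rho> u v \<longrightarrow> A u v)"
proof -
  have ham: "ham_cycle (2 * V) C" using C(1) by (simp add: tours_def)
  have e_lt: "e u < V" if "u \<in> U" for u
    using e that by (auto simp: bij_betw_def)
  have e_inj: "e u = e v \<longleftrightarrow> u = v" if "u \<in> U" "v \<in> U" for u v
    using e that by (auto simp: bij_betw_def inj_on_def)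
  have split_iff: "{2 * a + 2, 2 * b + 1} \<in> split_edges e U \<longleftrightarrow> (\<exists>u\<in>U. a = e u \<and> b = e u)" for a b
  proof -
    have "{2 * a + 2, 2 * b + 1} = {2 * e u + 1, 2 * e u + 2} \<longleftrightarrow> a = e u \<and> b = e u" for u
      using doubleton_parity[of a b "e u" "e u"] by (simp add: insert_commute)
    then show ?thesis by (auto simp: split_edges_def)
  qed
  define \<rho> where "\<rho> u v \<longleftrightarrow> u \<in> U \<and> v \<in> U \<and> u \<noteq> v \<and> {2 * e u + 2, 2 * e v + 1} \<in> C" for u v
  have \<rho>A: "A u v" if "\<rho> u v" for u v
  proof -
    have "{2 * e u + 2, 2 * e v + 1} \<notin> split_edges e U"
      using that unfolding split_iff by (auto simp: \<rho>_def e_inj)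
    then have "{2 * e u + 2, 2 * e v + 1} \<in> arc_edges e U A"
      using that C(3) by (auto simp: \<rho>_def)
    then obtain u' v' where "u' \<in> U" "v' \<in> U" "A u' v'" "{2 * e u + 2, 2 * e v + 1} = {2 * e u' + 2, 2 * e v' + 1}"
      unfolding arc_edges_def by blast
    then show ?thesis
      using that unfolding doubleton_parity by (auto simp: \<rho>_def e_inj)
  qed
  have C_cases: "(\<exists>u\<in>U. ed = {2 * e u + 2, 2 * e u + 1}) \<or> (\<exists>u v. \<rho> u v \<and> ed = {2 * e u + 2, 2 * e v + 1})"
    if "ed \<in> C" for ed
  proof -
    from that C(3) consider "ed \<in> split_edges e U" | "ed \<in> arc_edges e U A" by blast
    then show ?thesis
    proof cases
      case 1
      then show ?thesis by (auto simp: split_edges_def insert_commute)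
    next
      case 2
      then obtain u v where "u \<in> U" "v \<in> U" "u \<noteq> v" "ed = {2 * e u + 2, 2 * e v + 1}"
        unfolding arc_edges_def by blast
      then show ?thesis using that unfolding \<rho>_def by blast
    qed
  qed
  have out: "{y. {2 * e u + 2, y} \<in> C} = insert (2 * e u + 1) ((\<lambda>v. 2 * e v + 1) ` {v. \<rho> u v})"
    if u: "u \<in> U" for u
  proof (intro equalityI subsetI)
    fix y assume "y \<in> {y. {2 * e u + 2, y} \<in> C}"
    then have "{2 * e u + 2, y} \<in> C" by simp
    from C_cases[OF this] show "y \<in> insert (2 * e u + 1) ((\<lambda>v. 2 * e v + 1) ` {v. \<rho> u v})"
    proof (elim disjE bexE exE conjE)
      fix w assume "w \<in> U" "{2 * e u + 2, y} = {2 * e w + 2, 2 * e w + 1}"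
      then show ?thesis
        by (auto simp: doubleton_eq_iff) presburger+
    next
      fix w v assume w: "\<rho> w v" "{2 * e u + 2, y} = {2 * e w + 2, 2 * e v + 1}"
      moreover have "2 * e u + 2 \<noteq> 2 * e v + 1" by presburger
      ultimately have "e u = e w" "y = 2 * e v + 1" by (auto simp: doubleton_eq_iff)
      then show ?thesis using w u by (auto simp: e_inj \<rho>_def)
    qed
  next
    fix y assume "y \<in> insert (2 * e u + 1) ((\<lambda>v. 2 * e v + 1) ` {v. \<rho> u v})"
    then show "y \<in> {y. {2 * e u + 2, y} \<in> C}"
      using C(2) u by (auto simp: \<rho>_def split_edges_def insert_commute)
  qed
  have inn: "{y. {2 * e u + 1, y} \<in> C} = insert (2 * e u + 2) ((\<lambda>v. 2 * e v + 2) ` {v. \<rho> v u})"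
    if u: "u \<in> U" for u
  proof (intro equalityI subsetI)
    fix y assume "y \<in> {y. {2 * e u + 1, y} \<in> C}"
    then have "{2 * e u + 1, y} \<in> C" by simp
    from C_cases[OF this] show "y \<in> insert (2 * e u + 2) ((\<lambda>v. 2 * e v + 2) ` {v. \<rho> v u})"
    proof (elim disjE bexE exE conjE)
      fix w assume "w \<in> U" "{2 * e u + 1, y} = {2 * e w + 2, 2 * e w + 1}"
      then show ?thesis
        by (auto simp: doubleton_eq_iff) presburger+
    next
      fix w v assume w: "\<rho> w v" "{2 * e u + 1, y} = {2 * e w + 2, 2 * e v + 1}"
      moreover have "2 * e u + 1 \<noteq> 2 * e w + 2" by presburger
      ultimately have "e u = e v" "y = 2 * e w + 2" by (auto simp: doubleton_eq_iff)
      then show ?thesis using w u by (auto simp: e_inj \<rho>_def)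
    qed
  next
    fix y assume "y \<in> insert (2 * e u + 2) ((\<lambda>v. 2 * e v + 2) ` {v. \<rho> v u})"
    then show "y \<in> {y. {2 * e u + 1, y} \<in> C}"
      using C(2) u by (auto simp: \<rho>_def split_edges_def insert_commute)
  qed
  have in_range: "2 * e u + 1 \<in> {1..2 * V}" "2 * e u + 2 \<in> {1..2 * V}" if "u \<in> U" for u
    using e_lt[OF that] by auto
  have inj1: "inj_on (\<lambda>v. 2 * e v + 1) U" "inj_on (\<lambda>v. 2 * e v + 2) U"
    using e_inj by (auto simp: inj_on_def)
  have succ1: "card {v. \<rho> u v} = 1" if u: "u \<in> U" for u
  proof -
    have fin: "finite {v. \<rho> u v}"
      using e by (auto simp: \<rho>_def bij_betw_finite intro: finite_subset[of _ U])
    have "2 = card (insert (2 * e u + 1) ((\<lambda>v. 2 * e v + 1) ` {v. \<rho> u v}))"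
      using ham_cycle_nbrs[OF ham in_range(2)[OF u]] unfolding out[OF u] by simp
    also have "\<dots> = Suc (card ((\<lambda>v. 2 * e v + 1) ` {v. \<rho> u v}))"
      by (rule card_insert_disjoint[OF finite_imageI[OF fin]]) (use u in \<open>auto simp: \<rho>_def e_inj\<close>)
    also have "card ((\<lambda>v. 2 * e v + 1) ` {v. \<rho> u v}) = card {v. \<rho> u v}"
      by (rule card_image) (rule inj_on_subset[OF inj1(1)], auto simp: \<rho>_def)
    finally show ?thesis by simp
  qed
  have pred1: "card {v. \<rho> v u} = 1" if u: "u \<in> U" for u
  proof -
    have fin: "finite {v. \<rho> v u}"
      using e by (auto simp: \<rho>_def bij_betw_finite intro: finite_subset[of _ U])
    have "2 = card (insert (2 * e u + 2) ((\<lambda>v. 2 * e v + 2) ` {v. \<rho> v u}))"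
      using ham_cycle_nbrs[OF ham in_range(1)[OF u]] unfolding inn[OF u] by simp
    also have "\<dots> = Suc (card ((\<lambda>v. 2 * e v + 2) ` {v. \<rho> v u}))"
      by (rule card_insert_disjoint[OF finite_imageI[OF fin]]) (use u in \<open>auto simp: \<rho>_def e_inj\<close>)
    also have "card ((\<lambda>v. 2 * e v + 2) ` {v. \<rho> v u}) = card {v. \<rho> v u}"
      by (rule card_image) (rule inj_on_subset[OF inj1(2)], auto simp: \<rho>_def)
    finally show ?thesis by simp
  qed
  have fn: "v = v'" if "\<rho> u v" "\<rho> u v'" for u v v'
  proof -
    have "u \<in> U" using that by (simp add: \<rho>_def)
    from succ1[OF this] obtain w where "{v. \<rho> u v} = {w}" by (auto simp: card_1_singleton_iff)
    then show ?thesis using that by (metis mem_Collect_eq singletonD)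
  qed
  have inj: "u = u'" if "\<rho> u v" "\<rho> u' v" for u u' v
  proof -
    have "v \<in> U" using that by (simp add: \<rho>_def)
    from pred1[OF this] obtain w where "{u. \<rho> u v} = {w}" by (auto simp: card_1_singleton_iff)
    then show ?thesis using that by (metis mem_Collect_eq singletonD)
  qed
  have "\<not> \<rho> v u" if uv: "\<rho> u v" for u v
  proof
    assume vu: "\<rho> v u"
    have U: "u \<in> U" "v \<in> U" using uv by (auto simp: \<rho>_def)
    \<comment> \<open>The four halves of \<open>u\<close> and \<open>v\<close> are closed under
      neighbourhood, yet the tour has at least six nodes.\<close>
    define X where "X = {2 * e u + 1, 2 * e u + 2, 2 * e v + 1, 2 * e v + 2}"
    have "\<rho> u w \<longleftrightarrow> w = v" "\<rho> v w \<longleftrightarrow> w = u" "\<rho> w u \<longleftrightarrow> w = v" "\<rho> w v \<longleftrightarrow> w = u" for w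
      using uv vu fn inj by blast+
    then have S: "{w. \<rho> u w} = {v}" "{w. \<rho> v w} = {u}" "{w. \<rho> w u} = {v}" "{w. \<rho> w v} = {u}"
      by simp_all
    have "{y. {x, y} \<in> C} \<subseteq> X" if "x \<in> X" for x
    proof -
      from that consider "x = 2 * e u + 1" | "x = 2 * e u + 2" | "x = 2 * e v + 1" | "x = 2 * e v + 2"
        unfolding X_def by blast
      then show ?thesis
        by cases (simp_all only: out[OF U(1)] out[OF U(2)] inn[OF U(1)] inn[OF U(2)] S, auto simp: X_def)
    qed
    then have "y \<in> X" if "x \<in> X" "{x, y} \<in> C" for x y
      using that by blast
    then have "X = {1..2 * V}"
      using in_range U by (intro ham_cycle_connected[OF ham]) (auto simp: X_def)
    then have "2 * V = card X" by simp
    also have "\<dots> \<le> 4"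
      unfolding X_def by (rule card_insert_le_m1 | simp)+
    finally show False using V by simp
  qed
  note no2 = this
  have "\<exists>v. \<rho> u v" if "u \<in> U" for u
    using succ1[OF that] by (metis card_1_singletonE mem_Collect_eq singletonI)
  moreover have "\<exists>u. \<rho> u v" if "v \<in> U" for v
    using pred1[OF that] by (metis card_1_singletonE mem_Collect_eq singletonI)
  ultimately have "cover U \<rho>"
    unfolding cover_def using fn inj no2 by blast
  then show ?thesis using \<rho>A by blast
qed

lemma ham_list_imp_tour:
  assumes e: "bij_betw e U {..<V}" and V: "2 \<le> V"
    and us: "distinct us" "set us = U" "successively A us" "A (last us) (hd us)"
  shows "\<exists>C\<in>tours (2 * V). split_edges e U \<subseteq> C \<and> C \<subseteq> split_edges e U \<union> arc_edges e U A"
proof -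
  have "finite U" using e by (simp add: bij_betw_finite)
  have len: "length us = V"
    using distinct_card[OF us(1)] us(2) bij_betw_same_card[OF e] by simp
  have eU: "e ` U = {..<V}" using e by (simp add: bij_betw_def)
  have e_inj: "e u = e v \<longleftrightarrow> u = v" if "u \<in> U" "v \<in> U" for u v
    using e that by (auto simp: bij_betw_def inj_on_def)
  \<comment> \<open>Positions \<open>2 * t\<close> and \<open>2 * t + 1\<close> of the tour hold the
    entering and the leaving half of the vertex \<open>us ! t\<close>.\<close>
  define f where "f i = 2 * e (us ! (i div 2)) + 1 + i mod 2" for i
  define vs where "vs = map f [0..<2 * V]"
  define C where "C = {{vs ! i, vs ! ((i + 1) mod (2 * V))} | i. i < 2 * V}"
  have usU: "us ! i \<in> U" if "i < V" for i
    using that len us(2) by (metis nth_mem)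
  have us_inj: "us ! i = us ! j \<longleftrightarrow> i = j" if "i < V" "j < V" for i j
    using nth_eq_iff_index_eq[OF us(1)] that len by simp
  have "inj_on f {0..<2 * V}"
  proof (rule inj_onI)
    fix i j assume "i \<in> {0..<2 * V}" "j \<in> {0..<2 * V}" "f i = f j"
    then have ij: "i div 2 < V" "j div 2 < V" by auto
    have "e (us ! (i div 2)) = e (us ! (j div 2))" "i mod 2 = j mod 2"
      using \<open>f i = f j\<close> unfolding f_def by presburger+
    then have "i div 2 = j div 2"
      using e_inj[OF usU[OF ij(1)] usU[OF ij(2)]] us_inj[OF ij] by simp
    then show "i = j" using \<open>i mod 2 = j mod 2\<close> by (metis div_mult_mod_eq)
  qed
  then have dist: "distinct vs"
    unfolding vs_def by (simp add: distinct_map)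
  have e_lt: "e u < V" if "u \<in> U" for u
    using eU that by auto
  have "f i \<in> {1..2 * V}" if "i < 2 * V" for i
  proof -
    have "i div 2 < V" using that by simp
    then have "e (us ! (i div 2)) < V" by (intro e_lt usU)
    moreover have "i mod 2 < 2" by simp
    ultimately have "1 \<le> f i" "f i \<le> 2 * V" unfolding f_def by linarith+
    then show ?thesis by simp
  qed
  then have "set vs \<subseteq> {1..2 * V}"
    unfolding vs_def by auto
  moreover have "card (set vs) = card {1..2 * V}"
    using distinct_card[OF dist] by (simp add: vs_def)
  ultimately have set_vs: "set vs = {1..2 * V}"
    by (intro card_subset_eq) auto
  have ham: "ham_cycle (2 * V) C"
    unfolding ham_cycle_def using dist set_vs V by (auto simp: C_def)
  have next_arc: "A (us ! t) (us ! ((t + 1) mod V))" if "t < V" for t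
  proof (cases "t + 1 = V")
    case True
    then have "us ! t = last us" "us ! ((t + 1) mod V) = hd us"
      using len V by (auto simp: last_conv_nth hd_conv_nth length_greater_0_conv[symmetric]
          simp del: length_greater_0_conv)
    then show ?thesis using us(4) by simp
  next
    case False
    then show ?thesis
      using us(3) that len by (auto simp: successively_conv_nth)
  qed
  have even: "{vs ! (2 * t), vs ! ((2 * t + 1) mod (2 * V))} = {2 * e (us ! t) + 1, 2 * e (us ! t) + 2}"
    if "t < V" for t
    using that by (simp add: vs_def f_def)
  have odd: "{vs ! (2 * t + 1), vs ! ((2 * t + 1 + 1) mod (2 * V))}
      = {2 * e (us ! t) + 2, 2 * e (us ! ((t + 1) mod V)) + 1}" if "t < V" for t
  proof -
    have "(2 * t + 1 + 1) mod (2 * V) = 2 * ((t + 1) mod V)"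
      by (simp add: mult_mod_right)
    then show ?thesis using that by (simp add: vs_def f_def)
  qed
  have split: "split_edges e U \<subseteq> C"
  proof
    fix ed assume "ed \<in> split_edges e U"
    then obtain t where "t < V" "ed = {2 * e (us ! t) + 1, 2 * e (us ! t) + 2}"
      using us(2) len by (auto simp: split_edges_def in_set_conv_nth)
    then show "ed \<in> C"
      unfolding C_def using even[of t] by (intro CollectI exI[of _ "2 * t"]) auto
  qed
  have sub: "C \<subseteq> split_edges e U \<union> arc_edges e U A"
  proof
    fix ed assume "ed \<in> C"
    then obtain i where i: "i < 2 * V" "ed = {vs ! i, vs ! ((i + 1) mod (2 * V))}"
      by (auto simp: C_def)
    show "ed \<in> split_edges e U \<union> arc_edges e U A"
    proof (cases "even i")
      case True
      then obtain t where "i = 2 * t" by blast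
      then show ?thesis
        using i even[of t] usU[of t] by (auto simp: split_edges_def)
    next
      case False
      then obtain t where t: "i = 2 * t + 1" by (auto elim: oddE)
      then have "t < V" using i by simp
      then have "us ! t \<noteq> us ! ((t + 1) mod V)"
        using V by (subst us_inj) (auto simp: mod_Suc)
      then show ?thesis
        using i t odd[OF \<open>t < V\<close>] usU[OF \<open>t < V\<close>] usU[of "(t + 1) mod V"] next_arc[OF \<open>t < V\<close>] \<open>t < V\<close>
        unfolding arc_edges_def by auto
    qed
  qed
  have "C \<subseteq> set (edges_list (2 * V))"
  proof
    fix ed assume "ed \<in> C"
    then obtain i where i: "i < 2 * V" "ed = {vs ! i, vs ! ((i + 1) mod (2 * V))}"
      by (auto simp: C_def)
    have lv: "length vs = 2 * V" by (simp add: vs_def)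
    have "(i + 1) mod (2 * V) < 2 * V" "(i + 1) mod (2 * V) \<noteq> i"
      using V i by (auto simp: mod_Suc)
    then have "vs ! i \<noteq> vs ! ((i + 1) mod (2 * V))" "vs ! i \<in> {1..2 * V}" "vs ! ((i + 1) mod (2 * V)) \<in> {1..2 * V}"
      using nth_eq_iff_index_eq[OF dist] i lv set_vs by (auto simp flip: set_vs)
    then show "ed \<in> set (edges_list (2 * V))"
      unfolding set_edges_list i(2)
      by (cases "vs ! i < vs ! ((i + 1) mod (2 * V))") (auto, (metis insert_commute linorder_neqE_nat)+)
  qed
  then have "C \<in> tours (2 * V)"
    using ham by (simp add: tours_def)
  then show ?thesis using split sub by blast
qed

section \<open>From circuits to tours\<close>

text \<open>All gates are treated as binary. A missing or illegal argument is replaced by the gate's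
  own variable \<open>n + k\<close>, whose value \<open>gate_fun\<close> then ignores.\<close>

fun gate_args :: "nat \<Rightarrow> nat \<Rightarrow> gate \<Rightarrow> nat \<times> nat" where
  "gate_args n k (Input i) = (if i < n then i else n + k, n + k)"
| "gate_args n k (Const b) = (n + k, n + k)"
| "gate_args n k (Not i) = (if i < k then n + i else n + k, n + k)"
| "gate_args n k (And i j) = (if i < k then n + i else n + k, if j < k then n + j else n + k)"
| "gate_args n k (Or i j) = (if i < k then n + i else n + k, if j < k then n + j else n + k)"

fun gate_fun :: "nat \<Rightarrow> nat \<Rightarrow> gate \<Rightarrow> bool \<Rightarrow> bool \<Rightarrow> bool" where
  "gate_fun n k (Input i) p q \<longleftrightarrow> i < n \<and> p"
| "gate_fun n k (Const b) p q \<longleftrightarrow> b"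
| "gate_fun n k (Not i) p q \<longleftrightarrow> \<not> (i < k \<and> p)"
| "gate_fun n k (And i j) p q \<longleftrightarrow> (i < k \<and> p) \<and> (j < k \<and> q)"
| "gate_fun n k (Or i j) p q \<longleftrightarrow> (i < k \<and> p) \<or> (j < k \<and> q)"

lemma gate_args_le: "fst (gate_args n k g) \<le> n + k" "snd (gate_args n k g) \<le> n + k"
  by (cases g; simp)+

lemma gate_fun_correct:
  assumes "\<And>i. i < n \<Longrightarrow> \<alpha> i = x ! i" "length x = n" "\<And>i. i < k \<Longrightarrow> \<alpha> (n + i) = vs ! i" "length vs = k"
  shows "gate_val vs x g = gate_fun n k g (\<alpha> (fst (gate_args n k g))) (\<alpha> (snd (gate_args n k g)))"
  using assms by (cases g) auto

text \<open>Variables \<open>0..<n\<close> are the inputs and variable \<open>n + k\<close> is the value of gate \<open>k\<close>. The clause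
  \<open>Some (k, p, q, r)\<close> forbids the values \<open>p, q, r\<close> of the arguments and the output of gate \<open>k\<close>,
  unless the gate allows them, in which case the clause contains every literal.\<close>

fun tseitin :: "nat \<Rightarrow> gate list \<Rightarrow> (nat \<times> bool \<times> bool \<times> bool) option \<Rightarrow> nat \<Rightarrow> bool \<Rightarrow> bool" where
  "tseitin n C None i b \<longleftrightarrow> i = n + length C - 1 \<and> b"
| "tseitin n C (Some (k, p, q, r)) i b \<longleftrightarrow> r = gate_fun n k (C ! k) p q \<or>
     i = fst (gate_args n k (C ! k)) \<and> b \<noteq> p \<or> i = snd (gate_args n k (C ! k)) \<and> b \<noteq> q \<or> i = n + k \<and> b \<noteq> r"

text \<open>Eight triples of values for each gate, and \<open>None\<close> to demand that the last
  gate be true.\<close>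

definition tseitin_clauses :: "gate list \<Rightarrow> (nat \<times> bool \<times> bool \<times> bool) option set" where
  "tseitin_clauses C = insert None (Some ` ({..<length C} \<times> UNIV))"

lemma card_tseitin_clauses: "card (tseitin_clauses C) = 8 * length C + 1" "finite (tseitin_clauses C)"
proof -
  show fin: "finite (tseitin_clauses C)" by (simp add: tseitin_clauses_def)
  have "card (Some ` ({..<length C} \<times> (UNIV :: (bool \<times> bool \<times> bool) set))) = 8 * length C"
    by (subst card_image) (simp_all add: card_cartesian_product UNIV_Times_UNIV[symmetric] del: UNIV_Times_UNIV)
  then show "card (tseitin_clauses C) = 8 * length C + 1"
    unfolding tseitin_clauses_def by (subst card_insert_disjoint) auto
qed

lemma tseitin_correct:
  assumes "C \<noteq> []" "length x = n"
  shows "circuit_eval C x \<longleftrightarrow> (\<exists>\<alpha>. (\<forall>i<n. \<alpha> i = x ! i) \<and>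
    (\<forall>c\<in>tseitin_clauses C. \<exists>i<n + length C. tseitin n C c i (\<alpha> i)))"
proof -
  let ?s = "length C"
  have last: "circuit_eval C x = circuit_wires C x ! (?s - 1)"
    using assms(1) length_circuit_wires[of C x] unfolding circuit_eval_def
    by (metis last_conv_nth length_0_conv)
  show ?thesis
  proof
    assume eval: "circuit_eval C x"
    define \<alpha> where "\<alpha> i = (if i < n then x ! i else circuit_wires C x ! (i - n))" for i
    have "\<exists>i<n + ?s. tseitin n C c i (\<alpha> i)" if "c \<in> tseitin_clauses C" for c
    proof (cases c)
      case None
      have "\<not> n + ?s - 1 < n" "n + ?s - 1 - n = ?s - 1" "n + ?s - 1 < n + ?s"
        using assms(1) by (cases C; simp)+
      with None show ?thesis
        using eval assms(1) unfolding last by (intro exI[of _ "n + ?s - 1"]) (simp add: \<alpha>_def)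
    next
      case (Some t)
      obtain k p q r where t: "t = (k, p, q, r)" by (cases t)
      have k: "k < ?s" using that Some t by (auto simp: tseitin_clauses_def)
      let ?g = "C ! k"
      have "circuit_wires C x ! k = gate_val (take k (circuit_wires C x)) x ?g"
        using k by (rule circuit_wires_nth)
      also have "\<dots> = gate_fun n k ?g (\<alpha> (fst (gate_args n k ?g))) (\<alpha> (snd (gate_args n k ?g)))"
        by (rule gate_fun_correct) (use k assms(2) in \<open>auto simp: \<alpha>_def\<close>)
      finally have *: "\<alpha> (n + k) = gate_fun n k ?g (\<alpha> (fst (gate_args n k ?g))) (\<alpha> (snd (gate_args n k ?g)))"
        by (simp add: \<alpha>_def)
      have le: "fst (gate_args n k ?g) < n + ?s" "snd (gate_args n k ?g) < n + ?s" "n + k < n + ?s"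
        using gate_args_le[of n k ?g] k by auto
      consider "\<alpha> (fst (gate_args n k ?g)) \<noteq> p" | "\<alpha> (snd (gate_args n k ?g)) \<noteq> q"
        | "\<alpha> (n + k) \<noteq> r" | "r = gate_fun n k ?g p q"
        using * by (cases "\<alpha> (fst (gate_args n k ?g)) = p"; cases "\<alpha> (snd (gate_args n k ?g)) = q") auto
      then show ?thesis
        unfolding Some t using le by cases (metis tseitin.simps(2))+
    qed
    then show "\<exists>\<alpha>. (\<forall>i<n. \<alpha> i = x ! i) \<and> (\<forall>c\<in>tseitin_clauses C. \<exists>i<n + ?s. tseitin n C c i (\<alpha> i))"
      by (intro exI[of _ \<alpha>]) (auto simp: \<alpha>_def)
  next
    assume "\<exists>\<alpha>. (\<forall>i<n. \<alpha> i = x ! i) \<and> (\<forall>c\<in>tseitin_clauses C. \<exists>i<n + ?s. tseitin n C c i (\<alpha> i))"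
    then obtain \<alpha> where \<alpha>': "\<forall>i<n. \<alpha> i = x ! i"
      "\<forall>c\<in>tseitin_clauses C. \<exists>i<n + ?s. tseitin n C c i (\<alpha> i)" by (elim exE conjE)
    then have \<alpha>: "\<And>i. i < n \<Longrightarrow> \<alpha> i = x ! i"
      "\<And>c. c \<in> tseitin_clauses C \<Longrightarrow> \<exists>i. tseitin n C c i (\<alpha> i)"
      by (simp, meson)
    have "\<alpha> (n + k) = circuit_wires C x ! k" if "k < ?s" for k
      using that
    proof (induction k rule: less_induct)
      case (less k)
      let ?g = "C ! k"
      \<comment> \<open>This clause forbids exactly the values that the assignment takes, so it can
        hold only because the gate allows them.\<close>
      have "Some (k, \<alpha> (fst (gate_args n k ?g)), \<alpha> (snd (gate_args n k ?g)), \<alpha> (n + k)) \<in> tseitin_clauses C"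
        using less.prems by (auto simp: tseitin_clauses_def)
      from \<alpha>(2)[OF this] have "\<alpha> (n + k) = gate_fun n k ?g (\<alpha> (fst (gate_args n k ?g))) (\<alpha> (snd (gate_args n k ?g)))"
        by auto
      also have "\<dots> = gate_val (take k (circuit_wires C x)) x ?g"
        by (rule gate_fun_correct[symmetric]) (use less \<alpha>(1) assms(2) in auto)
      also have "\<dots> = circuit_wires C x ! k"
        using less.prems by (rule circuit_wires_nth[symmetric])
      finally show ?case .
    qed
    from this[of "?s - 1"] have "\<alpha> (n + ?s - 1) = circuit_wires C x ! (?s - 1)"
      using assms(1) by (simp add: Suc_le_eq)
    moreover have "\<alpha> (n + ?s - 1)"
      using \<alpha>(2)[of None] by (auto simp: tseitin_clauses_def)
    ultimately show "circuit_eval C x"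
      unfolding last by simp
  qed
qed

text \<open>Only the entry arcs of the rows of input variables depend on the input; one gate reads
  the bit and one may negate it.\<close>

lemma buildable_arc:
  "buildable n {} 2 {\<lambda>x. arc nv nc lit (\<lambda>i b. i < n \<longrightarrow> x ! i = b) u v}"
proof -
  let ?ok = "\<lambda>x i b. i < n \<longrightarrow> x ! i = b"
  let ?W = "3 * (nc + 2)"
  consider i where "u = St i" "v = Row i 0" "i < n" "i < nv"
    | i where "u = St i" "v = Row i ?W" "i < n" "i < nv"
    | "\<And>i. i < n \<Longrightarrow> i < nv \<Longrightarrow> u = St i \<Longrightarrow> v \<noteq> Row i 0 \<and> v \<noteq> Row i ?W"
    by blast
  then show ?thesis
  proof cases
    case 1
    have "arc nv nc lit (?ok x) u v \<longleftrightarrow> x ! i" for x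
    proof
      assume "arc nv nc lit (?ok x) u v"
      then show "x ! i" unfolding 1 using \<open>i < n\<close> by cases auto
    next
      assume "x ! i"
      then show "arc nv nc lit (?ok x) u v" unfolding 1 using 1 by (intro arc.enterL) auto
    qed
    then show ?thesis
      using buildable_le[OF buildable_input[OF \<open>i < n\<close>, of "{}"], of 2] by simp
  next
    case 2
    have "arc nv nc lit (?ok x) u v \<longleftrightarrow> \<not> x ! i" for x
    proof
      assume "arc nv nc lit (?ok x) u v"
      then show "\<not> x ! i" unfolding 2 using \<open>i < n\<close> by cases auto
    next
      assume "\<not> x ! i"
      then show "arc nv nc lit (?ok x) u v" unfolding 2(1,2) using 2 by (intro arc.enterR) auto
    qed
    then show ?thesis
      using buildable_le[OF buildable_not[OF buildable_input[OF \<open>i < n\<close>, of "{}"]], of 2] by simp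
  next
    case 3
    have "arc nv nc lit (?ok y) u v" if "arc nv nc lit (?ok x) u v" for x y
      using that
    proof cases
      case (enterL i)
      then have "\<not> i < n" using 3 by blast
      then show ?thesis unfolding enterL(1,2) using enterL(3) by (intro arc.enterL) auto
    next
      case (enterR i)
      then have "\<not> i < n" using 3 by blast
      then show ?thesis unfolding enterR(1,2) using enterR(3) by (intro arc.enterR) auto
    qed (simp_all only: arc.intros(3-10))
    \<comment> \<open>The relation is constant in \<open>x\<close> here, so any word can serve to
      evaluate it.\<close>
    then have "arc nv nc lit (?ok []) u v = arc nv nc lit (?ok x) u v" for x
      by blast
    then show ?thesis
      by (intro buildable_le[OF buildable_cong[OF buildable_const[of n "{}" "arc nv nc lit (?ok []) u v"]]]) auto
  qed
qed

text \<open>The digraph has a vertex set that depends on \<open>C\<close>, \<open>n\<close> and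
  \<open>l\<close> but not on \<open>x\<close>; the input only determines which edges fall outside
  \<open>good x\<close> and are forbidden. The \<open>3\<close> is the cost of an arc and a
  negation.\<close>

lemma buildable_exists_witness:
  assumes "C \<noteq> []"
    and TSP: "\<And>m. \<exists>A B b. conv (vec_of_word ` {x \<in> TSP. length x = m}) = proj_polyhedron m (p m) A B b"
  shows "\<exists>m \<le> (2 * ((n + l + length C) * (24 * length C + 12) + 8 * length C + 1))\<^sup>2.
     buildable n {} (lp_size m (p m) 3) {\<lambda>x. \<exists>w. length w = l \<and> circuit_eval C (x @ w)}"
proof -
  define nv where "nv = n + l + length C"
  define nc where "nc = 8 * length C + 1"
  have "\<exists>h. bij_betw h {1..nc} (tseitin_clauses C)"
    using ex_bij_betw_nat_finite_1[OF card_tseitin_clauses(2)] by (simp add: nc_def card_tseitin_clauses)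
  then obtain h where h: "bij_betw h {1..nc} (tseitin_clauses C)" by blast
  define lit where "lit i j b = tseitin (n + l) C (h j) i b" for i j b
  define ok where "ok x i b \<longleftrightarrow> (i < n \<longrightarrow> x ! i = b)" for x :: word and i b
  have "0 < nv" using assms(1) by (simp add: nv_def)
  have hc: "(\<forall>c\<in>tseitin_clauses C. P c) \<longleftrightarrow> (\<forall>j\<in>{1..nc}. P (h j))" for P
  proof -
    have "tseitin_clauses C = h ` {1..nc}" using h by (simp add: bij_betw_def)
    then show ?thesis by (simp only: ball_simps)
  qed
  have sat: "(\<exists>w. length w = l \<and> circuit_eval C (x @ w)) \<longleftrightarrow>
     (\<exists>\<alpha>. (\<forall>i<nv. ok x i (\<alpha> i)) \<and> (\<forall>j\<in>{1..nc}. \<exists>i<nv. lit i j (\<alpha> i)))" (is "?L \<longleftrightarrow> ?R")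
    if x: "length x = n" for x
  proof
    assume ?L
    then obtain w where w: "length w = l" "circuit_eval C (x @ w)" by blast
    then obtain \<alpha> where "\<forall>i<n + l. \<alpha> i = (x @ w) ! i"
      "\<forall>c\<in>tseitin_clauses C. \<exists>i<n + l + length C. tseitin (n + l) C c i (\<alpha> i)"
      using tseitin_correct[OF assms(1), of "x @ w" "n + l"] x by auto
    then show ?R
      unfolding hc using x by (intro exI[of _ \<alpha>]) (auto simp: ok_def lit_def nv_def nth_append)
  next
    assume ?R
    then obtain \<alpha> where \<alpha>: "\<forall>i<nv. ok x i (\<alpha> i)" "\<forall>j\<in>{1..nc}. \<exists>i<nv. lit i j (\<alpha> i)" by blast
    define w where "w = map (\<lambda>i. \<alpha> (n + i)) [0..<l]"
    have "circuit_eval C (x @ w)"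
    proof (subst tseitin_correct[OF assms(1), of "x @ w" "n + l"])
      show "length (x @ w) = n + l" using x by (simp add: w_def)
      show "\<exists>\<alpha>. (\<forall>i<n + l. \<alpha> i = (x @ w) ! i) \<and>
        (\<forall>c\<in>tseitin_clauses C. \<exists>i<n + l + length C. tseitin (n + l) C c i (\<alpha> i))"
        unfolding hc
        by (intro exI[of _ \<alpha>]) (use \<alpha> x in \<open>auto simp: ok_def lit_def nv_def nth_append w_def\<close>)
    qed
    then show ?L by (intro exI[of _ w]) (simp add: w_def)
  qed
  define U where "U = verts nv nc"
  have "finite U" by (simp add: U_def verts_def)
  define V where "V = card U"
  obtain e where e: "bij_betw e U {..<V}"
    using ex_bij_betw_finite_nat[OF \<open>finite U\<close>] by (auto simp: V_def atLeast0LessThan)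
  have "3 \<le> V"
  proof -
    have "Row 0 ` {..<3} \<subseteq> U"
      using \<open>0 < nv\<close> unfolding U_def verts_def by force
    then have "card (Row 0 ` {..<3::nat}) \<le> V"
      unfolding V_def using \<open>finite U\<close> by (rule card_mono[rotated])
    then show ?thesis by (simp add: card_image inj_on_def)
  qed
  \<comment> \<open>A variable contributes its start node and a row of
    \<open>24 * length C + 10\<close> nodes, and there are \<open>8 * length C + 1\<close> clause
    nodes.\<close>
  have V_le: "V \<le> nv * (24 * length C + 12) + 8 * length C + 1"
  proof -
    have "V \<le> card (St ` {..<nv}) + card ((\<lambda>(i, k). Row i k) ` ({..<nv} \<times> {..3 * (nc + 2)})) + card (Cl ` {1..nc})"
      unfolding V_def U_def verts_def by (meson add_le_mono1 card_Un_le order_trans)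
    also have "\<dots> \<le> card {..<nv} + card ({..<nv} \<times> {..3 * (nc + 2)}) + card {1..nc}"
      by (intro add_mono card_image_le) auto
    also have "\<dots> = nv + nv * (3 * (nc + 2) + 1) + nc"
      by (simp add: card_cartesian_product)
    also have "\<dots> \<le> nv * (24 * length C + 12) + 8 * length C + 1"
      by (simp add: nc_def algebra_simps)
    finally show ?thesis .
  qed
  define m where "m = length (edges_list (2 * V))"
  obtain A B b where AB: "conv (vec_of_word ` {x \<in> TSP. length x = m}) = proj_polyhedron m (p m) A B b"
    using TSP by blast
  define good where "good x = split_edges e U \<union> arc_edges e U (arc nv nc lit (ok x))" for x
  have e_inj: "e u = e v \<longleftrightarrow> u = v" if "u \<in> U" "v \<in> U" for u v
    using e that by (auto simp: bij_betw_def inj_on_def)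
  have tour: "(\<exists>C\<in>tours (2 * V). (\<forall>ed\<in>C. \<not> ed \<notin> good x) \<and> split_edges e U \<subseteq> C) \<longleftrightarrow>
     (\<exists>\<alpha>. (\<forall>i<nv. ok x i (\<alpha> i)) \<and> (\<forall>j\<in>{1..nc}. \<exists>i<nv. lit i j (\<alpha> i)))" (is "?L \<longleftrightarrow> ?R") for x
  proof
    assume ?L
    then obtain C where "C \<in> tours (2 * V)" "split_edges e U \<subseteq> C" "C \<subseteq> good x" by blast
    then obtain \<rho> where "cover U \<rho>" "\<forall>u v. \<rho> u v \<longrightarrow> arc nv nc lit (ok x) u v"
      using tour_imp_cover[OF e \<open>3 \<le> V\<close>] unfolding good_def by blast
    then show ?R
      using cover_imp_sat[of nv nc \<rho> lit "ok x"] unfolding U_def by blast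
  next
    assume ?R
    then obtain us where us: "distinct us" "set us = U" "successively (arc nv nc lit (ok x)) us"
      "arc nv nc lit (ok x) (last us) (hd us)"
      using sat_imp_ham_list[OF \<open>0 < nv\<close>, of "ok x" _ nc lit] unfolding U_def by blast
    then obtain C0 where "C0 \<in> tours (2 * V)" "split_edges e U \<subseteq> C0" "C0 \<subseteq> good x"
      using ham_list_imp_tour[OF e _ us] \<open>3 \<le> V\<close> unfolding good_def by auto
    then show ?L by blast
  qed
  have "buildable n {} (lp_size m (p m) 3) {\<lambda>x. \<exists>C\<in>tours (2 * V). (\<forall>ed\<in>C. \<not> ed \<notin> good x) \<and> split_edges e U \<subseteq> C}"
  proof (rule buildable_tour[OF _ m_def AB])
    show "3 \<le> 2 * V" using \<open>3 \<le> V\<close> by simp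
    show "split_edges e U \<subseteq> set (edges_list (2 * V))"
    proof
      fix ed assume "ed \<in> split_edges e U"
      then obtain u where "u \<in> U" "ed = {2 * e u + 1, 2 * e u + 2}"
        by (auto simp: split_edges_def)
      moreover have "e u < V" using e \<open>u \<in> U\<close> by (auto simp: bij_betw_def)
      ultimately show "ed \<in> set (edges_list (2 * V))"
        unfolding set_edges_list by (intro CollectI exI[of _ "2 * e u + 1"] exI[of _ "2 * e u + 2"]) auto
    qed
    show "buildable n {} 3 {\<lambda>x. ed \<notin> good x}" for ed
    proof -
      consider "ed \<in> split_edges e U"
        | u v where "ed \<notin> split_edges e U" "u \<in> U" "v \<in> U" "u \<noteq> v" "ed = {2 * e u + 2, 2 * e v + 1}"
        | "ed \<notin> split_edges e U" "\<And>u v. u \<in> U \<Longrightarrow> v \<in> U \<Longrightarrow> u \<noteq> v \<Longrightarrow> ed \<noteq> {2 * e u + 2, 2 * e v + 1}"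
        by blast
      then show ?thesis
      proof cases
        case 1
        then have "ed \<notin> good x \<longleftrightarrow> False" for x by (simp add: good_def)
        then show ?thesis using buildable_le[OF buildable_const[of n "{}" False], of 3] by simp
      next
        case 2
        have "ed \<in> arc_edges e U R \<longleftrightarrow> R u v" for R
        proof
          assume "ed \<in> arc_edges e U R"
          then obtain u' v' where "u' \<in> U" "v' \<in> U" "R u' v'" "ed = {2 * e u' + 2, 2 * e v' + 1}"
            unfolding arc_edges_def by blast
          then show "R u v"
            using 2 unfolding 2(5) doubleton_parity by (auto simp: e_inj)
        next
          assume "R u v"
          then show "ed \<in> arc_edges e U R" using 2 unfolding arc_edges_def by blast
        qed
        then have "ed \<notin> good x \<longleftrightarrow> \<not> arc nv nc lit (ok x) u v" for x
          using 2(1) by (simp add: good_def)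
        then show ?thesis
          using buildable_le[OF buildable_not[OF buildable_arc[of n nv nc lit u v]], of 3] by (simp add: ok_def[abs_def])
      next
        case 3
        then have "ed \<notin> arc_edges e U R" for R
          unfolding arc_edges_def by blast
        then have "ed \<notin> good x \<longleftrightarrow> True" for x using 3(1) by (simp add: good_def)
        then show ?thesis using buildable_le[OF buildable_const[of n "{}" True], of 3] by simp
      qed
    qed
  qed
  then have "buildable n {} (lp_size m (p m) 3) {\<lambda>x. \<exists>w. length w = l \<and> circuit_eval C (x @ w)}"
    by (rule buildable_cong) (simp only: tour sat)
  moreover have "m \<le> (2 * ((n + l + length C) * (24 * length C + 12) + 8 * length C + 1))\<^sup>2"
  proof -
    have "m \<le> (2 * V) * (2 * V)"
      unfolding m_def by (rule length_edges_list_le)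
    also have "\<dots> = (2 * V)\<^sup>2" by (simp only: power2_eq_square)
    also have "\<dots> \<le> (2 * ((n + l + length C) * (24 * length C + 12) + 8 * length C + 1))\<^sup>2"
      using V_le unfolding nv_def by (intro power_mono mult_le_mono2) auto
    finally show ?thesis .
  qed
  ultimately show ?thesis by blast
qed

section \<open>Turing machines\<close>

abbreviation tm_run :: "tm \<Rightarrow> nat list \<Rightarrow> nat \<Rightarrow> config" where
  "tm_run M w t \<equiv> (tm_step M ^^ t) (init_config w)"

lemma tm_step_halted: "fst c = 1 \<Longrightarrow> tm_step M c = c"
  by (cases c) (simp add: tm_step_def)

text \<open>Accepting configurations are fixed points of the step function, so it suffices to
  inspect the last configuration.\<close>

lemma tm_accepts_within_iff: "tm_accepts_within M w t \<longleftrightarrow> fst (tm_run M w t) = 1"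
proof
  assume "tm_accepts_within M w t"
  then obtain s where s: "s \<le> t" "fst (tm_run M w s) = 1"
    by (auto simp: tm_accepts_within_def)
  show "fst (tm_run M w t) = 1"
    using s(1) by (induction t rule: dec_induct) (use s(2) in \<open>auto simp: tm_step_halted\<close>)
qed (auto simp: tm_accepts_within_def)

text \<open>With halting turned into a step that changes nothing, all steps follow a single
  table.\<close>

definition halting_delta :: "tm \<Rightarrow> nat \<Rightarrow> nat \<Rightarrow> nat \<times> nat \<times> int" where
  "halting_delta M q a = (if q = 1 \<or> q = 2 then (q, a, 0) else delta M q a)"

lemma tm_step_halting_delta:
  "tm_step M (q, tp, h) = (case halting_delta M q (tp h) of (q', a', d) \<Rightarrow> (q', tp(h := a'), h + d))"
  by (simp add: tm_step_def halting_delta_def)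

lemma halting_delta_valid:
  assumes "valid_tm M" "q < nq M" "a < ns M" "halting_delta M q a = (q', a', d)"
  shows "q' < nq M" "a' < ns M" "d \<in> {-1, 0, 1}"
proof -
  have "q' < nq M \<and> a' < ns M \<and> d \<in> {-1, 0, 1}"
  proof (cases "q = 1 \<or> q = 2")
    case True
    then have "q' = q" "a' = a" "d = 0"
      using assms(4) by (simp_all add: halting_delta_def)
    then show ?thesis using assms(2,3) by simp
  next
    case False
    then have "delta M q a = (q', a', d)"
      using assms(4) by (simp add: halting_delta_def)
    moreover have "case delta M q a of (q', a', d) \<Rightarrow> q' < nq M \<and> a' < ns M \<and> d \<in> {-1, 0, 1}"
      using assms(1)[unfolded valid_tm_def, THEN conjunct2, THEN conjunct2, rule_format, of q a] assms(2,3)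
      by (simp only: simp_thms)
    ultimately show ?thesis by (simp only: prod.case)
  qed
  then show "q' < nq M" "a' < ns M" "d \<in> {-1, 0, 1}" by blast+
qed

text \<open>These bounds limit the states, symbols and head positions that the circuit has to
  represent.\<close>

lemma tm_run_invariant:
  assumes M: "valid_tm M" and w: "set w \<subseteq> {1, 2, 3}"
  shows "case tm_run M w t of (q, tp, h) \<Rightarrow> q < nq M \<and> (\<forall>i. tp i < ns M) \<and> \<bar>h\<bar> \<le> int t"
proof (induction t)
  case 0
  have ns: "4 \<le> ns M" "3 \<le> nq M" using M by (simp_all only: valid_tm_def)
  have "w ! i < ns M" if "i < length w" for i
  proof -
    have "w ! i \<in> {1, 2, 3}" using w that nth_mem by blast
    then show ?thesis using ns by auto
  qed
  then show ?case
    using ns by (auto simp: init_config_def)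
next
  case (Suc t)
  obtain q tp h where run: "tm_run M w t = (q, tp, h)" by (cases "tm_run M w t")
  obtain q' a' d where \<delta>: "halting_delta M q (tp h) = (q', a', d)"
    by (cases "halting_delta M q (tp h)")
  have "q < nq M" "\<And>i. tp i < ns M" "\<bar>h\<bar> \<le> int t" using Suc run by auto
  moreover from halting_delta_valid[OF M this(1,2) \<delta>]
  have "q' < nq M" "a' < ns M" "d \<in> {-1, 0, 1}" by auto
  ultimately show ?case
    by (auto simp: run tm_step_halting_delta \<delta>)
qed

text \<open>The circuit reads input and certificate as one word \<open>u\<close>, which is cut after
  \<open>n\<close> bits to insert the separator.\<close>

definition tape_word :: "nat \<Rightarrow> word \<Rightarrow> nat list" where
  "tape_word n u = enc_bits (take n u) @ [3] @ enc_bits (drop n u)"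

lemma set_tape_word: "set (tape_word n u) \<subseteq> {1, 2, 3}"
  by (auto simp: tape_word_def enc_bits_def)

lemma length_tape_word: "length u = n + l \<Longrightarrow> length (tape_word n u) = n + l + 1"
  by (simp add: tape_word_def enc_bits_def)

lemma tape_word_nth:
  assumes "length u = n + l" "i < n + l + 1"
  shows "tape_word n u ! i =
    (if i < n then if u ! i then 2 else 1 else if i = n then 3 else if u ! (i - 1) then 2 else 1)"
proof -
  consider "i < n" | "i = n" | "n < i" by linarith
  then show ?thesis
  proof cases
    case 3
    define j where "j = i - Suc n"
    have "i = n + Suc j" "j < l" using 3 assms(2) by (simp_all add: j_def)
    then show ?thesis using assms(1) by (simp add: tape_word_def enc_bits_def nth_append)
  qed (use assms(1) in \<open>simp_all add: tape_word_def enc_bits_def nth_append\<close>)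
qed

text \<open>One wire for each combination of time, cell and either state or symbol, over the cells
  from \<open>- T\<close> to \<open>T\<close>. Head position and state share a wire
  \<open>H\<close>, because a transition depends on the state at the cell being read.\<close>

lemma buildable_tm:
  assumes M: "valid_tm M"
  shows "buildable (n + l) {} ((2 * T + 1) * (nq M + ns M) * 3 + T * ((2 * T + 1) * (nq M + ns M) *
      (10 * (3 * nq M * ns M) + 5 * nq M + 20)) + (4 * (2 * T + 1) + 1))
    {\<lambda>u. tm_accepts_within M (tape_word n u) T}"
proof -
  define run where "run t u = tm_run M (tape_word n u) t" for t u
  define H where "H t = (\<lambda>(i, q) u. fst (run t u) = q \<and> snd (snd (run t u)) = i)" for t :: nat
  define Y where "Y t = (\<lambda>(i, a) u. fst (snd (run t u)) i = a)" for t :: nat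
  define I where "I = {- int T..int T}"
  define S where "S t = H t ` (I \<times> {..<nq M}) \<union> Y t ` (I \<times> {..<ns M})" for t
  let ?k = "10 * (3 * nq M * ns M) + 5 * nq M + 20"
  have cardI: "card I = 2 * T + 1" "finite I" by (simp_all add: I_def)
  have inv: "fst (run t u) < nq M" "fst (snd (run t u)) i < ns M" "\<bar>snd (snd (run t u))\<bar> \<le> int t" for t u i
    using tm_run_invariant[OF M set_tape_word[of n u], of t] by (auto simp: run_def split: prod.splits)
  have S_buildable: "buildable (n + l) F ((2 * T + 1) * (nq M + ns M) * k) (S t)"
    if "\<And>i q. i \<in> I \<Longrightarrow> q < nq M \<Longrightarrow> buildable (n + l) F k {H t (i, q)}"
      "\<And>i a. i \<in> I \<Longrightarrow> a < ns M \<Longrightarrow> buildable (n + l) F k {Y t (i, a)}" for F k t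
  proof -
    have "buildable (n + l) F (card (I \<times> {..<nq M}) * k) (H t ` (I \<times> {..<nq M}))"
      by (rule buildable_singletons) (use that cardI in auto)
    moreover have "buildable (n + l) F (card (I \<times> {..<ns M}) * k) (Y t ` (I \<times> {..<ns M}))"
      by (rule buildable_singletons) (use that cardI in auto)
    then have "buildable (n + l) (F \<union> H t ` (I \<times> {..<nq M})) (card (I \<times> {..<ns M}) * k) (Y t ` (I \<times> {..<ns M}))"
      by (rule buildable_mono) auto
    ultimately have "buildable (n + l) F (card (I \<times> {..<nq M}) * k + card (I \<times> {..<ns M}) * k) (S t)"
      unfolding S_def by (rule buildable_trans)
    then show ?thesis
      by (rule buildable_le) (simp add: card_cartesian_product cardI algebra_simps)
  qed
  have S0: "buildable (n + l) {} ((2 * T + 1) * (nq M + ns M) * 3) (S 0)"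
  proof (rule S_buildable)
    show "buildable (n + l) {} 3 {H 0 (i, q)}" for i q
      by (rule buildable_cong[OF buildable_le[OF buildable_const[of _ _ "q = 0 \<and> i = 0"]]])
         (auto simp: H_def run_def init_config_def)
    show "buildable (n + l) {} 3 {Y 0 (i, a)}" for i a
    proof -
      have nth: "fst (snd (run 0 u)) i = (if 0 \<le> i \<and> i < int (n + l + 1) then
          (if nat i < n then if u ! nat i then 2 else 1 else if nat i = n then 3
           else if u ! (nat i - 1) then 2 else 1) else 0)"
        if "length u = n + l" for u
        unfolding run_def init_config_def using tape_word_nth[OF that] length_tape_word[OF that] by (auto simp: nat_less_iff)
      have bit: "buildable (n + l) {} 3 {\<lambda>u. (if u ! j then 2 else 1) = a}" if "j < n + l" for j
      proof -
        consider "a = 2" | "a = 1" | "a \<noteq> 1" "a \<noteq> 2" by blast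
        then show ?thesis
        proof cases
          case 1
          show ?thesis
            by (rule buildable_cong[OF buildable_le[OF buildable_input[OF that]]]) (auto simp: 1)
        next
          case 2
          show ?thesis
            by (rule buildable_cong[OF buildable_le[OF buildable_not[OF buildable_input[OF that]]]]) (auto simp: 2)
        next
          case 3
          show ?thesis
            by (rule buildable_cong[OF buildable_le[OF buildable_const[of _ _ False]]]) (use 3 in auto)
        qed
      qed
      consider "0 \<le> i" "nat i < n" | "i = int n" | "i < 0 \<or> int (n + l + 1) \<le> i"
        | "int n < i" "i < int (n + l + 1)" by linarith
      then show ?thesis
      proof cases
        case 1
        then have "nat i < n + l" by simp
        from bit[OF this] show ?thesis
          by (rule buildable_cong) (use 1 nth in \<open>auto simp: Y_def\<close>)
      next
        case 2
        show ?thesis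
          by (rule buildable_cong[OF buildable_le[OF buildable_const[of _ _ "a = 3"]]]) (use 2 nth in \<open>auto simp: Y_def\<close>)
      next
        case 3
        show ?thesis
          by (rule buildable_cong[OF buildable_le[OF buildable_const[of _ _ "a = 0"]]]) (use 3 nth in \<open>auto simp: Y_def\<close>)
      next
        case 4
        then have lt: "nat i - 1 < n + l" by linarith
        have eq: "fst (snd (run 0 u)) i = (if u ! (nat i - 1) then 2 else 1)" if "length u = n + l" for u
        proof -
          have "0 \<le> i" "\<not> nat i < n" "nat i \<noteq> n" using 4 by linarith+
          then show ?thesis using nth[OF that] 4(2) by simp
        qed
        show ?thesis
          by (rule buildable_cong[OF bit[OF lt]]) (auto simp: Y_def eq)
      qed
    qed
  qed
  define K where "K = {-1, 0, 1 :: int} \<times> {..<nq M} \<times> {..<ns M}"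
  have K: "finite K" "card K = 3 * nq M * ns M" by (simp_all add: K_def card_cartesian_product)
  have K': "card (({..<nq M} \<times> {..<ns M}) \<inter> X) \<le> 3 * nq M * ns M" for X
  proof -
    have "card (({..<nq M} \<times> {..<ns M}) \<inter> X) \<le> card ({..<nq M} \<times> {..<ns M})"
      by (intro card_mono) auto
    then show ?thesis by (simp add: card_cartesian_product)
  qed
  have atH: "buildable (n + l) ({} \<union> S t) 0 {H t (i, q)}" if "i \<in> I" "q < nq M" for t i q
    by (rule buildable_subset) (use that in \<open>auto simp: S_def\<close>)
  have atY: "buildable (n + l) ({} \<union> S t) 0 {Y t (i, a)}" if "i \<in> I" "a < ns M" for t i a
    by (rule buildable_subset) (use that in \<open>auto simp: S_def\<close>)
  have run_Suc: "run (Suc t) u = (case halting_delta M (fst (run t u)) (fst (snd (run t u)) (snd (snd (run t u)))) of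
      (q', a', d) \<Rightarrow> (q', (fst (snd (run t u)))(snd (snd (run t u)) := a'), snd (snd (run t u)) + d))" for t u
  proof -
    obtain p tp h where r: "run t u = (p, tp, h)" by (cases "run t u")
    have "run (Suc t) u = tm_step M (run t u)" by (simp add: run_def)
    then show ?thesis by (simp add: r tm_step_halting_delta)
  qed
  have step: "buildable (n + l) ({} \<union> S t) ((2 * T + 1) * (nq M + ns M) * ?k) (S (Suc t))" if t: "t < T" for t
  proof (rule S_buildable)
    fix i q assume i: "i \<in> I" and q: "q < nq M"
    \<comment> \<open>The possible last transitions into cell \<open>i\<close>: a move
      \<open>d\<close> from cell \<open>i - d\<close>, in state \<open>p\<close>, while reading
      \<open>b\<close>. The old cell is in range because \<open>t < T\<close>.\<close>
    let ?J = "{(d, p, b) \<in> K. i - d \<in> I \<and> (\<exists>a. halting_delta M p b = (q, a, d))}"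
    have "card ?J \<le> 3 * nq M * ns M"
      unfolding K(2)[symmetric] by (rule card_mono) (use K(1) in auto)
    moreover have "finite ?J"
      by (rule finite_subset[OF _ K(1)]) auto
    then have "buildable (n + l) ({} \<union> S t) (card ?J * (1 + 4) + 1)
        {\<lambda>u. \<exists>j\<in>?J. case j of (d, p, b) \<Rightarrow> H t (i - d, p) u \<and> Y t (i - d, b) u}"
    proof (rule buildable_ex)
      fix j assume "j \<in> ?J"
      then obtain d p b where j: "j = (d, p, b)" "p < nq M" "b < ns M" "i - d \<in> I"
        by (auto simp: K_def)
      have "buildable (n + l) ({} \<union> S t) (Suc (0 + 0)) {\<lambda>u. H t (i - d, p) u \<and> Y t (i - d, b) u}"
        by (intro buildable_and atH atY j)
      then show "buildable (n + l) ({} \<union> S t) 1 {\<lambda>u. case j of (d, p, b) \<Rightarrow> H t (i - d, p) u \<and> Y t (i - d, b) u}"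
        by (simp add: j)
    qed
    ultimately have "buildable (n + l) ({} \<union> S t) ?k
        {\<lambda>u. \<exists>j\<in>?J. case j of (d, p, b) \<Rightarrow> H t (i - d, p) u \<and> Y t (i - d, b) u}"
      by (elim buildable_le) simp
    then show "buildable (n + l) ({} \<union> S t) ?k {H (Suc t) (i, q)}"
    proof (rule buildable_cong)
      fix u :: word
      obtain p tp h where r: "run t u = (p, tp, h)" by (cases "run t u")
      obtain q' a' d where \<delta>: "halting_delta M p (tp h) = (q', a', d)" by (cases "halting_delta M p (tp h)")
      have b: "p < nq M" "tp h < ns M" "\<bar>h\<bar> \<le> int t"
        using inv[of t u] unfolding r by auto
      have d: "d \<in> {-1, 0, 1}" using halting_delta_valid[OF M b(1,2) \<delta>] by simp
      have hI: "h \<in> I" using b(3) t by (auto simp: I_def)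
      have "H (Suc t) (i, q) u \<longleftrightarrow> q' = q \<and> h + d = i"
        by (simp add: H_def run_Suc r \<delta>)
      also have "\<dots> \<longleftrightarrow> (d, p, tp h) \<in> ?J \<and> h + d = i"
        using b d hI \<delta> by (auto simp: K_def)
      also have "\<dots> \<longleftrightarrow> (\<exists>j\<in>?J. case j of (d, p, b) \<Rightarrow> H t (i - d, p) u \<and> Y t (i - d, b) u)"
      proof -
        have HY: "H t (i - d', p') u \<and> Y t (i - d', b') u \<longleftrightarrow> p' = p \<and> i = h + d' \<and> b' = tp h" for d' p' b'
          by (auto simp: H_def Y_def r)
        show ?thesis
        proof
          assume J: "(d, p, tp h) \<in> ?J \<and> h + d = i"
          have "H t (i - d, p) u \<and> Y t (i - d, tp h) u"
            unfolding HY using J by blast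
          then show "\<exists>j\<in>?J. case j of (d, p, b) \<Rightarrow> H t (i - d, p) u \<and> Y t (i - d, b) u"
            using J by (intro bexI[of _ "(d, p, tp h)"]) (simp_all only: prod.case)
        next
          assume "\<exists>j\<in>?J. case j of (d, p, b) \<Rightarrow> H t (i - d, p) u \<and> Y t (i - d, b) u"
          then obtain j where j: "j \<in> ?J" "case j of (d, p, b) \<Rightarrow> H t (i - d, p) u \<and> Y t (i - d, b) u"
            by (rule bexE)
          obtain d' p' b' where j_eq: "j = (d', p', b')" by (cases j)
          have eqs: "p' = p" "i = h + d'" "b' = tp h"
            using j(2) unfolding j_eq prod.case HY by blast+
          have "d' = d"
            using j(1) \<delta> unfolding j_eq eqs by simp
          then show "(d, p, tp h) \<in> ?J \<and> h + d = i"
            using j(1) eqs unfolding j_eq by simp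
        qed
      qed
      finally show "(\<exists>j\<in>?J. case j of (d, p, b) \<Rightarrow> H t (i - d, p) u \<and> Y t (i - d, b) u) = H (Suc t) (i, q) u" ..
    qed
  next
    fix i a assume i: "i \<in> I" and a: "a < ns M"
    \<comment> \<open>A cell keeps its symbol unless the head is on it; in that case its new symbol
      is the one written.\<close>
    let ?J = "({..<nq M} \<times> {..<ns M}) \<inter> {(p, b). \<exists>q d. halting_delta M p b = (q, a, d)}"
    have "buildable (n + l) ({} \<union> S t) (Suc (Suc (card {..<nq M} * (0 + 4) + 1) + 0) + (card ?J * (1 + 4) + 1) + 4)
        {\<lambda>u. (\<not> (\<exists>p\<in>{..<nq M}. H t (i, p) u) \<and> Y t (i, a) u) \<or>
             (\<exists>j\<in>?J. case j of (p, b) \<Rightarrow> H t (i, p) u \<and> Y t (i, b) u)}"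
    proof (intro buildable_or buildable_and buildable_not buildable_ex)
      show "buildable (n + l) ({} \<union> S t) 0 {H t (i, p)}" if "p \<in> {..<nq M}" for p
        using atH i that by simp
      show "buildable (n + l) ({} \<union> S t) 0 {Y t (i, a)}"
        using atY i a by simp
      show "buildable (n + l) ({} \<union> S t) 1 {\<lambda>u. case j of (p, b) \<Rightarrow> H t (i, p) u \<and> Y t (i, b) u}" if "j \<in> ?J" for j
      proof -
        obtain p b where j: "j = (p, b)" "p < nq M" "b < ns M" using that \<open>j \<in> ?J\<close> by auto
        have "buildable (n + l) ({} \<union> S t) (Suc (0 + 0)) {\<lambda>u. H t (i, p) u \<and> Y t (i, b) u}"
          by (intro buildable_and atH atY j i)
        then show ?thesis by (simp add: j)
      qed
    qed auto
    then have "buildable (n + l) ({} \<union> S t) ?k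
        {\<lambda>u. (\<not> (\<exists>p\<in>{..<nq M}. H t (i, p) u) \<and> Y t (i, a) u) \<or>
             (\<exists>j\<in>?J. case j of (p, b) \<Rightarrow> H t (i, p) u \<and> Y t (i, b) u)}"
      by (rule buildable_le) (use K'[of "{(p, b). \<exists>q d. halting_delta M p b = (q, a, d)}"] in simp)
    then show "buildable (n + l) ({} \<union> S t) ?k {Y (Suc t) (i, a)}"
    proof (rule buildable_cong)
      fix u :: word
      obtain p tp h where r: "run t u = (p, tp, h)" by (cases "run t u")
      obtain q' a' d where \<delta>: "halting_delta M p (tp h) = (q', a', d)" by (cases "halting_delta M p (tp h)")
      have b: "p < nq M" "tp h < ns M"
        using inv[of t u] unfolding r by auto
      have 1: "Y (Suc t) (i, a) u \<longleftrightarrow> (if h = i then a' = a else tp i = a)"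
        by (auto simp: Y_def run_Suc r \<delta>)
      have 2: "(\<exists>p\<in>{..<nq M}. H t (i, p) u) \<longleftrightarrow> h = i"
        using b by (auto simp: H_def r)
      have 3: "(\<exists>j\<in>?J. case j of (p, b) \<Rightarrow> H t (i, p) u \<and> Y t (i, b) u) \<longleftrightarrow> h = i \<and> a' = a"
      proof -
        have HY: "H t (i, p') u \<and> Y t (i, b') u \<longleftrightarrow> p' = p \<and> i = h \<and> b' = tp h" for p' b'
          by (auto simp: H_def Y_def r)
        have "(\<exists>j\<in>X. case j of (p, b) \<Rightarrow> H t (i, p) u \<and> Y t (i, b) u) \<longleftrightarrow> (p, tp h) \<in> X \<and> h = i" for X
          unfolding case_prod_beta HY by (auto intro: bexI[of _ "(p, tp h)"])
        then show ?thesis using b \<delta> by auto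
      qed
      show "((\<not> (\<exists>p\<in>{..<nq M}. H t (i, p) u) \<and> Y t (i, a) u) \<or>
             (\<exists>j\<in>?J. case j of (p, b) \<Rightarrow> H t (i, p) u \<and> Y t (i, b) u)) = Y (Suc t) (i, a) u"
        unfolding 1 2 3 by (auto simp: Y_def r)
    qed
  qed
  have "buildable (n + l) ({} \<union> S 0) (T * ((2 * T + 1) * (nq M + ns M) * ?k)) (S T)"
    by (rule buildable_iter) (rule step)
  from buildable_trans_drop[OF S0 this]
  have ST: "buildable (n + l) {} ((2 * T + 1) * (nq M + ns M) * 3 + T * ((2 * T + 1) * (nq M + ns M) * ?k)) (S T)" .
  have "buildable (n + l) ({} \<union> S T) (card I * (0 + 4) + 1) {\<lambda>u. \<exists>i\<in>I. H T (i, 1) u}"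
  proof (intro buildable_ex atH cardI)
    have "3 \<le> nq M" using M by (simp only: valid_tm_def)
    then show "1 < nq M" by simp
  qed
  from buildable_trans_drop[OF ST this]
  have "buildable (n + l) {} ((2 * T + 1) * (nq M + ns M) * 3 + T * ((2 * T + 1) * (nq M + ns M) * ?k)
      + (4 * (2 * T + 1) + 1)) {\<lambda>u. \<exists>i\<in>I. H T (i, 1) u}"
    by (rule buildable_le) (simp add: cardI)
  then show ?thesis
  proof (rule buildable_cong)
    fix u :: word
    have "snd (snd (run T u)) \<in> I"
      using inv(3)[of T u] by (auto simp: I_def)
    then show "(\<exists>i\<in>I. H T (i, 1) u) = tm_accepts_within M (tape_word n u) T"
      unfolding tm_accepts_within_iff by (auto simp: H_def run_def)
  qed
qed

section \<open>The main theorem\<close>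

lemma perceptron_size_mono:
  "D \<le> D' \<Longrightarrow> T \<le> T' \<Longrightarrow> perceptron_size D T a \<le> perceptron_size D' T' a"
  unfolding perceptron_size_def
  by (intro Suc_le_mono[THEN iffD2] add_mono mult_le_mono power_mono order_refl) auto

lemma lp_size_mono: "m \<le> m' \<Longrightarrow> k \<le> k' \<Longrightarrow> lp_size m k a \<le> lp_size m' k' a"
  unfolding lp_size_def
  by (intro perceptron_size_mono add_mono mult_le_mono power_mono order_refl) auto

lemma NP_subset_Ppoly_if_TSP_CF:
  assumes "TSP \<in> CF"
  shows "NP \<subseteq> Ppoly"
proof
  fix L assume "L \<in> NP"
  then obtain M pt q where M: "valid_tm M" and pt: "poly_bounded pt" and q: "poly_bounded q" and
    L: "\<And>x. x \<in> L \<longleftrightarrow> (\<exists>w. length w \<le> q (length x) \<and>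
        tm_accepts_within M (enc_bits x @ [3] @ enc_bits w) (pt (length x)))"
    unfolding NP_def by blast
  obtain p where "poly_bounded p" and
    p: "\<And>m. \<exists>A B b. conv (vec_of_word ` {x \<in> TSP. length x = m}) = proj_polyhedron m (p m) A B b"
    using assms unfolding CF_def by blast
  then obtain c e where ce: "\<And>m. p m \<le> c * m ^ e + c"
    unfolding poly_bounded_def by blast
  define s where "s n = (2 * pt n + 1) * (nq M + ns M) * 3 + pt n * ((2 * pt n + 1) * (nq M + ns M) *
      (10 * (3 * nq M * ns M) + 5 * nq M + 20)) + (4 * (2 * pt n + 1) + 1)" for n
  define mb where "mb n = (2 * ((n + q n + s n) * (24 * s n + 12) + 8 * s n + 1))\<^sup>2" for n
  \<comment> \<open>\<open>p\<close> need not be monotone, so it is replaced by its monotone bound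
    at the largest possible dimension \<open>mb n\<close>.\<close>
  define kb where "kb n = c * mb n ^ e + c" for n
  \<comment> \<open>Circuits have a fixed input length, hence one disjunct for every certificate
    length up to \<open>q n\<close>.\<close>
  define P where "P n = card {..q n} * (lp_size (mb n) (kb n) 3 + 4) + 1" for n
  have accept: "buildable n {} (lp_size (mb n) (kb n) 3)
      {\<lambda>x. \<exists>w. length w = l \<and> tm_accepts_within M (enc_bits x @ [3] @ enc_bits w) (pt n)}"
    if "l \<le> q n" for n l
  proof -
    have "computes (n + l) (s n) {\<lambda>u. tm_accepts_within M (tape_word n u) (pt n)}"
      unfolding s_def by (rule buildable_imp_computes[OF buildable_tm[OF M]])
    then obtain C where C: "C \<noteq> []" "length C \<le> s n"
      "\<And>u. length u = n + l \<Longrightarrow> circuit_eval C u = tm_accepts_within M (tape_word n u) (pt n)"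
      using computes_circuit by blast
    obtain m where m: "m \<le> (2 * ((n + l + length C) * (24 * length C + 12) + 8 * length C + 1))\<^sup>2"
      and g: "buildable n {} (lp_size m (p m) 3) {\<lambda>x. \<exists>w. length w = l \<and> circuit_eval C (x @ w)}"
      using buildable_exists_witness[OF C(1) p] by blast
    have "m \<le> mb n"
      using m unfolding mb_def
      by (rule order_trans) (use C(2) that in \<open>intro power_mono add_mono mult_le_mono order_refl; simp\<close>)
    moreover have "p m \<le> kb n"
      using ce[of m] unfolding kb_def
      by (rule order_trans) (use \<open>m \<le> mb n\<close> in \<open>intro add_mono mult_le_mono power_mono order_refl; simp\<close>)
    ultimately have "buildable n {} (lp_size (mb n) (kb n) 3) {\<lambda>x. \<exists>w. length w = l \<and> circuit_eval C (x @ w)}"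
      using buildable_le[OF g] lp_size_mono by blast
    then show ?thesis
    proof (rule buildable_cong)
      fix x :: word assume "length x = n"
      then have "circuit_eval C (x @ w) = tm_accepts_within M (enc_bits x @ [3] @ enc_bits w) (pt n)"
        if "length w = l" for w
        using C(3)[of "x @ w"] that by (simp add: tape_word_def)
      then show "(\<exists>w. length w = l \<and> circuit_eval C (x @ w)) =
          (\<exists>w. length w = l \<and> tm_accepts_within M (enc_bits x @ [3] @ enc_bits w) (pt n))"
        by blast
    qed
  qed
  have "\<exists>C. length C \<le> P n \<and> (\<forall>x. length x = n \<longrightarrow> (circuit_eval C x \<longleftrightarrow> x \<in> L))" for n
  proof -
    have "buildable n {} (P n)
      {\<lambda>x. \<exists>l\<in>{..q n}. \<exists>w. length w = l \<and> tm_accepts_within M (enc_bits x @ [3] @ enc_bits w) (pt n)}"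
      unfolding P_def by (rule buildable_ex) (use accept in auto)
    from computes_circuit[OF buildable_imp_computes[OF this]] obtain C where "length C \<le> P n"
      "\<And>x. length x = n \<Longrightarrow> circuit_eval C x =
        (\<exists>l\<in>{..q n}. \<exists>w. length w = l \<and> tm_accepts_within M (enc_bits x @ [3] @ enc_bits w) (pt n))"
      by blast
    then show ?thesis
      by (intro exI[of _ C]) (auto simp: L)
  qed
  moreover have "poly_bounded P"
  proof -
    have s: "poly_bounded s"
      unfolding s_def
      by (intro poly_bounded_add poly_bounded_mult poly_bounded_power poly_bounded_const pt)
    have mb: "poly_bounded mb"
      unfolding mb_def
      by (intro poly_bounded_add poly_bounded_mult poly_bounded_power poly_bounded_const poly_bounded_id s q)
    have kb: "poly_bounded kb"
      unfolding kb_def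
      by (intro poly_bounded_add poly_bounded_mult poly_bounded_power poly_bounded_const mb)
    show ?thesis
      unfolding P_def lp_size_def perceptron_size_def card_atMost Suc_eq_plus1
      by (intro poly_bounded_add poly_bounded_mult poly_bounded_power poly_bounded_const mb kb q)
  qed
  ultimately show "L \<in> Ppoly"
    unfolding Ppoly_def by blast
qed

theorem theorem9:
  assumes "\<not> NP \<subseteq> Ppoly"
  shows "TSP \<notin> CF"
  using NP_subset_Ppoly_if_TSP_CF assms by blast

end
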